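(* Let $\Gamma$ be a word-hyperbolic group and let $\mathcal{A}\Gamma$ be an unconditional Banach algebra over $\mathbb{C}\Gamma$. Then: (a) The canonical quasiderivation $\Delta_{(S,\sigma)}$ associated to any choice of (finite symmetric) generating set $S$ and minimal presentation $\sigma$ is closable, as an unbounded operator from $\mathcal{A}\Gamma$ to $\mathcal{A}\Gamma\otimes_{uc}\mathcal{A}\Gamma$ with domain $\mathbb{C}\Gamma$. (b) The domain $\mathcal{A}^1\Gamma$ of the (closed) canonical quasiderivation is independent of the choice of $S$ and $\sigma$. (c) $\mathcal{A}^1\Gamma$ is an unconditional Banach algebra over $\mathbb{C}\Gamma$. (d) The canonical inclusion $\mathcal{A}^1\Gamma\hookrightarrow\mathcal{A}\Gamma$ is a homomorphism of Banach algebras and identifies $\mathcal{A}^1\Gamma$ with a dense and holomorphically closed subalgebra of $\mathcal{A}\Gamma$.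
   Context: For a set $X$, $\mathbb{C}X$ is the complex vector space with basis $(u_x)_{x\in X}$; for $a=\sum a_xu_x$ put $|a|=\sum|a_x|u_x$, and write $|a|\le|b|$ if $|a_x|\le|b_x|$ for all $x$. A seminorm on $\mathbb{C}X$ is unconditional if $|a|\le|b|$ implies $\|a\|\le\|b\|$. An unconditional Banach algebra over the group ring $\mathbb{C}\Gamma$ is a Banach algebra obtained from $\mathbb{C}\Gamma$ by completion with respect to an unconditional seminorm; it contains $\mathbb{C}\Gamma$ as a dense subalgebra. (Algebra norms are considered up to equivalence.) Canonical quasiderivation: for a finite symmetric generating set $S$ of $\Gamma$, a minimal presentation is a map $\sigma:\Gamma\to\bigcup_nS^n$ assigning to each $g$ a word of minimal length in the alphabet $S$ representing $g$. If $\sigma(g)=(s_1,\dots,s_n)$, then $\Delta_{(S,\sigma)}:\mathbb{C}\Gamma\to\mathbb{C}\Gamma\otimes\mathbb{C}\Gamma$ is the linear map with $$\Delta_{(S,\sigma)}(u_g)=\sum_{i=0}^nu_{s_1\cdots s_i}\otimes u_{s_{i+1}\cdots s_n}.$$ $\mathcal{A}\Gamma\otimes_{uc}\mathcal{A}\Gamma$ is the completion of the algebraic tensor product with respect to the unconditional cross-norm, which on $\mathbb{C}\Gamma\otimes\mathbb{C}\Gamma\simeq\mathbb{C}(\Gamma\times\Gamma)$ is $\|\gamma\|_{uc}=\inf\sum_{i\in I}\|\alpha_i'\|\,\|\alpha_i''\|$, the infimum over all finite families $\alpha_i',\alpha_i''\in\mathbb{C}\Gamma$ with $|\gamma|\le\sum_i|\alpha_i'|\otimes|\alpha_i''|$.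 $\mathcal{A}^1\Gamma$ is the closure of $\mathbb{C}\Gamma$ in the graph norm of $\Delta_{(S,\sigma)}$, viewed as unbounded operator from $\mathcal{A}\Gamma$ to $\mathcal{A}\Gamma\otimes_{uc}\mathcal{A}\Gamma$. A dense subalgebra of a Banach algebra is holomorphically closed if the spectra of its elements in both algebras agree. *)

theory Defs
  imports "HOL-Analysis.Analysis" "HOL-Library.Poly_Mapping"
begin

section \<open>The vector spaces \<open>\<complex>X\<close> and unconditional seminorms\<close>

text \<open>
  \<open>\<complex>X\<close> is \<^typ>\<open>'x \<Rightarrow>\<^sub>0 complex\<close>, the finitely supported functions on the type \<^typ>\<open>'x\<close>, and
  \<open>\<complex>X \<otimes> \<complex>Y\<close> is identified with \<open>\<complex>(X \<times> Y)\<close>. A group \<open>\<Gamma>\<close> is a type of class \<^class>\<open>group_add\<close>: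
  it is written additively but is \<^emph>\<open>not\<close> assumed to be commutative. With this convention the
  library's convolution product on \<^typ>\<open>'g \<Rightarrow>\<^sub>0 complex\<close> is the product of the group ring \<open>\<complex>\<Gamma>\<close>,
  and \<open>s\<^sub>1\<cdots>s\<^sub>n\<close> is \<open>sum_list [s\<^sub>1,\<dots>,s\<^sub>n]\<close>.
\<close>

abbreviation basis_vec :: "'x \<Rightarrow> 'x \<Rightarrow>\<^sub>0 complex" where
  "basis_vec x \<equiv> Poly_Mapping.single x 1"

definition cscale :: "complex \<Rightarrow> ('x \<Rightarrow>\<^sub>0 complex) \<Rightarrow> 'x \<Rightarrow>\<^sub>0 complex" where
  "cscale c a = Poly_Mapping.map ((*) c) a"

definition cabs :: "('x \<Rightarrow>\<^sub>0 complex) \<Rightarrow> 'x \<Rightarrow>\<^sub>0 complex" where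
  "cabs a = Poly_Mapping.map (\<lambda>z. complex_of_real (cmod z)) a"

text \<open>The relation \<open>|a| \<le> |b|\<close>.\<close>

definition abs_le :: "('x \<Rightarrow>\<^sub>0 complex) \<Rightarrow> ('x \<Rightarrow>\<^sub>0 complex) \<Rightarrow> bool" where
  "abs_le a b \<longleftrightarrow>
     (\<forall>x. cmod (Poly_Mapping.lookup a x) \<le> cmod (Poly_Mapping.lookup b x))"

definition ctensor ::
  "('x \<Rightarrow>\<^sub>0 complex) \<Rightarrow> ('y \<Rightarrow>\<^sub>0 complex) \<Rightarrow> ('x \<times> 'y) \<Rightarrow>\<^sub>0 complex" where
  "ctensor a b =
     (\<Sum>x\<in>Poly_Mapping.keys a. \<Sum>y\<in>Poly_Mapping.keys b.
        Poly_Mapping.single (x, y) (Poly_Mapping.lookup a x * Poly_Mapping.lookup b y))"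

definition seminorm :: "(('x \<Rightarrow>\<^sub>0 complex) \<Rightarrow> real) \<Rightarrow> bool" where
  "seminorm q \<longleftrightarrow>
     (\<forall>a. 0 \<le> q a) \<and> (\<forall>a b. q (a + b) \<le> q a + q b) \<and> (\<forall>c a. q (cscale c a) = cmod c * q a)"

definition unconditional_seminorm :: "(('x \<Rightarrow>\<^sub>0 complex) \<Rightarrow> real) \<Rightarrow> bool" where
  "unconditional_seminorm q \<longleftrightarrow> seminorm q \<and> (\<forall>a b. abs_le a b \<longrightarrow> q a \<le> q b)"


section \<open>Complex Banach spaces and Banach algebras carried by a subset of a type\<close>

text \<open>
  The carrier and the norm are explicit because a subalgebra has to be considered with a norm
  of its own. The norm \<open>p\<close> on a carrier \<open>V\<close> is irrelevant outside \<open>V\<close>.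
\<close>

definition norm_dist :: "'v::ab_group_add set \<Rightarrow> ('v \<Rightarrow> real) \<Rightarrow> 'v \<Rightarrow> 'v \<Rightarrow> real" where
  "norm_dist V p x y = (if x \<in> V \<and> y \<in> V then p (x - y) else 0)"

abbreviation norm_topology :: "'v::ab_group_add set \<Rightarrow> ('v \<Rightarrow> real) \<Rightarrow> 'v topology" where
  "norm_topology V p \<equiv> Metric_space.mtopology V (norm_dist V p)"

definition complex_normed_space ::
  "(complex \<Rightarrow> 'v::ab_group_add \<Rightarrow> 'v) \<Rightarrow> 'v set \<Rightarrow> ('v \<Rightarrow> real) \<Rightarrow> bool" where
  "complex_normed_space sc V p \<longleftrightarrow>
     vector_space sc \<and> module.subspace sc V \<and>
     (\<forall>x\<in>V. 0 \<le> p x) \<and> (\<forall>x\<in>V. p x = 0 \<longrightarrow> x = 0) \<and>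
     (\<forall>x\<in>V. \<forall>y\<in>V. p (x + y) \<le> p x + p y) \<and>
     (\<forall>c. \<forall>x\<in>V. p (sc c x) = cmod c * p x)"

definition complex_banach_space ::
  "(complex \<Rightarrow> 'v::ab_group_add \<Rightarrow> 'v) \<Rightarrow> 'v set \<Rightarrow> ('v \<Rightarrow> real) \<Rightarrow> bool" where
  "complex_banach_space sc V p \<longleftrightarrow>
     complex_normed_space sc V p \<and> Metric_space.mcomplete V (norm_dist V p)"

lemma Metric_space_norm_dist:
  assumes "complex_normed_space sc V p"
  shows "Metric_space V (norm_dist V p)"
proof -
  interpret vector_space sc
    using assms by (simp add: complex_normed_space_def)
  have V: "subspace V" and nonneg: "\<And>x. x \<in> V \<Longrightarrow> 0 \<le> p x"
    and zero: "\<And>x. x \<in> V \<Longrightarrow> p x = 0 \<Longrightarrow> x = 0"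
    and add: "\<And>x y. x \<in> V \<Longrightarrow> y \<in> V \<Longrightarrow> p (x + y) \<le> p x + p y"
    and hom: "\<And>c x. x \<in> V \<Longrightarrow> p (sc c x) = cmod c * p x"
    using assms by (auto simp: complex_normed_space_def)
  have p0: "p 0 = 0"
    using hom[of 0 0] subspace_0[OF V] by simp
  have minus: "p (x - y) = p (y - x)" if "x \<in> V" "y \<in> V" for x y
    using hom[of "x - y" "-1"] subspace_diff[OF V] that by simp
  show ?thesis
  proof
    show "0 \<le> norm_dist V p x y" for x y
      using nonneg subspace_diff[OF V] by (simp add: norm_dist_def)
    show "norm_dist V p x y = norm_dist V p y x" for x y
      using minus by (simp add: norm_dist_def)
    show "(norm_dist V p x y = 0) = (x = y)" if "x \<in> V" "y \<in> V" for x y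
      using that zero[of "x - y"] subspace_diff[OF V] p0 by (auto simp: norm_dist_def)
    show "norm_dist V p x z \<le> norm_dist V p x y + norm_dist V p y z"
      if "x \<in> V" "y \<in> V" "z \<in> V" for x y z
      using that add[of "x - y" "y - z"] subspace_diff[OF V] by (simp add: norm_dist_def)
  qed
qed

definition complex_algebra :: "(complex \<Rightarrow> 'a::ring_1 \<Rightarrow> 'a) \<Rightarrow> bool" where
  "complex_algebra sc \<longleftrightarrow>
     vector_space sc \<and>
     (\<forall>c x y. sc c (x * y) = sc c x * y \<and> sc c (x * y) = x * sc c y)"

definition unital_subalgebra :: "(complex \<Rightarrow> 'a::ring_1 \<Rightarrow> 'a) \<Rightarrow> 'a set \<Rightarrow> bool" where
  "unital_subalgebra sc B \<longleftrightarrow>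
     module.subspace sc B \<and> 1 \<in> B \<and> (\<forall>x\<in>B. \<forall>y\<in>B. x * y \<in> B)"

text \<open>
  Algebra norms are considered up to equivalence, so the product is only required to be bounded;
  rescaling \<open>p\<close> by the constant \<open>C\<close> makes it submultiplicative.
\<close>

definition complex_banach_algebra ::
  "(complex \<Rightarrow> 'a::ring_1 \<Rightarrow> 'a) \<Rightarrow> 'a set \<Rightarrow> ('a \<Rightarrow> real) \<Rightarrow> bool" where
  "complex_banach_algebra sc B p \<longleftrightarrow>
     complex_algebra sc \<and> unital_subalgebra sc B \<and> complex_banach_space sc B p \<and>
     (\<exists>C. \<forall>x\<in>B. \<forall>y\<in>B. p (x * y) \<le> C * p x * p y)"

definition banach_algebra_hom ::
  "(complex \<Rightarrow> 'a::ring_1 \<Rightarrow> 'a) \<Rightarrow> 'a set \<Rightarrow> ('a \<Rightarrow> real) \<Rightarrow>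
   (complex \<Rightarrow> 'b::ring_1 \<Rightarrow> 'b) \<Rightarrow> 'b set \<Rightarrow> ('b \<Rightarrow> real) \<Rightarrow> ('a \<Rightarrow> 'b) \<Rightarrow> bool" where
  "banach_algebra_hom sc B p sc' B' p' f \<longleftrightarrow>
     complex_banach_algebra sc B p \<and> complex_banach_algebra sc' B' p' \<and>
     f ` B \<subseteq> B' \<and> f 1 = 1 \<and>
     (\<forall>x\<in>B. \<forall>y\<in>B. f (x + y) = f x + f y \<and> f (x * y) = f x * f y) \<and>
     (\<forall>c. \<forall>x\<in>B. f (sc c x) = sc' c (f x)) \<and>
     (\<exists>C. \<forall>x\<in>B. p' (f x) \<le> C * p x)"

definition equivalent_norms :: "'v set \<Rightarrow> ('v \<Rightarrow> real) \<Rightarrow> ('v \<Rightarrow> real) \<Rightarrow> bool" where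
  "equivalent_norms V p p' \<longleftrightarrow> (\<exists>C. \<forall>x\<in>V. p x \<le> C * p' x \<and> p' x \<le> C * p x)"

definition spectrum_in ::
  "(complex \<Rightarrow> 'a::ring_1 \<Rightarrow> 'a) \<Rightarrow> 'a set \<Rightarrow> 'a \<Rightarrow> complex set" where
  "spectrum_in sc B x =
     {c. \<not> (\<exists>y\<in>B. y * (x - sc c 1) = 1 \<and> (x - sc c 1) * y = 1)}"

definition holomorphically_closed ::
  "(complex \<Rightarrow> 'a::ring_1 \<Rightarrow> 'a) \<Rightarrow> 'a set \<Rightarrow> 'a set \<Rightarrow> bool" where
  "holomorphically_closed sc B A \<longleftrightarrow>
     (\<forall>x\<in>B. spectrum_in sc B x = spectrum_in sc A x)"


section \<open>Unconditional Banach algebras over group rings\<close>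

text \<open>\<open>(V, p)\<close>, with structure map \<open>\<iota>\<close>, is the (Hausdorff) completion of \<open>\<complex>X\<close> in the seminorm \<open>q\<close>.\<close>

definition completion_of ::
  "(complex \<Rightarrow> 'v::ab_group_add \<Rightarrow> 'v) \<Rightarrow> 'v set \<Rightarrow> ('v \<Rightarrow> real) \<Rightarrow>
   (('x \<Rightarrow>\<^sub>0 complex) \<Rightarrow> 'v) \<Rightarrow> (('x \<Rightarrow>\<^sub>0 complex) \<Rightarrow> real) \<Rightarrow> bool" where
  "completion_of sc V p \<iota> q \<longleftrightarrow>
     complex_banach_space sc V p \<and> Vector_Spaces.linear cscale sc \<iota> \<and>
     range \<iota> \<subseteq> V \<and> (\<forall>a. p (\<iota> a) = q a) \<and> norm_topology V p closure_of range \<iota> = V"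

definition unconditional_banach_algebra ::
  "(complex \<Rightarrow> 'a::ring_1 \<Rightarrow> 'a) \<Rightarrow> 'a set \<Rightarrow> ('a \<Rightarrow> real) \<Rightarrow>
   (('g::group_add \<Rightarrow>\<^sub>0 complex) \<Rightarrow> 'a) \<Rightarrow> bool" where
  "unconditional_banach_algebra sc B p \<iota> \<longleftrightarrow>
     complex_banach_algebra sc B p \<and>
     (\<exists>q. unconditional_seminorm q \<and> completion_of sc B p \<iota> q) \<and>
     \<iota> 1 = 1 \<and> (\<forall>a b. \<iota> (a * b) = \<iota> a * \<iota> b) \<and> inj \<iota>"


section \<open>The unconditional tensor product\<close>

definition uc_norm ::
  "(('x \<Rightarrow>\<^sub>0 complex) \<Rightarrow> real) \<Rightarrow> (('x \<times> 'x) \<Rightarrow>\<^sub>0 complex) \<Rightarrow> real" where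
  "uc_norm q \<gamma> =
     Inf {(\<Sum>(a, b)\<leftarrow>F. q a * q b) | F.
            abs_le \<gamma> (\<Sum>(a, b)\<leftarrow>F. ctensor (cabs a) (cabs b))}"

text \<open>The map \<open>\<complex>(X \<times> X) \<cong> \<complex>X \<otimes> \<complex>X \<rightarrow> T\<close> induced by \<open>\<iota> : \<complex>X \<rightarrow> A\<close> and the bilinear map
  \<open>tens : A \<times> A \<rightarrow> T\<close>.\<close>

definition tensor_incl ::
  "(complex \<Rightarrow> 't::ab_group_add \<Rightarrow> 't) \<Rightarrow> ('a \<Rightarrow> 'a \<Rightarrow> 't) \<Rightarrow> (('x \<Rightarrow>\<^sub>0 complex) \<Rightarrow> 'a) \<Rightarrow>
   (('x \<times> 'x) \<Rightarrow>\<^sub>0 complex) \<Rightarrow> 't" where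
  "tensor_incl scaleT tens \<iota> \<gamma> =
     (\<Sum>z\<in>Poly_Mapping.keys \<gamma>.
        scaleT (Poly_Mapping.lookup \<gamma> z) (tens (\<iota> (basis_vec (fst z))) (\<iota> (basis_vec (snd z)))))"

text \<open>
  The Banach space \<open>(T, normT)\<close> is, through the bilinear map \<open>tens\<close>, the completion of the
  algebraic tensor product of \<open>(A, normA)\<close> with itself in the unconditional cross-norm. Here
  \<open>A\<close> and \<open>T\<close> are whole types. Since \<open>\<complex>X\<close> is dense in \<open>A\<close>, the values on \<open>\<complex>X \<otimes> \<complex>X\<close> together with
  the cross-norm property determine the norm on the algebraic tensor product.
\<close>

definition uc_tensor_completion ::
  "(complex \<Rightarrow> 'a::ab_group_add \<Rightarrow> 'a) \<Rightarrow> ('a \<Rightarrow> real) \<Rightarrow> (('x \<Rightarrow>\<^sub>0 complex) \<Rightarrow> 'a) \<Rightarrow>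
   (complex \<Rightarrow> 't::ab_group_add \<Rightarrow> 't) \<Rightarrow> ('t \<Rightarrow> real) \<Rightarrow> ('a \<Rightarrow> 'a \<Rightarrow> 't) \<Rightarrow> bool" where
  "uc_tensor_completion scaleA normA \<iota> scaleT normT tens \<longleftrightarrow>
     complex_banach_space scaleT UNIV normT \<and>
     (\<forall>x. Vector_Spaces.linear scaleA scaleT (tens x)) \<and>
     (\<forall>y. Vector_Spaces.linear scaleA scaleT (\<lambda>x. tens x y)) \<and>
     norm_topology UNIV normT closure_of (module.span scaleT {tens x y | x y. True}) = UNIV \<and>
     (\<forall>x y. normT (tens x y) = normA x * normA y) \<and>
     (\<forall>\<gamma>. normT (tensor_incl scaleT tens \<iota> \<gamma>) = uc_norm (\<lambda>a. normA (\<iota> a)) \<gamma>)"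


section \<open>Word metrics and hyperbolicity\<close>

definition fin_sym_generating :: "'g::group_add set \<Rightarrow> bool" where
  "fin_sym_generating S \<longleftrightarrow>
     finite S \<and> (\<forall>s\<in>S. - s \<in> S) \<and> (\<forall>g. \<exists>w. set w \<subseteq> S \<and> sum_list w = g)"

definition word_length :: "'g::group_add set \<Rightarrow> 'g \<Rightarrow> nat" where
  "word_length S g = (LEAST n. \<exists>w. set w \<subseteq> S \<and> sum_list w = g \<and> length w = n)"

definition word_dist :: "'g::group_add set \<Rightarrow> 'g \<Rightarrow> 'g \<Rightarrow> real" where
  "word_dist S g h = real (word_length S (- g + h))"

definition gromov_product :: "('x \<Rightarrow> 'x \<Rightarrow> real) \<Rightarrow> 'x \<Rightarrow> 'x \<Rightarrow> 'x \<Rightarrow> real" where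
  "gromov_product d w x y = (d w x + d w y - d x y) / 2"

text \<open>Gromov's definition: the group with the word metric of some finite symmetric generating
  set is a hyperbolic metric space.\<close>

definition word_hyperbolic :: "'g::group_add itself \<Rightarrow> bool" where
  "word_hyperbolic _ \<longleftrightarrow>
     (\<exists>(S :: 'g set) \<delta>. fin_sym_generating S \<and>
        (\<forall>w x y z. gromov_product (word_dist S) w x z \<ge>
           min (gromov_product (word_dist S) w x y) (gromov_product (word_dist S) w y z) - \<delta>))"


section \<open>The canonical quasiderivation and its closure\<close>

definition minimal_presentation :: "'g::group_add set \<Rightarrow> ('g \<Rightarrow> 'g list) \<Rightarrow> bool" where
  "minimal_presentation S \<sigma> \<longleftrightarrow>
     (\<forall>g. set (\<sigma> g) \<subseteq> S \<and> sum_list (\<sigma> g) = g \<and> length (\<sigma> g) = word_length S g)"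

definition quasiderivation ::
  "('g::group_add \<Rightarrow> 'g list) \<Rightarrow> ('g \<Rightarrow>\<^sub>0 complex) \<Rightarrow> ('g \<times> 'g) \<Rightarrow>\<^sub>0 complex" where
  "quasiderivation \<sigma> a =
     (\<Sum>g\<in>Poly_Mapping.keys a. cscale (Poly_Mapping.lookup a g)
        (\<Sum>i = 0..length (\<sigma> g).
           ctensor (basis_vec (sum_list (take i (\<sigma> g)))) (basis_vec (sum_list (drop i (\<sigma> g))))))"

text \<open>
  The closure in \<open>A \<times> T\<close> of the graph of the quasiderivation, viewed as an unbounded operator from
  \<open>A\<close> to \<open>T\<close> with domain \<open>\<complex>\<Gamma>\<close>. The operator is closable iff this relation is
  single-valued; it is then the graph of the closed quasiderivation, and its domain is the closure
  of \<open>\<complex>\<Gamma>\<close> in the graph norm.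
\<close>

definition quasiderivation_closure ::
  "('a::ab_group_add \<Rightarrow> real) \<Rightarrow> (('g::group_add \<Rightarrow>\<^sub>0 complex) \<Rightarrow> 'a) \<Rightarrow>
   (complex \<Rightarrow> 't::ab_group_add \<Rightarrow> 't) \<Rightarrow> ('t \<Rightarrow> real) \<Rightarrow> ('a \<Rightarrow> 'a \<Rightarrow> 't) \<Rightarrow>
   ('g \<Rightarrow> 'g list) \<Rightarrow> ('a \<times> 't) set" where
  "quasiderivation_closure normA \<iota> scaleT normT tens \<sigma> =
     prod_topology (norm_topology UNIV normA) (norm_topology UNIV normT) closure_of
       range (\<lambda>a. (\<iota> a, tensor_incl scaleT tens \<iota> (quasiderivation \<sigma> a)))"

definition graph_norm ::
  "('a \<Rightarrow> real) \<Rightarrow> ('t \<Rightarrow> real) \<Rightarrow> ('a \<times> 't) set \<Rightarrow> 'a \<Rightarrow> real" where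
  "graph_norm normA normT R x = normA x + normT (THE y. (x, y) \<in> R)"

end

theory Submission
  imports Defs
begin

text \<open>
  The quasiderivation has a very simple description in coordinates. With \<open>P(g)\<close> the set of prefixes
  of the word \<open>\<sigma>(g)\<close>, the coefficient of \<open>\<Delta>(a)\<close> at \<open>(h, k)\<close> is \<open>a(h + k)\<close> if \<open>h \<in> P(h + k)\<close>, and \<open>0\<close>
  otherwise (\<open>lookup_quasiderivation\<close>): distinct prefixes of a geodesic word represent distinct
  elements. All norms in sight are unconditional, so every inequality between them can be checked
  coefficientwise on absolute values.

  \<^bold>\<open>Closability.\<close> If \<open>a\<^sub>n \<rightarrow> 0\<close> and \<open>\<Delta>(a\<^sub>n) \<rightarrow> y\<close>, then every coefficient of \<open>\<Delta>(a\<^sub>n)\<close> tends to \<open>0\<close>. In an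
  unconditional norm a Cauchy sequence whose coefficients tend to \<open>0\<close> is a null sequence, since
  deleting a finite set of coefficients does not increase the norm; hence \<open>y = 0\<close> (\<open>closable\<close>).

  \<^bold>\<open>Geometry.\<close> Hyperbolicity enters through two facts about prefixes. Geodesics for two generating sets
  are quasigeodesics for a third one, for which the metric is hyperbolic; by stability of
  quasigeodesics each prefix of \<open>\<sigma>(g)\<close> is a prefix of \<open>\<sigma>'(g)\<close> up to right translation by one of finitely many
  elements (\<open>prefixes_close\<close>). Since triangles are thin, each prefix of \<open>\<sigma>(g\<^sub>1 + g\<^sub>2)\<close> is, up to such a
  translation, a prefix of \<open>\<sigma>(g\<^sub>1)\<close> or \<open>g\<^sub>1\<close> plus a prefix of \<open>\<sigma>(g\<^sub>2)\<close> (\<open>thin_presentation_exists\<close>).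
  Right translation by \<open>r\<close> in the first factor of the tensor product, combined with left translation by
  \<open>-r\<close> in the second, is bounded for the cross-norm. Thus the first fact gives
  \<open>\<parallel>\<Delta>(a)\<parallel> \<le> K \<parallel>\<Delta>'(a)\<parallel>\<close> (\<open>uc_quasiderivation_comparison\<close>), so the domain does not depend on the
  choices, and the second gives the Leibniz inequality
  \<open>\<parallel>\<Delta>(ab)\<parallel> \<le> M (\<parallel>\<Delta>(a)\<parallel> \<parallel>b\<parallel> + \<parallel>a\<parallel> \<parallel>\<Delta>(b)\<parallel>)\<close> (\<open>uc_quasiderivation_leibniz\<close>), so that the
  graph norm is an algebra norm.

  \<^bold>\<open>Spectra.\<close> The constant \<open>M\<close> may exceed \<open>1\<close>, but it does little harm under repeated squaring:
  \<open>\<parallel>\<Delta>(w\<^sup>2)\<parallel> \<le> 2 M \<parallel>w\<parallel> \<parallel>\<Delta>(w)\<parallel>\<close>, and if \<open>\<parallel>w\<parallel>\<close> is small the norms of \<open>w, w\<^sup>2, w\<^sup>4, \<dots>\<close> eventually beat \<open>2 M\<close>.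
  So these powers tend to \<open>0\<close> in the graph norm, \<open>1 - w\<close> divides an element \<open>1 - w\<^sup>N\<close>, with \<open>N\<close> a power of two,
  that a Neumann series inverts, and therefore \<open>1 - w\<close> is invertible in the subalgebra (\<open>right_inverse_A1\<close>). An
  element \<open>y\<close> with inverse \<open>v\<close> in the big algebra is reduced to this case by approximating \<open>v\<close> by an
  element \<open>z\<close> of the group ring and putting \<open>w = 1 - y z\<close> (\<open>inverse_in_A1\<close>).
\<close>

section \<open>Quasigeodesics in hyperbolic metrics\<close>

lemma linear_less_power2: "\<exists>k0. \<forall>k\<ge>k0. a + b * real k < 2 ^ k"
proof -
  have "(\<lambda>k. a * (1/2)^k + b * (real k / 2 ^ k)) \<longlonglongrightarrow> a * 0 + b * 0"
    by (intro tendsto_intros lim_n_over_pown LIMSEQ_realpow_zero) auto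
  then have "\<forall>\<^sub>F k in sequentially. a * (1/2)^k + b * (real k / 2 ^ k) < 1"
    by (intro order_tendstoD) auto
  then have "\<forall>\<^sub>F k in sequentially. a + b * real k < 2 ^ k"
    by eventually_elim (simp add: field_simps power_divide)
  then show ?thesis by (simp add: eventually_sequentially)
qed

locale hyperbolic_metric =
  fixes d :: "'x \<Rightarrow> 'x \<Rightarrow> real" and \<delta> :: real
  assumes refl: "d x x = 0"
    and sym: "d x y = d y x"
    and triangle: "d x z \<le> d x y + d y z"
    and four_point: "min (gromov_product d w x y) (gromov_product d w y z) - \<delta> \<le> gromov_product d w x z"
begin

lemma nonneg: "0 \<le> d x y"
  using triangle[of x x y] sym[of x y] refl[of x] by simp

lemma delta_nonneg: "0 \<le> \<delta>"
  using four_point[of x x x x for x] by (simp add: gromov_product_def refl)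

lemma gromov_commute: "gromov_product d w x y = gromov_product d w y x"
  by (simp add: gromov_product_def sym)

text \<open>
  The four-point condition loses one \<open>\<delta>\<close> for every halving of a chain, so the loss is only logarithmic
  in the length of the chain. This is the form in which exponential divergence of geodesics is used below.
\<close>

lemma chain_product:
  assumes "\<And>l. i \<le> l \<Longrightarrow> l \<le> j \<Longrightarrow> m \<le> d y (p l)"
    and "\<And>l. i \<le> l \<Longrightarrow> l < j \<Longrightarrow> m \<le> gromov_product d y (p l) (p (Suc l))"
    and "i \<le> j" "j - i \<le> 2 ^ k"
  shows "m - real k * \<delta> \<le> gromov_product d y (p i) (p j)"
  using assms
proof (induction k arbitrary: i j)
  case 0
  then consider "j = i" | "j = Suc i" by fastforce
  then show ?case
  proof cases
    case 1
    with "0.prems"(1)[of i] show ?thesis by (simp add: gromov_product_def refl)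
  next
    case 2
    with "0.prems"(2)[of i] show ?thesis by simp
  qed
next
  case (Suc k)
  define h where "h = i + (j - i) div 2"
  have h: "i \<le> h" "h \<le> j" "h - i \<le> 2 ^ k" "j - h \<le> 2 ^ k"
    using Suc.prems(3,4) by (auto simp: h_def)
  have "m - real k * \<delta> \<le> gromov_product d y (p i) (p h)"
    by (rule Suc.IH) (use Suc.prems h in auto)
  moreover have "m - real k * \<delta> \<le> gromov_product d y (p h) (p j)"
    by (rule Suc.IH) (use Suc.prems h in auto)
  ultimately show ?case
    using four_point[of y "p i" "p h" "p j"] by (simp add: algebra_simps)
qed

text \<open>
  A point \<open>y\<close> at which the endpoints of a geodesic have a small Gromov product is close to the geodesic. The
  witness is the point where the internal circle of the triangle touches it, rounded to an integer
  parameter.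
\<close>

lemma thin_triangle:
  assumes c: "\<And>i j. i \<le> n \<Longrightarrow> j \<le> n \<Longrightarrow> d (c i) (c j) = \<bar>real i - real j\<bar>"
  shows "\<exists>i\<le>n. d y (c i) \<le> gromov_product d y (c 0) (c n) + 1 + 2 * \<delta>"
proof -
  (* t is the Gromov product of y and c n at c 0, i.e. the parameter of the tangent point. *)
  define t where "t = (d y (c 0) + real n - d y (c n)) / 2"
  have n: "d (c 0) (c n) = n" using c[of 0 n] by simp
  have t0: "0 \<le> t"
    using triangle[of y "c n" "c 0"] n by (simp add: t_def)
  have tn: "t \<le> n"
    using triangle[of y "c 0" "c n"] n by (simp add: t_def sym)
  define i where "i = nat \<lfloor>t\<rfloor>"
  have i: "real i \<le> t" "t < real i + 1" "i \<le> n"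
    using t0 tn by (auto simp: i_def) linarith
  have di: "d (c 0) (c i) = i" "d (c i) (c n) = real n - real i"
    using c[of 0 i] c[of i n] i(3) by auto
  have "d y (c i) \<le> gromov_product d y (c 0) (c n) + 1 + 2 * \<delta>"
    using four_point[of y "c 0" "c i" "c n"] i(1,2) di n
    by (simp add: gromov_product_def t_def min_def field_simps split: if_splits)
  with i show ?thesis by blast
qed

text \<open>
  The key step towards stability of quasigeodesics. Let \<open>y = c j\<close> be a point of the geodesic at the
  maximal distance \<open>D\<close> from the path \<open>p\<close>. Leave the geodesic at the two points at distance about \<open>2 D\<close>
  from \<open>y\<close> and connect them through \<open>p\<close>. The detour stays at distance about \<open>D\<close> from \<open>y\<close> and uses
  \<open>O(D)\<close> points of \<open>p\<close>, whereas its endpoints have Gromov product \<open>0\<close> at \<open>y\<close>. By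
  \<open>chain_product\<close>, \<open>D\<close> is at most a constant plus \<open>\<delta>\<close> times the logarithm of \<open>D\<close>.
\<close>

lemma distance_le_log:
  assumes c: "\<And>i j. i \<le> m \<Longrightarrow> j \<le> m \<Longrightarrow> d (c i) (c j) = \<bar>real i - real j\<bar>"
    and step: "\<And>i. i < n \<Longrightarrow> d (p i) (p (Suc i)) \<le> K"
    and qi: "\<And>i j. i \<le> n \<Longrightarrow> j \<le> n \<Longrightarrow> \<bar>real i - real j\<bar> \<le> K * d (p i) (p j)"
    and ends: "c 0 = p 0" "c m = p n"
    and K: "0 \<le> K"
    and far: "\<And>i. i \<le> n \<Longrightarrow> D \<le> d (c j) (p i)"
    and near: "\<And>j. j \<le> m \<Longrightarrow> \<exists>i\<le>n. d (c j) (p i) \<le> D"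
    and D: "0 \<le> D" and j: "j \<le> m" and k: "K * (6 * D + 2) \<le> 2 ^ k"
  shows "D \<le> K / 2 + (real k + 2) * \<delta>"
proof -
  define y where "y = c j"
  define L where "L = nat \<lceil>2 * D\<rceil>"
  have L: "2 * D \<le> real L" "real L \<le> 2 * D + 1"
    using D unfolding L_def by linarith+
  (* The point at parameter j - L, or the common starting point of c and p if the geodesic is too short;
     in the second case the starting point is its own nearest point on the path. *)
  have side1: "\<exists>j'\<le>j. \<exists>i\<le>n. D \<le> gromov_product d y (c j') (p i) \<and> d y (c j') \<le> L \<and> d (c j') (p i) \<le> D"
  proof (cases "j < L")
    case True
    have "D \<le> gromov_product d y (c 0) (p 0)"
      using far[of 0] ends by (simp add: gromov_product_def refl y_def)
    moreover have "d y (c 0) \<le> L" using c[of j 0] j True by (simp add: y_def)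
    moreover have "d (c 0) (p 0) \<le> D" using ends D refl by simp
    ultimately show ?thesis by blast
  next
    case False
    then have y1: "d y (c (j - L)) = L" using c[of j "j - L"] j by (simp add: y_def)
    obtain i where i: "i \<le> n" "d (c (j - L)) (p i) \<le> D" using near[of "j - L"] j by (auto simp: le_diff_conv)
    have "D \<le> gromov_product d y (c (j - L)) (p i)"
      using y1 i far[OF i(1)] L by (simp add: gromov_product_def y_def)
    with y1 i show ?thesis by (intro exI[of _ "j - L"]) auto
  qed
  (* The same towards the other end. *)
  have side2: "\<exists>j'\<ge>j. j' \<le> m \<and> (\<exists>i\<le>n. D \<le> gromov_product d y (c j') (p i) \<and> d y (c j') \<le> L \<and> d (c j') (p i) \<le> D)"
  proof (cases "m < j + L")
    case True
    have "D \<le> gromov_product d y (c m) (p n)"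
      using far[of n] ends by (simp add: gromov_product_def refl y_def)
    moreover have "d y (c m) \<le> L" using c[of j m] j True by (simp add: y_def)
    moreover have "d (c m) (p n) \<le> D" using ends D refl by simp
    ultimately show ?thesis using j by blast
  next
    case False
    then have y1: "d y (c (j + L)) = L" using c[of j "j + L"] j by (simp add: y_def)
    obtain i where i: "i \<le> n" "d (c (j + L)) (p i) \<le> D" using near[of "j + L"] False by auto
    have "D \<le> gromov_product d y (c (j + L)) (p i)"
      using y1 i far[OF i(1)] L by (simp add: gromov_product_def y_def)
    with y1 i False show ?thesis by (intro exI[of _ "j + L"]) auto
  qed
  obtain j1 i1 where 1: "j1 \<le> j" "i1 \<le> n" "D \<le> gromov_product d y (c j1) (p i1)" "d y (c j1) \<le> L"
      "d (c j1) (p i1) \<le> D"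
    using side1 by blast
  obtain j2 i2 where 2: "j \<le> j2" "j2 \<le> m" "i2 \<le> n" "D \<le> gromov_product d y (c j2) (p i2)"
      "d y (c j2) \<le> L" "d (c j2) (p i2) \<le> D"
    using side2 by blast
  have on: "gromov_product d y (c j1) (c j2) = 0"
    using c[of j j1] c[of j j2] c[of j1 j2] 1 2 by (simp add: gromov_product_def y_def)
  have "d (p i1) (p i2) \<le> 6 * D + 2"
    using triangle[of "p i1" "p i2" "c j1"] triangle[of "c j1" "p i2" y] triangle[of y "p i2" "c j2"]
      sym[of "p i1" "c j1"] sym[of "c j1" y] 1 2 L by linarith
  then have "\<bar>real i1 - real i2\<bar> \<le> K * (6 * D + 2)"
    using qi[OF 1(2) 2(3)] mult_left_mono[OF _ K] by (meson order_trans)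
  then have len: "\<bar>real i1 - real i2\<bar> \<le> 2 ^ k" using k by linarith
  have mid: "D - K / 2 - real k * \<delta> \<le> gromov_product d y (p a) (p b)"
    if "a \<le> b" "b \<le> n" "\<bar>real a - real b\<bar> \<le> 2 ^ k" for a b
  proof (rule chain_product)
    show "a \<le> b" by fact
    have "real (b - a) \<le> real (2 ^ k)" using that by simp
    then show "b - a \<le> 2 ^ k" by (simp only: of_nat_le_iff)
    show "D - K / 2 \<le> d y (p l)" if "l \<le> b" for l
      using far[of l] that \<open>b \<le> n\<close> K by (simp add: y_def)
    show "D - K / 2 \<le> gromov_product d y (p l) (p (Suc l))" if "l < b" for l
      using far[of l] far[of "Suc l"] step[of l] that \<open>b \<le> n\<close> by (simp add: gromov_product_def y_def)
  qed
  have mid': "D - K / 2 - real k * \<delta> \<le> gromov_product d y (p i1) (p i2)"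
    using mid[of i1 i2] mid[of i2 i1] len 1 2 gromov_commute by (cases "i1 \<le> i2") auto
  have kd: "0 \<le> real k * \<delta>" using delta_nonneg by simp
  have "gromov_product d y (p i1) (c j2) \<le> \<delta> \<or> gromov_product d y (c j1) (p i1) \<le> \<delta>"
    using four_point[of y "c j1" "p i1" "c j2"] on by (auto simp: min_le_iff_disj)
  moreover have "D - K / 2 - real k * \<delta> - \<delta> \<le> gromov_product d y (p i1) (c j2)"
    using four_point[of y "p i1" "p i2" "c j2"] mid' 2(4) gromov_commute[of y "c j2" "p i2"] K kd
    by (auto simp: min_def split: if_splits)
  ultimately have "D \<le> K / 2 + real k * \<delta> + 2 * \<delta>"
    using 1(3) K kd delta_nonneg by linarith
  then show ?thesis by (simp add: algebra_simps)
qed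

text \<open>
  The bound of \<open>distance_le_log\<close> is linear in \<open>k\<close> whereas the least admissible \<open>k\<close> has
  \<open>2 ^ k\<close> linear in the distance, so only finitely many \<open>k\<close> can occur and the distance is bounded
  in terms of \<open>K\<close> and \<open>\<delta>\<close> alone.
\<close>

lemma geodesic_near_quasigeodesic:
  assumes K: "0 \<le> K"
  shows "\<exists>R. \<forall>c m p n. (\<forall>i j. i \<le> m \<longrightarrow> j \<le> m \<longrightarrow> d (c i) (c j) = \<bar>real i - real j\<bar>) \<longrightarrow>
    (\<forall>i<n. d (p i) (p (Suc i)) \<le> K) \<longrightarrow>
    (\<forall>i j. i \<le> n \<longrightarrow> j \<le> n \<longrightarrow> \<bar>real i - real j\<bar> \<le> K * d (p i) (p j)) \<longrightarrow>
    c 0 = p 0 \<longrightarrow> c m = p n \<longrightarrow> (\<forall>j\<le>m. \<exists>i\<le>n. d (c j) (p i) \<le> R)"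
proof -
  obtain k0 where k0: "\<And>k. k \<ge> k0 \<Longrightarrow>
      K * (6 * (K / 2 + 3 * \<delta>) + 2) + (K * 6 * \<delta>) * real k < 2 ^ k"
    using linear_less_power2 by blast
  define R where "R = K / 2 + (real k0 + 2) * \<delta>"
  show ?thesis
  proof (intro exI[of _ R] allI impI)
    fix c m p n j0
    assume c: "\<forall>i j. i \<le> m \<longrightarrow> j \<le> m \<longrightarrow> d (c i) (c j) = \<bar>real i - real j\<bar>"
      and step: "\<forall>i<n. d (p i) (p (Suc i)) \<le> K"
      and qi: "\<forall>i j. i \<le> n \<longrightarrow> j \<le> n \<longrightarrow> \<bar>real i - real j\<bar> \<le> K * d (p i) (p j)"
      and ends: "c 0 = p 0" "c m = p n" and j0: "j0 \<le> m"
    define f where "f j = Min ((\<lambda>i. d (c j) (p i)) ` {..n})" for j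
    define D where "D = Max (f ` {..m})"
    have f_le: "f j \<le> d (c j) (p i)" if "i \<le> n" for i j
      using that by (auto simp: f_def intro!: Min_le)
    have f_ex: "\<exists>i\<le>n. d (c j) (p i) = f j" for j
    proof -
      have "f j \<in> (\<lambda>i. d (c j) (p i)) ` {..n}" unfolding f_def by (rule Min_in) auto
      then show ?thesis by auto
    qed
    have f_D: "f j \<le> D" if "j \<le> m" for j
      using that by (auto simp: D_def intro!: Max_ge)
    have "D \<in> f ` {..m}" unfolding D_def by (rule Max_in) auto
    then obtain j where j: "j \<le> m" "D = f j" by auto
    have D0: "0 \<le> D" using f_ex[of j] nonneg j by metis
    have bound: "D \<le> K / 2 + (real k + 2) * \<delta>" if "K * (6 * D + 2) \<le> 2 ^ k" for k
    proof (rule distance_le_log[where c = c and p = p and n = n and m = m and j = j])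
      show "D \<le> d (c j) (p i)" if "i \<le> n" for i using f_le that j by simp
      show "\<exists>i\<le>n. d (c j) (p i) \<le> D" if "j \<le> m" for j using f_ex[of j] f_D[OF that] by auto
    qed (use c step qi ends K D0 j that in auto)
    have "D \<le> R"
    proof -
      have ex_k: "\<exists>k. K * (6 * D + 2) \<le> 2 ^ k"
        using real_arch_pow[of 2 "K * (6 * D + 2)"] by (auto intro: less_imp_le)
      define k where "k = (LEAST k. K * (6 * D + 2) \<le> 2 ^ k)"
      have k: "K * (6 * D + 2) \<le> 2 ^ k"
        unfolding k_def using ex_k by (rule LeastI_ex)
      have "k \<le> k0"
      proof (rule ccontr)
        assume "\<not> k \<le> k0"
        then obtain k' where k': "k = Suc k'" "k' \<ge> k0" by (cases k) auto
        then have "\<not> K * (6 * D + 2) \<le> 2 ^ k'"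
          unfolding k_def using not_less_Least[of k' "\<lambda>k. K * (6 * D + 2) \<le> 2 ^ k"] k_def by simp
        moreover have "K * (6 * D + 2) \<le> K * (6 * (K / 2 + (real k + 2) * \<delta>) + 2)"
          using bound[OF k] K by (intro mult_left_mono) auto
        ultimately show False using k0[OF k'(2)] k'(1) by (simp add: algebra_simps)
      qed
      then show ?thesis using bound[OF k] mult_right_mono[OF _ delta_nonneg, of "real k + 2" "real k0 + 2"]
        by (simp add: R_def)
    qed
    then show "\<exists>i\<le>n. d (c j0) (p i) \<le> R"
      using f_ex[of j0] f_D[OF j0] by force
  qed
qed

text \<open>
  The converse half of stability, by connectedness: walking along the geodesic, the near points
  of the path pass from the part before \<open>p i\<close> to the part after it. At the change of sides two path
  points on either side of \<open>p i\<close> are close to each other, hence their parameters are close to \<open>i\<close>.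
\<close>

lemma quasigeodesic_near_geodesic:
  assumes K: "0 \<le> K"
    and c: "\<And>i j. i \<le> m \<Longrightarrow> j \<le> m \<Longrightarrow> d (c i) (c j) = \<bar>real i - real j\<bar>"
    and lip: "\<And>i j. i \<le> n \<Longrightarrow> j \<le> n \<Longrightarrow> d (p i) (p j) \<le> K * \<bar>real i - real j\<bar>"
    and qi: "\<And>i j. i \<le> n \<Longrightarrow> j \<le> n \<Longrightarrow> \<bar>real i - real j\<bar> \<le> K * d (p i) (p j)"
    and ends: "c 0 = p 0" "c m = p n"
    and near: "\<And>j. j \<le> m \<Longrightarrow> \<exists>i\<le>n. d (c j) (p i) \<le> R"
    and i: "i \<le> n"
  shows "\<exists>j\<le>m. d (p i) (c j) \<le> K * (K * (2 * R + 1)) + R"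
proof -
  have R: "0 \<le> R" using near[of 0] nonneg order_trans by blast
  define Q where "Q j \<longleftrightarrow> (\<exists>a\<le>i. d (c j) (p a) \<le> R)" for j
  have "Q 0" using ends R refl by (auto simp: Q_def intro!: exI[of _ 0])
  have "\<exists>j\<le>m. Q j \<and> (\<exists>b\<ge>i. b \<le> n \<and> (\<exists>j'\<le>m. d (c j) (c j') \<le> 1 \<and> d (c j') (p b) \<le> R))"
  proof (cases "Q m")
    case True
    then show ?thesis using ends R refl i by (intro exI[of _ m] conjI exI[of _ n]) auto
  next
    case False
    define j where "j = (LEAST j. \<not> Q j)"
    have nj: "\<not> Q j" unfolding j_def by (rule LeastI[of _ m]) (rule False)
    have jm: "j \<le> m" unfolding j_def by (rule Least_le) (rule False)
    obtain j' where j': "j = Suc j'" using nj \<open>Q 0\<close> by (cases j) auto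
    have "Q j'" using not_less_Least[of j' "\<lambda>j. \<not> Q j"] j' j_def by auto
    obtain b where b: "b \<le> n" "d (c j) (p b) \<le> R" using near[OF jm] by blast
    have "i \<le> b" using nj b by (meson Q_def nat_le_linear)
    moreover have "d (c j') (c j) \<le> 1" using c[of j' j] jm j' by simp
    ultimately show ?thesis using \<open>Q j'\<close> b jm j' by (intro exI[of _ j'] conjI exI[of _ b] exI[of _ j]) auto
  qed
  then obtain j j' a b where jj: "j \<le> m" "a \<le> i" "d (c j) (p a) \<le> R" "i \<le> b" "b \<le> n"
      "d (c j) (c j') \<le> 1" "d (c j') (p b) \<le> R" unfolding Q_def by blast
  have "d (p a) (p b) \<le> 2 * R + 1"
    using triangle[of "p a" "p b" "c j"] triangle[of "c j" "p b" "c j'"] jj sym[of "p a" "c j"] by linarith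
  then have "\<bar>real a - real b\<bar> \<le> K * (2 * R + 1)"
    using qi[of a b] jj mult_left_mono[OF _ K] by (meson order_trans)
  then have "\<bar>real i - real a\<bar> \<le> K * (2 * R + 1)" using jj by linarith
  then have "d (p i) (p a) \<le> K * (K * (2 * R + 1))"
    using lip[of i a] i jj mult_left_mono[OF _ K] by (meson order_trans)
  then have "d (p i) (c j) \<le> K * (K * (2 * R + 1)) + R"
    using triangle[of "p i" "c j" "p a"] sym[of "p a" "c j"] jj by simp
  with jj show ?thesis by blast
qed

end

section \<open>Prefixes of geodesic words\<close>

lemma word_length_le: "set w \<subseteq> S \<Longrightarrow> sum_list w = g \<Longrightarrow> word_length S g \<le> length w"
  unfolding word_length_def by (rule Least_le) blast

lemma minimal_word_exists:
  assumes "fin_sym_generating S"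
  shows "\<exists>w. set w \<subseteq> S \<and> sum_list w = g \<and> length w = word_length S g"
proof -
  have "\<exists>n w. set w \<subseteq> S \<and> sum_list w = g \<and> length w = n"
    using assms by (auto simp: fin_sym_generating_def)
  from LeastI_ex[OF this] show ?thesis by (simp add: word_length_def)
qed

lemma minimal_presentation_exists:
  assumes "fin_sym_generating S"
  shows "\<exists>\<sigma>. minimal_presentation S \<sigma>"
  using minimal_word_exists[OF assms] unfolding minimal_presentation_def by metis

lemma word_length_0: "word_length S 0 = 0"
  using word_length_le[of "[]" S 0] by simp

lemma word_length_add:
  assumes "fin_sym_generating S"
  shows "word_length S (g + h) \<le> word_length S g + word_length S h"
proof -
  obtain v w where "set v \<subseteq> S" "sum_list v = g" "length v = word_length S g"
    "set w \<subseteq> S" "sum_list w = h" "length w = word_length S h"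
    using minimal_word_exists[OF assms] by metis
  then show ?thesis using word_length_le[of "v @ w" S "g + h"] by simp
qed

lemma sum_list_rev_uminus: "sum_list (rev (map uminus w)) = - sum_list (w :: 'g::group_add list)"
  by (induction w) (auto simp: minus_add)

lemma word_length_uminus:
  assumes S: "fin_sym_generating S"
  shows "word_length S (- g) = word_length S g"
proof -
  have le: "word_length S (- g) \<le> word_length S g" for g
  proof -
    obtain w where w: "set w \<subseteq> S" "sum_list w = g" "length w = word_length S g"
      using minimal_word_exists[OF S] by metis
    then have "set (rev (map uminus w)) \<subseteq> S"
      using S by (auto simp: fin_sym_generating_def)
    then show ?thesis
      using word_length_le[of "rev (map uminus w)" S "- g"] w by (simp add: sum_list_rev_uminus del: rev_map)
  qed
  from le[of g] le[of "- g"] show ?thesis by simp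
qed

lemma word_length_uminus_add:
  assumes "fin_sym_generating S"
  shows "word_length S (- g + h) = word_length S (- h + g)"
  using word_length_uminus[OF assms, of "- g + h"] by (simp add: minus_add)

text \<open>
  Word metrics of different finite generating sets are bi-Lipschitz equivalent; this is why geodesics for
  one of them are quasigeodesics for the other.
\<close>

lemma word_length_linear_bound:
  assumes S: "fin_sym_generating S" and S': "fin_sym_generating S'"
  shows "\<exists>K\<ge>0. \<forall>g. real (word_length S g) \<le> K * real (word_length S' g)"
proof -
  define K where "K = (\<Sum>s\<in>S'. word_length S s)"
  have K: "word_length S s \<le> K" if "s \<in> S'" for s
    unfolding K_def by (rule member_le_sum) (use that S' in \<open>auto simp: fin_sym_generating_def\<close>)
  have words: "word_length S (sum_list w) \<le> K * length w" if "set w \<subseteq> S'" for w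
    using that
  proof (induction w)
    case (Cons s w)
    then show ?case
      using word_length_add[OF S, of s "sum_list w"] K[of s] by simp
  qed (simp add: word_length_0)
  have "word_length S g \<le> K * word_length S' g" for g
    using minimal_word_exists[OF S', of g] words by metis
  then show ?thesis by (intro exI[of _ "real K"]) (auto simp flip: of_nat_mult)
qed

lemma ball_finite:
  assumes "fin_sym_generating S"
  shows "finite {g. word_length S g \<le> n}"
proof (rule finite_subset)
  show "{g. word_length S g \<le> n} \<subseteq> sum_list ` {w. set w \<subseteq> S \<and> length w \<le> n}"
  proof
    fix g assume "g \<in> {g. word_length S g \<le> n}"
    moreover obtain w where "set w \<subseteq> S" "sum_list w = g" "length w = word_length S g"
      using minimal_word_exists[OF assms] by metis
    ultimately show "g \<in> sum_list ` {w. set w \<subseteq> S \<and> length w \<le> n}" by auto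
  qed
  show "finite (sum_list ` {w. set w \<subseteq> S \<and> length w \<le> n})"
    using assms by (auto simp: fin_sym_generating_def intro: finite_lists_length_le)
qed

lemma sum_list_take_drop: "sum_list (take i w) + sum_list (drop i w) = sum_list (w :: 'g::group_add list)"
  by (metis append_take_drop_id sum_list.append)

definition prefixes_of :: "('g::group_add \<Rightarrow> 'g list) \<Rightarrow> 'g \<Rightarrow> 'g set" where
  "prefixes_of \<sigma> g = {sum_list (take i (\<sigma> g)) | i. i \<le> length (\<sigma> g)}"

text \<open>
  A subword between two positions of a minimal word is again minimal, since a shorter one could be
  substituted into the whole word.
\<close>

lemma minimal_presentation_dist:
  assumes S: "fin_sym_generating S" and \<sigma>: "minimal_presentation S \<sigma>"
    and i: "i \<le> length (\<sigma> g)" "j \<le> length (\<sigma> g)"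
  shows "word_dist S (sum_list (take i (\<sigma> g))) (sum_list (take j (\<sigma> g))) = \<bar>real i - real j\<bar>"
proof -
  define w where "w = \<sigma> g"
  have w: "set w \<subseteq> S" "length w = word_length S (sum_list w)"
    using \<sigma> by (auto simp: w_def minimal_presentation_def)
  have main: "word_dist S (sum_list (take i w)) (sum_list (take j w)) = real (j - i)"
    if ij: "i \<le> j" "j \<le> length w" for i j
  proof -
    define v where "v = take (j - i) (drop i w)"
    have eq: "take j w = take i w @ v"
      using ij by (metis v_def le_add_diff_inverse take_add)
    have v: "- sum_list (take i w) + sum_list (take j w) = sum_list v"
      by (simp add: eq add.assoc[symmetric])
    have sv: "set v \<subseteq> S" using w(1) unfolding v_def by (meson in_set_dropD in_set_takeD subset_iff)
    have le: "word_length S (sum_list v) \<le> j - i"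
      using word_length_le[OF sv refl] ij by (simp add: v_def)
    have "word_length S (sum_list w)
        \<le> word_length S (sum_list (take i w)) + word_length S (sum_list v) + word_length S (sum_list (drop j w))"
      using word_length_add[OF S, of "sum_list (take i w) + sum_list v" "sum_list (drop j w)"]
        word_length_add[OF S, of "sum_list (take i w)" "sum_list v"] sum_list_take_drop[of j w]
      by (simp add: eq)
    moreover have "word_length S (sum_list (take i w)) \<le> i"
      using word_length_le[of "take i w" S] w(1) by (metis in_set_takeD length_take min.bounded_iff order_refl subset_iff)
    moreover have "word_length S (sum_list (drop j w)) \<le> length w - j"
      using word_length_le[of "drop j w" S] w(1) by (metis in_set_dropD length_drop subset_iff)
    ultimately have "word_length S (sum_list v) = j - i"
      using le w(2) ij by linarith
    then show ?thesis by (simp add: word_dist_def v)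
  qed
  show ?thesis
  proof (cases "i \<le> j")
    case True
    then show ?thesis using main[of i j] i by (simp add: w_def)
  next
    case False
    then show ?thesis using main[of j i] i word_length_uminus_add[OF S]
      by (simp add: w_def word_dist_def)
  qed
qed

text \<open>Two families of paths are close when prefixes move by one of finitely many group elements.\<close>

lemma hyperbolic_metric_word_dist:
  assumes S: "fin_sym_generating S"
    and hyp: "\<forall>w x y z. gromov_product (word_dist S) w x z \<ge>
           min (gromov_product (word_dist S) w x y) (gromov_product (word_dist S) w y z) - \<delta>"
  shows "hyperbolic_metric (word_dist S) \<delta>"
proof
  show "word_dist S x x = 0" for x by (simp add: word_dist_def word_length_0)
  show "word_dist S x y = word_dist S y x" for x y
    by (simp add: word_dist_def word_length_uminus_add[OF S, of x])
  show "word_dist S x z \<le> word_dist S x y + word_dist S y z" for x y z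
    using word_length_add[OF S, of "- x + y" "- y + z"] by (simp add: word_dist_def add.assoc)
qed (use hyp in blast)

text \<open>
  Stability of quasigeodesics in the hyperbolic word metric of \<open>S\<close>, applied to the \<open>S'\<close>-geodesic
  \<open>\<sigma>'(g)\<close> and the \<open>S\<close>-geodesic \<open>\<sigma>(g)\<close>, with constants that do not depend on \<open>g\<close>.
\<close>

lemma prefixes_close_both:
  assumes S: "fin_sym_generating S" and hyp: "hyperbolic_metric (word_dist S) \<delta>"
    and \<sigma>: "minimal_presentation S \<sigma>"
    and S': "fin_sym_generating S'" and \<sigma>': "minimal_presentation S' \<sigma>'"
  shows "\<exists>R. \<forall>g. (\<forall>h\<in>prefixes_of \<sigma> g. \<exists>h'\<in>prefixes_of \<sigma>' g. word_dist S h h' \<le> R) \<and>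
    (\<forall>h'\<in>prefixes_of \<sigma>' g. \<exists>h\<in>prefixes_of \<sigma> g. word_dist S h' h \<le> R)"
proof -
  interpret hyperbolic_metric "word_dist S" \<delta> by fact
  obtain K1 where K1: "K1 \<ge> 0" "\<And>g. real (word_length S g) \<le> K1 * real (word_length S' g)"
    using word_length_linear_bound[OF S S'] by blast
  obtain K2 where K2: "K2 \<ge> 0" "\<And>g. real (word_length S' g) \<le> K2 * real (word_length S g)"
    using word_length_linear_bound[OF S' S] by blast
  define K where "K = max K1 K2"
  have K: "0 \<le> K" using K1(1) by (simp add: K_def)
  have dK: "word_dist S x y \<le> K * word_dist S' x y" "word_dist S' x y \<le> K * word_dist S x y" for x y
    using K1(2)[of "- x + y"] K2(2)[of "- x + y"]
      mult_right_mono[of K1 K "real (word_length S' (- x + y))"]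
      mult_right_mono[of K2 K "real (word_length S (- x + y))"]
    by (auto simp: word_dist_def K_def)
  obtain R where R: "\<And>c m p n. (\<forall>i j. i \<le> m \<longrightarrow> j \<le> m \<longrightarrow> word_dist S (c i) (c j) = \<bar>real i - real j\<bar>) \<Longrightarrow>
    (\<forall>i<n. word_dist S (p i) (p (Suc i)) \<le> K) \<Longrightarrow>
    (\<forall>i j. i \<le> n \<longrightarrow> j \<le> n \<longrightarrow> \<bar>real i - real j\<bar> \<le> K * word_dist S (p i) (p j)) \<Longrightarrow>
    c 0 = p 0 \<Longrightarrow> c m = p n \<Longrightarrow> (\<forall>j\<le>m. \<exists>i\<le>n. word_dist S (c j) (p i) \<le> R)"
    using geodesic_near_quasigeodesic[OF K] by blast
  show ?thesis
  proof (intro exI allI conjI ballI)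
    fix g
    define m n where "m = length (\<sigma> g)" and "n = length (\<sigma>' g)"
    define c p where "c = (\<lambda>i. sum_list (take i (\<sigma> g)))" and "p = (\<lambda>i. sum_list (take i (\<sigma>' g)))"
    have c: "word_dist S (c i) (c j) = \<bar>real i - real j\<bar>" if "i \<le> m" "j \<le> m" for i j
      using minimal_presentation_dist[OF S \<sigma>] that by (simp add: c_def m_def)
    have p: "word_dist S' (p i) (p j) = \<bar>real i - real j\<bar>" if "i \<le> n" "j \<le> n" for i j
      using minimal_presentation_dist[OF S' \<sigma>'] that by (simp add: p_def n_def)
    have lip: "word_dist S (p i) (p j) \<le> K * \<bar>real i - real j\<bar>" if "i \<le> n" "j \<le> n" for i j
      using dK(1)[of "p i" "p j"] p[OF that] by simp
    have qi: "\<bar>real i - real j\<bar> \<le> K * word_dist S (p i) (p j)" if "i \<le> n" "j \<le> n" for i j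
      using dK(2)[of "p i" "p j"] p[OF that] by simp
    have ends: "c 0 = p 0" "c m = p n"
      using \<sigma> \<sigma>' by (auto simp: c_def p_def m_def n_def minimal_presentation_def)
    have near: "\<forall>j\<le>m. \<exists>i\<le>n. word_dist S (c j) (p i) \<le> R"
    proof (rule R)
      show "\<forall>i<n. word_dist S (p i) (p (Suc i)) \<le> K"
        using lip[of i "Suc i" for i] by (auto intro!: order_trans[OF lip])
    qed (use c qi ends in auto)
    have R0: "0 \<le> R" using near nonneg order_trans by blast
    have P: "prefixes_of \<sigma> g = c ` {..m}" "prefixes_of \<sigma>' g = p ` {..n}"
      by (auto simp: prefixes_of_def c_def p_def m_def n_def)
    have R_le: "R \<le> K * (K * (2 * R + 1)) + R" using K R0 by simp
    show "\<exists>h'\<in>prefixes_of \<sigma>' g. word_dist S h h' \<le> K * (K * (2 * R + 1)) + R"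
      if h: "h \<in> prefixes_of \<sigma> g" for h
    proof -
      obtain j where j: "j \<le> m" "h = c j" using P h by auto
      then obtain i where "i \<le> n" "word_dist S h (p i) \<le> R" using near by blast
      with R_le P show ?thesis by (intro bexI[of _ "p i"]) auto
    qed
    show "\<exists>h'\<in>prefixes_of \<sigma> g. word_dist S h h' \<le> K * (K * (2 * R + 1)) + R"
      if h: "h \<in> prefixes_of \<sigma>' g" for h
    proof -
      obtain i where i: "i \<le> n" "h = p i" using P h by auto
      have "\<exists>j\<le>m. word_dist S (p i) (c j) \<le> K * (K * (2 * R + 1)) + R"
        by (rule quasigeodesic_near_geodesic[OF K c lip qi ends _ i(1)]) (use near in auto)
      then show ?thesis using P i by auto
    qed
  qed
qed

text \<open>
  Neither \<open>S\<close> nor \<open>S'\<close> is assumed to be the generating set for which the four-point condition was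
  given, so the comparison goes through a presentation for that set. Bounded distance turns into
  membership in a finite set because balls of the word metric are finite.
\<close>

lemma prefixes_close:
  assumes hyp: "word_hyperbolic TYPE('g::group_add)"
    and "fin_sym_generating S" "minimal_presentation S (\<sigma> :: 'g \<Rightarrow> 'g list)"
    and "fin_sym_generating S'" "minimal_presentation S' \<sigma>'"
  shows "\<exists>B. finite B \<and> (\<forall>g. \<forall>h\<in>prefixes_of \<sigma> g. \<exists>h'\<in>prefixes_of \<sigma>' g. - h' + h \<in> B)"
proof -
  obtain S0 :: "'g set" and \<delta> where S0: "fin_sym_generating S0" and "hyperbolic_metric (word_dist S0) \<delta>"
    using hyp hyperbolic_metric_word_dist unfolding word_hyperbolic_def by blast
  then interpret hyperbolic_metric "word_dist S0" \<delta> by simp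
  obtain \<sigma>0 where \<sigma>0: "minimal_presentation S0 \<sigma>0" using minimal_presentation_exists[OF S0] by blast
  obtain R where R: "\<And>g h. h \<in> prefixes_of \<sigma> g \<Longrightarrow> \<exists>h'\<in>prefixes_of \<sigma>0 g. word_dist S0 h h' \<le> R"
    using prefixes_close_both[OF S0 hyperbolic_metric_axioms \<sigma>0 assms(2,3)] by blast
  obtain R' where R': "\<And>g h. h \<in> prefixes_of \<sigma>0 g \<Longrightarrow> \<exists>h'\<in>prefixes_of \<sigma>' g. word_dist S0 h h' \<le> R'"
    using prefixes_close_both[OF S0 hyperbolic_metric_axioms \<sigma>0 assms(4,5)] by blast
  have "\<exists>h'\<in>prefixes_of \<sigma>' g. - h' + h \<in> {r. word_length S0 r \<le> nat \<lceil>R + R'\<rceil>}" if h: "h \<in> prefixes_of \<sigma> g" for g h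
  proof -
    obtain h0 h' where "h' \<in> prefixes_of \<sigma>' g" "word_dist S0 h h0 \<le> R" "word_dist S0 h0 h' \<le> R'"
      using R[OF h] R' by blast
    moreover from this have "word_dist S0 h' h \<le> R + R'" using triangle[of h h' h0] sym[of h h'] by linarith
    ultimately show ?thesis by (intro bexI[of _ h']) (auto simp: word_dist_def, linarith)
  qed
  with ball_finite[OF S0] show ?thesis by blast
qed

text \<open>
  Thinness of the geodesic triangle with vertices \<open>0\<close>, \<open>g\<^sub>1\<close> and \<open>g\<^sub>1 + g\<^sub>2\<close>. A point \<open>h\<close> of the
  side from \<open>0\<close> to \<open>g\<^sub>1 + g\<^sub>2\<close> sees its endpoints with Gromov product \<open>0\<close>, so by the four-point condition it
  sees one of the other two sides with Gromov product at most \<open>\<delta>\<close>.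
\<close>

lemma thin_presentation_exists:
  assumes hyp: "word_hyperbolic TYPE('g::group_add)"
  shows "\<exists>S \<sigma>0 B. fin_sym_generating S \<and> minimal_presentation S (\<sigma>0 :: 'g \<Rightarrow> 'g list) \<and> finite B \<and>
    (\<forall>g1 g2. \<forall>h\<in>prefixes_of \<sigma>0 (g1 + g2).
       (\<exists>h'\<in>prefixes_of \<sigma>0 g1. - h' + h \<in> B) \<or> (\<exists>h'\<in>prefixes_of \<sigma>0 g2. - (g1 + h') + h \<in> B))"
proof -
  obtain S0 :: "'g set" and \<delta> where S0: "fin_sym_generating S0" and "hyperbolic_metric (word_dist S0) \<delta>"
    using hyp hyperbolic_metric_word_dist unfolding word_hyperbolic_def by blast
  then interpret hyperbolic_metric "word_dist S0" \<delta> by simp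
  obtain \<sigma>0 where \<sigma>0: "minimal_presentation S0 \<sigma>0" using minimal_presentation_exists[OF S0] by blast
  define B where "B = {r. word_length S0 r \<le> nat \<lceil>1 + 3 * \<delta>\<rceil>}"
  have B: "- h' + h \<in> B" if "word_dist S0 h h' \<le> 1 + 3 * \<delta>" for h h'
    using that sym[of h h'] unfolding B_def word_dist_def by (auto, linarith)
  have "(\<exists>h'\<in>prefixes_of \<sigma>0 g1. - h' + h \<in> B) \<or> (\<exists>h'\<in>prefixes_of \<sigma>0 g2. - (g1 + h') + h \<in> B)"
    if h: "h \<in> prefixes_of \<sigma>0 (g1 + g2)" for g1 g2 h
  proof -
    have sum: "sum_list (\<sigma>0 g) = g" for g using \<sigma>0 by (simp add: minimal_presentation_def)
    obtain i where i: "i \<le> length (\<sigma>0 (g1 + g2))" "h = sum_list (take i (\<sigma>0 (g1 + g2)))"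
      using h by (auto simp: prefixes_of_def)
    (* h lies on a geodesic from 0 to g1 + g2. *)
    have "gromov_product (word_dist S0) h 0 (g1 + g2) = 0"
      using minimal_presentation_dist[OF S0 \<sigma>0, of 0 "g1 + g2" i]
        minimal_presentation_dist[OF S0 \<sigma>0, of i "g1 + g2" "length (\<sigma>0 (g1 + g2))"]
        minimal_presentation_dist[OF S0 \<sigma>0, of 0 "g1 + g2" "length (\<sigma>0 (g1 + g2))"] i sum sym[of h 0]
      by (simp add: gromov_product_def)
    then consider "gromov_product (word_dist S0) h 0 g1 \<le> \<delta>" | "gromov_product (word_dist S0) h g1 (g1 + g2) \<le> \<delta>"
      using four_point[of h 0 g1 "g1 + g2"] by (auto simp: min_le_iff_disj)
    then show ?thesis
    proof cases
      case 1
      define c where "c = (\<lambda>i. sum_list (take i (\<sigma>0 g1)))"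
      have "\<exists>i\<le>length (\<sigma>0 g1). word_dist S0 h (c i) \<le> gromov_product (word_dist S0) h (c 0) (c (length (\<sigma>0 g1))) + 1 + 2 * \<delta>"
        by (rule thin_triangle) (use minimal_presentation_dist[OF S0 \<sigma>0] in \<open>simp add: c_def\<close>)
      then obtain i where "i \<le> length (\<sigma>0 g1)" "word_dist S0 h (c i) \<le> 1 + 3 * \<delta>"
        using 1 by (auto simp: c_def sum)
      then show ?thesis using B by (intro disjI1 bexI[of _ "c i"]) (auto simp: prefixes_of_def c_def)
    next
      case 2
      define c where "c = (\<lambda>i. g1 + sum_list (take i (\<sigma>0 g2)))"
      have "\<exists>i\<le>length (\<sigma>0 g2). word_dist S0 h (c i) \<le> gromov_product (word_dist S0) h (c 0) (c (length (\<sigma>0 g2))) + 1 + 2 * \<delta>"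
      proof (rule thin_triangle)
        fix i j assume "i \<le> length (\<sigma>0 g2)" "j \<le> length (\<sigma>0 g2)"
        then show "word_dist S0 (c i) (c j) = \<bar>real i - real j\<bar>"
          using minimal_presentation_dist[OF S0 \<sigma>0, of i g2 j]
          by (simp only: c_def word_dist_def minus_add add.assoc minus_add_cancel)
      qed
      then obtain i where "i \<le> length (\<sigma>0 g2)" "word_dist S0 h (c i) \<le> 1 + 3 * \<delta>"
        using 2 by (auto simp: c_def sum)
      then show ?thesis using B by (intro disjI2 bexI[of _ "sum_list (take i (\<sigma>0 g2))"]) (auto simp: prefixes_of_def c_def)
    qed
  qed
  moreover have "finite B" unfolding B_def by (rule ball_finite[OF S0])
  ultimately show ?thesis using S0 \<sigma>0 by blast
qed

section \<open>Group rings, the unconditional cross-norm and the quasiderivation\<close>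

lemma lookup_cscale [simp]: "Poly_Mapping.lookup (cscale c a) x = c * Poly_Mapping.lookup a x"
  by (simp add: cscale_def Poly_Mapping.map.rep_eq when_def)

lemma lookup_cabs [simp]:
  "Poly_Mapping.lookup (cabs a) x = complex_of_real (cmod (Poly_Mapping.lookup a x))"
  by (simp add: cabs_def Poly_Mapping.map.rep_eq when_def)

lemma lookup_single_if: "Poly_Mapping.lookup (Poly_Mapping.single x c) y = (if x = y then c else 0)"
  by (simp add: lookup_single when_def)

lemma lookup_ctensor [simp]:
  "Poly_Mapping.lookup (ctensor a b) (x, y) = Poly_Mapping.lookup a x * Poly_Mapping.lookup b y"
proof -
  have "Poly_Mapping.lookup (ctensor a b) (x, y) =
    (\<Sum>x'\<in>Poly_Mapping.keys a. \<Sum>y'\<in>Poly_Mapping.keys b.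
       if x' = x \<and> y' = y then Poly_Mapping.lookup a x * Poly_Mapping.lookup b y else 0)"
    unfolding ctensor_def lookup_sum by (intro sum.cong refl) (auto simp: lookup_single_if)
  also have "\<dots> = (\<Sum>x'\<in>Poly_Mapping.keys a. if x' = x then
       (\<Sum>y'\<in>Poly_Mapping.keys b. if y' = y then Poly_Mapping.lookup a x * Poly_Mapping.lookup b y else 0) else 0)"
    by (intro sum.cong refl) auto
  also have "\<dots> = Poly_Mapping.lookup a x * Poly_Mapping.lookup b y"
    by (auto simp: not_in_keys_iff_lookup_eq_zero)
  finally show ?thesis .
qed

lemma ctensor_basis_vec: "ctensor (basis_vec x) (basis_vec y) = basis_vec (x, y)"
proof (rule poly_mapping_eqI)
  show "Poly_Mapping.lookup (ctensor (basis_vec x) (basis_vec y)) z = Poly_Mapping.lookup (basis_vec (x, y)) z" for z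
    by (cases z) (auto simp: lookup_single_if)
qed

text \<open>
  For a group the convolution sum is indexed by its first factor.
\<close>

lemma lookup_times_left:
  fixes a b :: "'g::group_add \<Rightarrow>\<^sub>0 complex"
  shows "Poly_Mapping.lookup (a * b) g =
    (\<Sum>l\<in>Poly_Mapping.keys a. Poly_Mapping.lookup a l * Poly_Mapping.lookup b (- l + g))"
proof -
  have "(g = l + m) = (m = - l + g)" for l m by (metis add_minus_cancel minus_add_cancel)
  then have "Poly_Mapping.lookup (a * b) g = (\<Sum>l. Poly_Mapping.lookup a l * Poly_Mapping.lookup b (- l + g))"
    by (simp add: lookup_mult)
  also have "\<dots> = (\<Sum>l\<in>Poly_Mapping.keys a. Poly_Mapping.lookup a l * Poly_Mapping.lookup b (- l + g))"
    by (rule Sum_any.expand_superset) (auto simp: in_keys_iff)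
  finally show ?thesis .
qed

lemma lookup_times_single_right:
  fixes a :: "'g::group_add \<Rightarrow>\<^sub>0 complex"
  shows "Poly_Mapping.lookup (a * basis_vec r) g = Poly_Mapping.lookup a (g - r)"
proof -
  have iff: "r = - l + g \<longleftrightarrow> l = g - r" for l
  proof
    assume "r = - l + g"
    then have "g = l + r" by simp
    then show "l = g - r" by simp
  next
    assume "l = g - r"
    then have "g = l + r" by simp
    then show "r = - l + g" by simp
  qed
  have "Poly_Mapping.lookup (a * basis_vec r) g =
      (\<Sum>l\<in>Poly_Mapping.keys a. if l = g - r then Poly_Mapping.lookup a (g - r) else 0)"
    unfolding lookup_times_left by (rule sum.cong) (simp_all add: lookup_single_if iff)
  then show ?thesis by (simp add: not_in_keys_iff_lookup_eq_zero)
qed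

lemma lookup_times_single_left:
  fixes a :: "'g::group_add \<Rightarrow>\<^sub>0 complex"
  shows "Poly_Mapping.lookup (basis_vec r * a) g = Poly_Mapping.lookup a (- r + g)"
  unfolding lookup_times_left by simp

text \<open>
  The reindexing \<open>m = c + l\<close> makes the left-hand side a partial sum of a convolution of absolute
  values. In the Leibniz inequality this is how the summation over all factorisations of a group element
  is absorbed into a product in the group ring.
\<close>

lemma sum_le_convolution:
  fixes a b :: "'g::group_add \<Rightarrow>\<^sub>0 complex"
  assumes "finite A"
  shows "(\<Sum>l\<in>A. cmod (Poly_Mapping.lookup a (c + l)) * cmod (Poly_Mapping.lookup b (- l + g)))
    \<le> cmod (Poly_Mapping.lookup (cabs a * cabs b) (c + g))"
proof -
  let ?f = "\<lambda>m. cmod (Poly_Mapping.lookup a m) * cmod (Poly_Mapping.lookup b (- m + (c + g)))"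
  have eq: "- (c + l) + (c + g) = - l + g" for l
    by (simp only: minus_add add.assoc minus_add_cancel)
  have "(\<Sum>l\<in>A. cmod (Poly_Mapping.lookup a (c + l)) * cmod (Poly_Mapping.lookup b (- l + g)))
    = (\<Sum>m\<in>(+) c ` A. ?f m)"
    by (subst sum.reindex) (simp_all only: o_def eq inj_on_def add_left_cancel, simp)
  also have "\<dots> = (\<Sum>m\<in>(+) c ` A \<inter> Poly_Mapping.keys a. ?f m)"
    by (rule sum.mono_neutral_right) (use assms in \<open>auto simp: in_keys_iff\<close>)
  also have "\<dots> \<le> (\<Sum>m\<in>Poly_Mapping.keys a. ?f m)"
    by (rule sum_mono2) auto
  also have "\<dots> = (\<Sum>m\<in>Poly_Mapping.keys (cabs a). ?f m)"
    by (intro sum.cong) (auto simp: in_keys_iff)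
  also have "\<dots> = cmod (complex_of_real (\<Sum>m\<in>Poly_Mapping.keys (cabs a). ?f m))"
    unfolding norm_of_real by (simp add: sum_nonneg)
  also have "complex_of_real (\<Sum>m\<in>Poly_Mapping.keys (cabs a). ?f m) = Poly_Mapping.lookup (cabs a * cabs b) (c + g)"
    by (simp add: lookup_times_left)
  finally show ?thesis .
qed

text \<open>
  The condition under the infimum that defines \<open>uc_norm\<close>, written as a family of real inequalities
  instead of a comparison of complex-valued finitely supported functions.
\<close>

definition dominated_by ::
  "(('x \<times> 'y) \<Rightarrow>\<^sub>0 complex) \<Rightarrow> (('x \<Rightarrow>\<^sub>0 complex) \<times> ('y \<Rightarrow>\<^sub>0 complex)) list \<Rightarrow> bool" where
  "dominated_by \<gamma> F \<longleftrightarrow> (\<forall>x y. cmod (Poly_Mapping.lookup \<gamma> (x, y))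
     \<le> (\<Sum>(a, b)\<leftarrow>F. cmod (Poly_Mapping.lookup a x) * cmod (Poly_Mapping.lookup b y)))"

lemma dominated_by_iff: "dominated_by \<gamma> F \<longleftrightarrow> abs_le \<gamma> (\<Sum>(a, b)\<leftarrow>F. ctensor (cabs a) (cabs b))"
proof -
  have "Poly_Mapping.lookup (\<Sum>(a, b)\<leftarrow>F. ctensor (cabs a) (cabs b)) (x, y) =
    complex_of_real (\<Sum>(a, b)\<leftarrow>F. cmod (Poly_Mapping.lookup a x) * cmod (Poly_Mapping.lookup b y))" for x y
    by (induction F) (auto simp: lookup_add)
  moreover have "0 \<le> (\<Sum>(a, b)\<leftarrow>F. cmod (Poly_Mapping.lookup a x) * cmod (Poly_Mapping.lookup b y))" for x y
    by (rule sum_list_nonneg) auto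
  ultimately show ?thesis by (simp add: dominated_by_def abs_le_def)
qed

locale unconditional_algebra_norm =
  fixes q :: "('g::group_add \<Rightarrow>\<^sub>0 complex) \<Rightarrow> real" and C :: real
  assumes unconditional: "unconditional_seminorm q"
    and C_nonneg: "0 \<le> C"
    and q_times: "q (a * b) \<le> C * q a * q b"
begin

lemma q_nonneg: "0 \<le> q a"
  using unconditional by (simp add: unconditional_seminorm_def seminorm_def)

lemma q_mono: "(\<And>x. cmod (Poly_Mapping.lookup a x) \<le> cmod (Poly_Mapping.lookup b x)) \<Longrightarrow> q a \<le> q b"
  using unconditional by (simp add: unconditional_seminorm_def abs_le_def)

lemma q_cabs: "q (cabs a) = q a"
  by (rule antisym; rule q_mono) simp_all

lemma uc_norm_le: "dominated_by \<gamma> F \<Longrightarrow> uc_norm q \<gamma> \<le> (\<Sum>(a, b)\<leftarrow>F. q a * q b)"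
  unfolding uc_norm_def dominated_by_iff
proof (rule cInf_lower)
  have "0 \<le> (\<Sum>(a, b)\<leftarrow>F. q a * q b)" for F
    by (rule sum_list_nonneg) (auto simp: q_nonneg)
  then show "bdd_below {(\<Sum>(a, b)\<leftarrow>F. q a * q b) | F. abs_le \<gamma> (\<Sum>(a, b)\<leftarrow>F. ctensor (cabs a) (cabs b))}"
    by (intro bdd_belowI[of _ 0]) blast
qed blast

text \<open>
  A single elementary tensor suffices: the indicator function of the first coordinates of the support,
  tensored with the sum of the absolute values over the first coordinate.
\<close>

lemma dominated_by_exists: "\<exists>F. dominated_by \<gamma> F"
proof -
  define u where "u = (\<Sum>x\<in>fst ` Poly_Mapping.keys \<gamma>. basis_vec x)"
  define v where "v = (\<Sum>z\<in>Poly_Mapping.keys \<gamma>. cscale (cmod (Poly_Mapping.lookup \<gamma> z)) (basis_vec (snd z)))"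
  have u: "Poly_Mapping.lookup u x = (if x \<in> fst ` Poly_Mapping.keys \<gamma> then 1 else 0)" for x
    by (simp add: u_def lookup_sum lookup_single_if)
  have v: "Poly_Mapping.lookup v y = complex_of_real (\<Sum>z\<in>Poly_Mapping.keys \<gamma>. if snd z = y then cmod (Poly_Mapping.lookup \<gamma> z) else 0)" for y
    by (auto simp: v_def lookup_sum lookup_single_if intro!: sum.cong)
  have "cmod (Poly_Mapping.lookup \<gamma> (x, y)) \<le> cmod (Poly_Mapping.lookup u x) * cmod (Poly_Mapping.lookup v y)" for x y
  proof (cases "(x, y) \<in> Poly_Mapping.keys \<gamma>")
    case True
    then have "cmod (Poly_Mapping.lookup \<gamma> (x, y)) \<le> (\<Sum>z\<in>Poly_Mapping.keys \<gamma>. if snd z = y then cmod (Poly_Mapping.lookup \<gamma> z) else 0)"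
      using member_le_sum[of "(x, y)" "Poly_Mapping.keys \<gamma>" "\<lambda>z. if snd z = y then cmod (Poly_Mapping.lookup \<gamma> z) else 0"]
      by auto
    moreover have "x \<in> fst ` Poly_Mapping.keys \<gamma>" using True by force
    ultimately show ?thesis unfolding u v norm_of_real by simp
  next
    case False
    then show ?thesis by (simp add: not_in_keys_iff_lookup_eq_zero)
  qed
  then have "dominated_by \<gamma> [(u, v)]" by (simp add: dominated_by_def)
  then show ?thesis by blast
qed

lemma uc_norm_approx:
  assumes "0 < \<epsilon>"
  shows "\<exists>F. dominated_by \<gamma> F \<and> (\<Sum>(a, b)\<leftarrow>F. q a * q b) < uc_norm q \<gamma> + \<epsilon>"
proof -
  let ?X = "{(\<Sum>(a, b)\<leftarrow>F. q a * q b) | F. dominated_by \<gamma> F}"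
  have "?X \<noteq> {}" using dominated_by_exists by blast
  moreover have "Inf ?X < uc_norm q \<gamma> + \<epsilon>"
    using assms by (simp add: uc_norm_def dominated_by_iff)
  ultimately obtain r where "r \<in> ?X" "r < uc_norm q \<gamma> + \<epsilon>"
    by (rule cInf_lessD[THEN bexE])
  then show ?thesis by blast
qed

lemma uc_norm_mono:
  assumes "abs_le \<gamma> \<gamma>'"
  shows "uc_norm q \<gamma> \<le> uc_norm q \<gamma>'"
proof (rule field_le_epsilon)
  fix \<epsilon> :: real assume "0 < \<epsilon>"
  then obtain F where "dominated_by \<gamma>' F" "(\<Sum>(a, b)\<leftarrow>F. q a * q b) < uc_norm q \<gamma>' + \<epsilon>"
    using uc_norm_approx by blast
  moreover from this have "dominated_by \<gamma> F"
    using assms unfolding dominated_by_def abs_le_def by (meson order_trans)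
  ultimately show "uc_norm q \<gamma> \<le> uc_norm q \<gamma>' + \<epsilon>" using uc_norm_le by force
qed

end

text \<open>
  The prefixes of a minimal word are pairwise distinct, so \<open>(h, k)\<close> arises from at most one cutting point of
  \<open>\<sigma>(h + k)\<close>, and from no other word.
\<close>

lemma lookup_quasiderivation:
  fixes \<sigma> :: "'g::group_add \<Rightarrow> 'g list"
  assumes S: "fin_sym_generating S" and \<sigma>: "minimal_presentation S \<sigma>"
  shows "Poly_Mapping.lookup (quasiderivation \<sigma> a) (h, k) =
    (if h \<in> prefixes_of \<sigma> (h + k) then Poly_Mapping.lookup a (h + k) else 0)"
proof -
  have sum: "sum_list (\<sigma> g) = g" for g using \<sigma> by (simp add: minimal_presentation_def)
  have split: "sum_list (drop i (\<sigma> g)) = - sum_list (take i (\<sigma> g)) + g" for i g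
  proof -
    have "sum_list (take i (\<sigma> g)) + sum_list (drop i (\<sigma> g)) = g"
      using sum_list_take_drop[of i "\<sigma> g"] sum[of g] by simp
    then have "- sum_list (take i (\<sigma> g)) + (sum_list (take i (\<sigma> g)) + sum_list (drop i (\<sigma> g)))
        = - sum_list (take i (\<sigma> g)) + g"
      by (rule arg_cong)
    then show ?thesis by (simp only: minus_add_cancel)
  qed
  have inj: "inj_on (\<lambda>i. sum_list (take i (\<sigma> g))) {0..length (\<sigma> g)}" for g
  proof (rule inj_onI)
    fix i j assume "i \<in> {0..length (\<sigma> g)}" "j \<in> {0..length (\<sigma> g)}"
      "sum_list (take i (\<sigma> g)) = sum_list (take j (\<sigma> g))"
    then show "i = j"
      using minimal_presentation_dist[OF S \<sigma>, of i g j] by (simp add: word_dist_def word_length_0)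
  qed
  have iff: "- h + g = k \<longleftrightarrow> g = h + k" for g
    by auto
  have inner: "(\<Sum>i = 0..length (\<sigma> g). if sum_list (take i (\<sigma> g)) = h \<and> sum_list (drop i (\<sigma> g)) = k then 1 else 0)
    = (if g = h + k \<and> h \<in> prefixes_of \<sigma> g then 1 else 0 :: complex)" for g
  proof -
    have "(\<Sum>i = 0..length (\<sigma> g). if sum_list (take i (\<sigma> g)) = h \<and> sum_list (drop i (\<sigma> g)) = k then 1 else 0)
      = (\<Sum>i = 0..length (\<sigma> g). if sum_list (take i (\<sigma> g)) = h then if g = h + k then 1 else 0 else 0 :: complex)"
      by (intro sum.cong refl) (auto simp: split iff)
    also have "\<dots> = (\<Sum>x\<in>(\<lambda>i. sum_list (take i (\<sigma> g))) ` {0..length (\<sigma> g)}. if x = h then if g = h + k then 1 else 0 else 0)"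
      by (subst sum.reindex[OF inj]) simp
    also have "(\<lambda>i. sum_list (take i (\<sigma> g))) ` {0..length (\<sigma> g)} = prefixes_of \<sigma> g"
      by (auto simp: prefixes_of_def)
    also have "(\<Sum>x\<in>prefixes_of \<sigma> g. if x = h then if g = h + k then 1 else 0 else 0) =
      (if g = h + k \<and> h \<in> prefixes_of \<sigma> g then 1 else 0 :: complex)"
      by (subst sum.delta) (auto simp: prefixes_of_def)
    finally show ?thesis .
  qed
  have "Poly_Mapping.lookup (quasiderivation \<sigma> a) (h, k) =
    (\<Sum>g\<in>Poly_Mapping.keys a. Poly_Mapping.lookup a g * (if g = h + k \<and> h \<in> prefixes_of \<sigma> g then 1 else 0))"
    unfolding quasiderivation_def
    by (simp add: lookup_sum ctensor_basis_vec lookup_single_if inner)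
  also have "\<dots> = (\<Sum>g\<in>Poly_Mapping.keys a. if g = h + k then
      (if h \<in> prefixes_of \<sigma> (h + k) then Poly_Mapping.lookup a (h + k) else 0) else 0)"
    by (intro sum.cong) auto
  also have "\<dots> = (if h \<in> prefixes_of \<sigma> (h + k) then Poly_Mapping.lookup a (h + k) else 0)"
    by (auto simp: not_in_keys_iff_lookup_eq_zero)
  finally show ?thesis .
qed

lemma quasiderivation_at_prefix:
  assumes "fin_sym_generating S" "minimal_presentation S \<sigma>" "h \<in> prefixes_of \<sigma> g"
  shows "Poly_Mapping.lookup (quasiderivation \<sigma> a) (h, - h + g) = Poly_Mapping.lookup a g"
  using assms(3) by (simp add: lookup_quasiderivation[OF assms(1,2)])

section \<open>Leibniz-type estimates\<close>

abbreviation mag :: "('x \<Rightarrow>\<^sub>0 complex) \<Rightarrow> 'x \<Rightarrow> real" where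
  "mag a x \<equiv> cmod (Poly_Mapping.lookup a x)"

lemma sum_list_concat_map:
  "(\<Sum>x\<leftarrow>concat (map (\<lambda>r. map (f r) F) bs). G x) = (\<Sum>r\<leftarrow>bs. \<Sum>x\<leftarrow>F. G (f r x))"
  for G :: "_ \<Rightarrow> real"
  by (induction bs) (simp_all add: o_def)

lemma sum_sum_list_swap:
  "(\<Sum>l\<in>A. \<Sum>p\<leftarrow>F. f l p) = (\<Sum>p\<leftarrow>F. \<Sum>l\<in>A. f l p)" for f :: "_ \<Rightarrow> _ \<Rightarrow> real"
  by (induction F) (simp_all add: sum.distrib)

context unconditional_algebra_norm
begin

text \<open>
  Estimates of the cross-norm follow one pattern: a family \<open>F\<close> that dominates \<open>\<gamma>1\<close> and a family
  \<open>F'\<close> that dominates \<open>\<gamma>2\<close> are transformed, for each \<open>r\<close> in a finite set \<open>B\<close>, by maps that multiply the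
  cost of an elementary tensor by at most \<open>c r\<close> or \<open>c' r\<close>, and the transformed families together dominate \<open>\<gamma>\<close>.
\<close>

lemma uc_norm_le_transfer:
  assumes B: "finite B"
    and cost: "\<And>r \<alpha> \<beta>. r \<in> B \<Longrightarrow> q (f r \<alpha>) * q (g r \<beta>) \<le> c r * (q \<alpha> * q \<beta>)"
    and cost': "\<And>r \<alpha> \<beta>. r \<in> B \<Longrightarrow> q (f' r \<alpha>) * q (g' r \<beta>) \<le> c' r * (q \<alpha> * q \<beta>)"
    and c: "\<And>r. r \<in> B \<Longrightarrow> 0 \<le> c r" "\<And>r. r \<in> B \<Longrightarrow> 0 \<le> c' r"
    and dom: "\<And>F F' x y. dominated_by \<gamma>1 F \<Longrightarrow> dominated_by \<gamma>2 F' \<Longrightarrow>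
      mag \<gamma> (x, y) \<le> (\<Sum>r\<in>B. \<Sum>(\<alpha>, \<beta>)\<leftarrow>F. mag (f r \<alpha>) x * mag (g r \<beta>) y)
        + (\<Sum>r\<in>B. \<Sum>(\<alpha>, \<beta>)\<leftarrow>F'. mag (f' r \<alpha>) x * mag (g' r \<beta>) y)"
  shows "uc_norm q \<gamma> \<le> (\<Sum>r\<in>B. c r) * uc_norm q \<gamma>1 + (\<Sum>r\<in>B. c' r) * uc_norm q \<gamma>2"
proof (rule field_le_epsilon)
  fix e :: real assume e: "0 < e"
  define m m' where "m = (\<Sum>r\<in>B. c r)" and "m' = (\<Sum>r\<in>B. c' r)"
  have m: "0 \<le> m" "0 \<le> m'" unfolding m_def m'_def by (intro sum_nonneg c; assumption)+
  (* The 1 in the denominator covers the case that both constants vanish. *)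
  define \<epsilon> where "\<epsilon> = e / (m + m' + 1)"
  have \<epsilon>: "0 < \<epsilon>" "(m + m') * \<epsilon> \<le> e" using e m by (auto simp: \<epsilon>_def field_simps)
  obtain F where F: "dominated_by \<gamma>1 F" "(\<Sum>(a, b)\<leftarrow>F. q a * q b) < uc_norm q \<gamma>1 + \<epsilon>"
    using uc_norm_approx[OF \<epsilon>(1)] by blast
  obtain F' where F': "dominated_by \<gamma>2 F'" "(\<Sum>(a, b)\<leftarrow>F'. q a * q b) < uc_norm q \<gamma>2 + \<epsilon>"
    using uc_norm_approx[OF \<epsilon>(1)] by blast
  obtain bs where bs: "set bs = B" "distinct bs" using finite_distinct_list[OF B] by blast
  define H where "H = concat (map (\<lambda>r. map (\<lambda>(\<alpha>, \<beta>). (f r \<alpha>, g r \<beta>)) F) bs)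
    @ concat (map (\<lambda>r. map (\<lambda>(\<alpha>, \<beta>). (f' r \<alpha>, g' r \<beta>)) F') bs)"
  have H: "(\<Sum>p\<leftarrow>H. G p) = (\<Sum>r\<in>B. \<Sum>(\<alpha>, \<beta>)\<leftarrow>F. G (f r \<alpha>, g r \<beta>))
      + (\<Sum>r\<in>B. \<Sum>(\<alpha>, \<beta>)\<leftarrow>F'. G (f' r \<alpha>, g' r \<beta>))" for G :: "_ \<Rightarrow> real"
    unfolding H_def map_append sum_list_append sum_list_concat_map
    using bs by (simp add: sum_list_distinct_conv_sum_set case_prod_unfold)
  have "dominated_by \<gamma> H"
    unfolding dominated_by_def H using dom[OF F(1) F'(1)] by (simp add: case_prod_unfold)
  then have "uc_norm q \<gamma> \<le> (\<Sum>(a, b)\<leftarrow>H. q a * q b)" by (rule uc_norm_le)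
  also have "\<dots> = (\<Sum>r\<in>B. \<Sum>(\<alpha>, \<beta>)\<leftarrow>F. q (f r \<alpha>) * q (g r \<beta>)) + (\<Sum>r\<in>B. \<Sum>(\<alpha>, \<beta>)\<leftarrow>F'. q (f' r \<alpha>) * q (g' r \<beta>))"
    unfolding H by simp
  also have "\<dots> \<le> (\<Sum>r\<in>B. \<Sum>(\<alpha>, \<beta>)\<leftarrow>F. c r * (q \<alpha> * q \<beta>)) + (\<Sum>r\<in>B. \<Sum>(\<alpha>, \<beta>)\<leftarrow>F'. c' r * (q \<alpha> * q \<beta>))"
    by (intro add_mono sum_mono sum_list_mono) (auto simp: cost cost')
  also have "\<dots> = m * (\<Sum>(\<alpha>, \<beta>)\<leftarrow>F. q \<alpha> * q \<beta>) + m' * (\<Sum>(\<alpha>, \<beta>)\<leftarrow>F'. q \<alpha> * q \<beta>)"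
    by (simp add: m_def m'_def sum_distrib_right case_prod_unfold sum_list_const_mult)
  also have "\<dots> \<le> m * (uc_norm q \<gamma>1 + \<epsilon>) + m' * (uc_norm q \<gamma>2 + \<epsilon>)"
    using F(2) F'(2) m by (intro add_mono mult_left_mono) auto
  also have "\<dots> \<le> m * uc_norm q \<gamma>1 + m' * uc_norm q \<gamma>2 + e"
    using \<epsilon>(2) by (simp add: algebra_simps)
  finally show "uc_norm q \<gamma> \<le> (\<Sum>r\<in>B. c r) * uc_norm q \<gamma>1 + (\<Sum>r\<in>B. c' r) * uc_norm q \<gamma>2 + e"
    by (simp add: m_def m'_def)
qed

lemma q_zero: "q 0 = 0"
proof -
  have "q (cscale 0 0) = cmod 0 * q 0"
    using unconditional unfolding unconditional_seminorm_def seminorm_def by blast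
  moreover have "cscale 0 0 = (0 :: 'g \<Rightarrow>\<^sub>0 complex)" by (rule poly_mapping_eqI) simp
  ultimately show ?thesis by simp
qed

text \<open>
  For a prefix \<open>h\<close> of \<open>\<sigma>(h + k)\<close>, if \<open>h = h' + r\<close> with \<open>h'\<close> a prefix of \<open>\<sigma>'(h + k)\<close>, then the coefficient of \<open>\<Delta>(a)\<close> at \<open>(h, k)\<close> is the
  coefficient of \<open>\<Delta>'(a)\<close> at \<open>(h - r, r + k)\<close>. So \<open>\<bar>\<Delta>(a)\<bar>\<close> is dominated by the sum over \<open>r \<in> B\<close> of the
  translates of \<open>\<bar>\<Delta>'(a)\<bar>\<close> by \<open>r\<close> on the right in the first factor and by \<open>-r\<close> on the left in the second.
\<close>

lemma uc_quasiderivation_comparison: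
  assumes S: "fin_sym_generating S" "minimal_presentation S \<sigma>"
    and S': "fin_sym_generating S'" "minimal_presentation S' \<sigma>'"
    and B: "finite B"
    and close: "\<And>g h. h \<in> prefixes_of \<sigma> g \<Longrightarrow> \<exists>h'\<in>prefixes_of \<sigma>' g. - h' + h \<in> B"
  shows "uc_norm q (quasiderivation \<sigma> a)
    \<le> (\<Sum>r\<in>B. C ^ 2 * q (basis_vec r) * q (basis_vec (- r))) * uc_norm q (quasiderivation \<sigma>' a)"
proof -
  have "uc_norm q (quasiderivation \<sigma> a)
    \<le> (\<Sum>r\<in>B. C ^ 2 * q (basis_vec r) * q (basis_vec (- r))) * uc_norm q (quasiderivation \<sigma>' a)
      + (\<Sum>r\<in>B. 0) * uc_norm q (quasiderivation \<sigma>' a)"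
  proof (rule uc_norm_le_transfer[where f = "\<lambda>r \<alpha>. \<alpha> * basis_vec r" and g = "\<lambda>r \<beta>. basis_vec (- r) * \<beta>"
        and f' = "\<lambda>_ _. 0" and g' = "\<lambda>_ _. 0"])
    show "finite B" by fact
  next
    fix r \<alpha> \<beta>
    have "q (\<alpha> * basis_vec r) * q (basis_vec (- r) * \<beta>)
        \<le> (C * q \<alpha> * q (basis_vec r)) * (C * q (basis_vec (- r)) * q \<beta>)"
      by (intro mult_mono q_times mult_nonneg_nonneg q_nonneg C_nonneg)
    then show "q (\<alpha> * basis_vec r) * q (basis_vec (- r) * \<beta>)
        \<le> C ^ 2 * q (basis_vec r) * q (basis_vec (- r)) * (q \<alpha> * q \<beta>)"
      by (simp add: power2_eq_square mult_ac)
  next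
    fix F F' and h k :: 'g
    assume F: "dominated_by (quasiderivation \<sigma>' a) F"
    define G where "G r = (\<Sum>(\<alpha>, \<beta>)\<leftarrow>F. mag (\<alpha> * basis_vec r) h * mag (basis_vec (- r) * \<beta>) k)" for r
    have G0: "0 \<le> G r" for r unfolding G_def by (rule sum_list_nonneg) auto
    have "mag (quasiderivation \<sigma> a) (h, k) \<le> (\<Sum>r\<in>B. G r)"
    proof (cases "h \<in> prefixes_of \<sigma> (h + k)")
      case True
      then obtain h' where h': "h' \<in> prefixes_of \<sigma>' (h + k)" "- h' + h \<in> B" using close by blast
      define r where "r = - h' + h"
      have h: "h = h' + r" by (simp add: r_def)
      have "mag (quasiderivation \<sigma> a) (h, k) = mag (quasiderivation \<sigma>' a) (h', - h' + (h + k))"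
        using True quasiderivation_at_prefix[OF S' h'(1)] by (simp add: lookup_quasiderivation[OF S])
      also have "- h' + (h + k) = r + k" by (simp add: r_def add.assoc)
      also have "mag (quasiderivation \<sigma>' a) (h', r + k) \<le> (\<Sum>(\<alpha>, \<beta>)\<leftarrow>F. mag \<alpha> h' * mag \<beta> (r + k))"
        using F by (simp add: dominated_by_def)
      also have "\<dots> = G r"
        unfolding G_def lookup_times_single_left lookup_times_single_right h by simp
      also have "\<dots> \<le> (\<Sum>r\<in>B. G r)"
        using member_le_sum[of r B G] h'(2) G0 B by (simp add: r_def)
      finally show ?thesis .
    next
      case False
      then show ?thesis by (simp add: lookup_quasiderivation[OF S] sum_nonneg G0)
    qed
    then show "mag (quasiderivation \<sigma> a) (h, k)
      \<le> (\<Sum>r\<in>B. \<Sum>(\<alpha>, \<beta>)\<leftarrow>F. mag (\<alpha> * basis_vec r) h * mag (basis_vec (- r) * \<beta>) k)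
        + (\<Sum>r\<in>B. \<Sum>(\<alpha>, \<beta>)\<leftarrow>F'. mag (0 :: 'g \<Rightarrow>\<^sub>0 complex) h * mag (0 :: 'g \<Rightarrow>\<^sub>0 complex) k)"
      by (simp add: G_def case_prod_unfold)
  qed (use C_nonneg q_nonneg q_zero in auto)
  then show ?thesis by simp
qed

text \<open>
  The coefficient of \<open>\<Delta>(ab)\<close> at \<open>(h, k)\<close> is a sum over the factorisations of \<open>h + k\<close> as \<open>l + m\<close>. When \<open>h\<close>
  is close to a prefix of \<open>\<sigma>(l)\<close>, the summand is controlled by \<open>\<Delta>(a)\<close> with its second tensor factor
  multiplied by \<open>b\<close> on the right; when \<open>h\<close> is close to \<open>l\<close> plus a prefix of \<open>\<sigma>(m)\<close>, it is controlled by \<open>\<Delta>(b)\<close>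
  with its first tensor factor multiplied by \<open>a\<close> on the left.
\<close>

lemma uc_quasiderivation_leibniz:
  assumes S: "fin_sym_generating S" "minimal_presentation S \<sigma>"
    and B: "finite B"
    and thin: "\<And>g1 g2 h. h \<in> prefixes_of \<sigma> (g1 + g2) \<Longrightarrow>
       (\<exists>h'\<in>prefixes_of \<sigma> g1. - h' + h \<in> B) \<or> (\<exists>h'\<in>prefixes_of \<sigma> g2. - (g1 + h') + h \<in> B)"
  shows "uc_norm q (quasiderivation \<sigma> (a * b))
    \<le> (\<Sum>r\<in>B. C ^ 3 * q (basis_vec r) * q (basis_vec (- r)))
       * (uc_norm q (quasiderivation \<sigma> a) * q b + q a * uc_norm q (quasiderivation \<sigma> b))"
proof -
  let ?\<Delta> = "quasiderivation \<sigma>"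
  let ?c = "\<lambda>r. C ^ 3 * q (basis_vec r) * q (basis_vec (- r))"
  have "uc_norm q (?\<Delta> (a * b)) \<le> (\<Sum>r\<in>B. ?c r * q b) * uc_norm q (?\<Delta> a) + (\<Sum>r\<in>B. ?c r * q a) * uc_norm q (?\<Delta> b)"
  proof (rule uc_norm_le_transfer[where f = "\<lambda>r \<alpha>. \<alpha> * basis_vec r" and g = "\<lambda>r \<beta>. basis_vec (- r) * (cabs \<beta> * cabs b)"
        and f' = "\<lambda>r \<alpha>. cabs a * cabs \<alpha> * basis_vec r" and g' = "\<lambda>r \<beta>. basis_vec (- r) * \<beta>"])
    show "finite B" by fact
  next
    fix r \<alpha> \<beta>
    have "q (basis_vec (- r) * (cabs \<beta> * cabs b)) \<le> C * q (basis_vec (- r)) * q (cabs \<beta> * cabs b)"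
      by (rule q_times)
    also have "\<dots> \<le> C * q (basis_vec (- r)) * (C * q \<beta> * q b)"
      using q_times[of "cabs \<beta>" "cabs b"] by (intro mult_left_mono) (auto simp: q_cabs C_nonneg q_nonneg)
    finally have "q (\<alpha> * basis_vec r) * q (basis_vec (- r) * (cabs \<beta> * cabs b))
        \<le> (C * q \<alpha> * q (basis_vec r)) * (C * q (basis_vec (- r)) * (C * q \<beta> * q b))"
      by (intro mult_mono q_times mult_nonneg_nonneg q_nonneg C_nonneg)
    then show "q (\<alpha> * basis_vec r) * q (basis_vec (- r) * (cabs \<beta> * cabs b)) \<le> ?c r * q b * (q \<alpha> * q \<beta>)"
      by (simp add: power3_eq_cube mult_ac)
    have "q (cabs a * cabs \<alpha> * basis_vec r) \<le> C * q (cabs a * cabs \<alpha>) * q (basis_vec r)"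
      by (rule q_times)
    also have "\<dots> \<le> C * (C * q a * q \<alpha>) * q (basis_vec r)"
      using q_times[of "cabs a" "cabs \<alpha>"]
      by (intro mult_left_mono mult_right_mono) (auto simp: q_cabs C_nonneg q_nonneg)
    finally have "q (cabs a * cabs \<alpha> * basis_vec r) * q (basis_vec (- r) * \<beta>)
        \<le> (C * (C * q a * q \<alpha>) * q (basis_vec r)) * (C * q (basis_vec (- r)) * q \<beta>)"
      by (intro mult_mono q_times mult_nonneg_nonneg q_nonneg C_nonneg)
    then show "q (cabs a * cabs \<alpha> * basis_vec r) * q (basis_vec (- r) * \<beta>) \<le> ?c r * q a * (q \<alpha> * q \<beta>)"
      by (simp add: power3_eq_cube mult_ac)
  next
    fix F G and h k :: 'g
    assume F: "dominated_by (?\<Delta> a) F" and G: "dominated_by (?\<Delta> b) G"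
    define g where "g = h + k"
    define f1 where "f1 l r = (\<Sum>(\<alpha>, \<beta>)\<leftarrow>F. mag \<alpha> (h - r) * mag \<beta> (- (h - r) + l)) * mag b (- l + g)" for l r
    define f2 where "f2 l r = mag a l * (\<Sum>(\<alpha>, \<beta>)\<leftarrow>G. mag \<alpha> (- l + (h - r)) * mag \<beta> (r + k))" for l r
    have f0: "0 \<le> f1 l r" "0 \<le> f2 l r" for l r
      unfolding f1_def f2_def by (auto intro!: mult_nonneg_nonneg sum_list_nonneg)
    (* A translation by r in both tensor factors does not change the product of the two coordinates. *)
    have shift: "- (h - r) + g = r + k" for r
      by (simp add: g_def add.assoc[symmetric])
    define A where "A = Poly_Mapping.keys a"
    let ?R1 = "\<Sum>r\<in>B. \<Sum>(\<alpha>, \<beta>)\<leftarrow>F. mag (\<alpha> * basis_vec r) h * mag (basis_vec (- r) * (cabs \<beta> * cabs b)) k"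
    let ?R2 = "\<Sum>r\<in>B. \<Sum>(\<alpha>, \<beta>)\<leftarrow>G. mag (cabs a * cabs \<alpha> * basis_vec r) h * mag (basis_vec (- r) * \<beta>) k"
    show "mag (?\<Delta> (a * b)) (h, k) \<le> ?R1 + ?R2"
    proof (cases "h \<in> prefixes_of \<sigma> g")
      case True
      have summand: "mag a l * mag b (- l + g) \<le> (\<Sum>r\<in>B. f1 l r) + (\<Sum>r\<in>B. f2 l r)" for l
      proof -
        have "h \<in> prefixes_of \<sigma> (l + (- l + g))" using True by simp
        from thin[OF this] show ?thesis
        proof
          assume "\<exists>h'\<in>prefixes_of \<sigma> l. - h' + h \<in> B"
          then obtain h' where h': "h' \<in> prefixes_of \<sigma> l" "- h' + h \<in> B" by blast
          define r where "r = - h' + h"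
          have "h = h' + r" by (simp add: r_def)
          then have r: "h' = h - r" by simp
          have "mag a l = mag (?\<Delta> a) (h - r, - (h - r) + l)"
            using quasiderivation_at_prefix[OF S h'(1)] by (simp only: r)
          also have "\<dots> \<le> (\<Sum>(\<alpha>, \<beta>)\<leftarrow>F. mag \<alpha> (h - r) * mag \<beta> (- (h - r) + l))"
            using F by (simp only: dominated_by_def)
          finally have "mag a l * mag b (- l + g) \<le> f1 l r"
            unfolding f1_def by (rule mult_right_mono) simp
          also have "\<dots> \<le> (\<Sum>r\<in>B. f1 l r)"
            using member_le_sum[of r B "f1 l"] h'(2) f0 B by (simp add: r_def)
          finally show ?thesis using sum_nonneg[of B "f2 l"] f0 by simp
        next
          assume "\<exists>h'\<in>prefixes_of \<sigma> (- l + g). - (l + h') + h \<in> B"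
          then obtain h' where h': "h' \<in> prefixes_of \<sigma> (- l + g)" "- (l + h') + h \<in> B" by blast
          define r where "r = - (l + h') + h"
          have "h = (l + h') + r" unfolding r_def by (simp only: add_minus_cancel)
          then have lh: "l + h' = h - r" by (simp only: add_diff_cancel)
          have "- l + (l + h') = - l + (h - r)" by (simp only: lh)
          then have r: "h' = - l + (h - r)" by (simp only: minus_add_cancel)
          have "- h' + (- l + g) = - (l + h') + g" by (simp only: minus_add add.assoc)
          also have "\<dots> = r + k" by (simp only: lh shift)
          finally have k: "- h' + (- l + g) = r + k" .
          have "mag b (- l + g) = mag (?\<Delta> b) (h', r + k)"
            using quasiderivation_at_prefix[OF S h'(1), of b] by (simp only: k)
          also have "\<dots> \<le> (\<Sum>(\<alpha>, \<beta>)\<leftarrow>G. mag \<alpha> h' * mag \<beta> (r + k))"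
            using G by (simp only: dominated_by_def)
          finally have "mag a l * mag b (- l + g) \<le> f2 l r"
            unfolding f2_def r[symmetric] by (rule mult_left_mono) simp
          also have "\<dots> \<le> (\<Sum>r\<in>B. f2 l r)"
            using member_le_sum[of r B "f2 l"] h'(2) f0 B by (simp add: r_def)
          finally show ?thesis using sum_nonneg[of B "f1 l"] f0 by simp
        qed
      qed
      have R1: "(\<Sum>l\<in>A. \<Sum>r\<in>B. f1 l r) \<le> ?R1"
      proof -
        have "(\<Sum>l\<in>A. \<Sum>r\<in>B. f1 l r) = (\<Sum>r\<in>B. \<Sum>l\<in>A. \<Sum>(\<alpha>, \<beta>)\<leftarrow>F. mag \<alpha> (h - r) * mag \<beta> (- (h - r) + l) * mag b (- l + g))"
          by (subst sum.swap) (simp add: f1_def sum_list_mult_const[symmetric] case_prod_unfold)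
        also have "\<dots> = (\<Sum>r\<in>B. \<Sum>(\<alpha>, \<beta>)\<leftarrow>F. mag \<alpha> (h - r) * (\<Sum>l\<in>A. mag \<beta> (- (h - r) + l) * mag b (- l + g)))"
          by (simp only: sum_sum_list_swap case_prod_unfold sum_distrib_left mult.assoc)
        also have "\<dots> \<le> ?R1"
        proof (intro sum_mono sum_list_mono)
          fix r p
          show "(case p of (\<alpha>, \<beta>) \<Rightarrow> mag \<alpha> (h - r) * (\<Sum>l\<in>A. mag \<beta> (- (h - r) + l) * mag b (- l + g)))
            \<le> (case p of (\<alpha>, \<beta>) \<Rightarrow> mag (\<alpha> * basis_vec r) h * mag (basis_vec (- r) * (cabs \<beta> * cabs b)) k)"
          proof (cases p)
            case (Pair \<alpha> \<beta>)
            have "(\<Sum>l\<in>A. mag \<beta> (- (h - r) + l) * mag b (- l + g)) \<le> mag (cabs \<beta> * cabs b) (- (h - r) + g)"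
              by (rule sum_le_convolution) (simp add: A_def)
            then show ?thesis
              unfolding Pair case_prod_conv lookup_times_single_left lookup_times_single_right shift minus_minus
              by (rule mult_left_mono) simp
          qed
        qed
        finally show ?thesis .
      qed
      have R2: "(\<Sum>l\<in>A. \<Sum>r\<in>B. f2 l r) \<le> ?R2"
      proof -
        have "(\<Sum>l\<in>A. \<Sum>r\<in>B. f2 l r) = (\<Sum>r\<in>B. \<Sum>l\<in>A. \<Sum>(\<alpha>, \<beta>)\<leftarrow>G. mag a l * mag \<alpha> (- l + (h - r)) * mag \<beta> (r + k))"
          by (subst sum.swap) (simp add: f2_def sum_list_const_mult[symmetric] case_prod_unfold mult.assoc)
        also have "\<dots> = (\<Sum>r\<in>B. \<Sum>(\<alpha>, \<beta>)\<leftarrow>G. (\<Sum>l\<in>A. mag a l * mag \<alpha> (- l + (h - r))) * mag \<beta> (r + k))"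
          by (simp only: sum_sum_list_swap case_prod_unfold sum_distrib_right)
        also have "\<dots> \<le> ?R2"
        proof (intro sum_mono sum_list_mono)
          fix r p
          show "(case p of (\<alpha>, \<beta>) \<Rightarrow> (\<Sum>l\<in>A. mag a l * mag \<alpha> (- l + (h - r))) * mag \<beta> (r + k))
            \<le> (case p of (\<alpha>, \<beta>) \<Rightarrow> mag (cabs a * cabs \<alpha> * basis_vec r) h * mag (basis_vec (- r) * \<beta>) k)"
          proof (cases p)
            case (Pair \<alpha> \<beta>)
            have "(\<Sum>l\<in>A. mag a l * mag \<alpha> (- l + (h - r))) \<le> mag (cabs a * cabs \<alpha>) (h - r)"
              using sum_le_convolution[of A a 0 \<alpha> "h - r"] by (simp add: A_def)
            then show ?thesis
              unfolding Pair case_prod_conv lookup_times_single_left lookup_times_single_right minus_minus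
              by (rule mult_right_mono) simp
          qed
        qed
        finally show ?thesis .
      qed
      have "mag (?\<Delta> (a * b)) (h, k) = cmod (\<Sum>l\<in>A. Poly_Mapping.lookup a l * Poly_Mapping.lookup b (- l + g))"
        using True by (simp add: lookup_quasiderivation[OF S] g_def A_def lookup_times_left)
      also have "\<dots> \<le> (\<Sum>l\<in>A. mag a l * mag b (- l + g))"
        by (rule order_trans[OF norm_sum]) (simp add: norm_mult)
      also have "\<dots> \<le> (\<Sum>l\<in>A. (\<Sum>r\<in>B. f1 l r) + (\<Sum>r\<in>B. f2 l r))"
        by (intro sum_mono summand)
      also have "\<dots> \<le> ?R1 + ?R2" unfolding sum.distrib using R1 R2 by (rule add_mono)
      finally show ?thesis .
    next
      case False
      have "0 \<le> ?R1" "0 \<le> ?R2" by (intro sum_nonneg sum_list_nonneg; auto)+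
      with False show ?thesis by (simp add: lookup_quasiderivation[OF S] g_def)
    qed
  qed (use C_nonneg q_nonneg in auto)
  also have "\<dots> = (\<Sum>r\<in>B. ?c r) * (uc_norm q (?\<Delta> a) * q b + q a * uc_norm q (?\<Delta> b))"
    by (simp only: sum_distrib_right[symmetric]) (simp only: algebra_simps)
  finally show ?thesis .
qed

end

section \<open>Closures of graphs of operators\<close>

text \<open>
  Normed spaces on a carrier, with convergence expressed through real sequences \<open>p (s n - x)\<close>.
\<close>

locale cnormed =
  fixes sc :: "complex \<Rightarrow> 'v::ab_group_add \<Rightarrow> 'v" and V :: "'v set" and p :: "'v \<Rightarrow> real"
  assumes normed: "complex_normed_space sc V p"
begin

sublocale vector_space sc
  using normed by (simp add: complex_normed_space_def)

sublocale metric: Metric_space V "norm_dist V p"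
  using normed by (rule Metric_space_norm_dist)

lemma carrier: "subspace V"
  using normed by (simp add: complex_normed_space_def)

lemma nonneg: "x \<in> V \<Longrightarrow> 0 \<le> p x"
  and zero_iff: "x \<in> V \<Longrightarrow> p x = 0 \<Longrightarrow> x = 0"
  and add_le: "x \<in> V \<Longrightarrow> y \<in> V \<Longrightarrow> p (x + y) \<le> p x + p y"
  and scale_eq: "x \<in> V \<Longrightarrow> p (sc c x) = cmod c * p x"
  using normed by (auto simp: complex_normed_space_def)

lemma diff_in: "x \<in> V \<Longrightarrow> y \<in> V \<Longrightarrow> x - y \<in> V"
  using carrier by (rule subspace_diff)

lemma zero_in: "0 \<in> V"
  using carrier by (rule subspace_0)

lemma norm_0: "p 0 = 0"
  using scale_eq[OF zero_in, of 0] by simp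

lemma diff_commute: "x \<in> V \<Longrightarrow> y \<in> V \<Longrightarrow> p (x - y) = p (y - x)"
  using scale_eq[OF diff_in, of x y "-1"] by simp

lemma diff_triangle: "x \<in> V \<Longrightarrow> y \<in> V \<Longrightarrow> z \<in> V \<Longrightarrow> p (x - z) \<le> p (x - y) + p (y - z)"
  using add_le[OF diff_in diff_in, of x y y z] by simp

lemma norm_le: "x \<in> V \<Longrightarrow> y \<in> V \<Longrightarrow> p x \<le> p y + p (x - y)"
  using add_le[of y "x - y"] diff_in by simp

lemma norm_limit:
  assumes "\<And>n. s n \<in> V" "x \<in> V" "(\<lambda>n. p (s n - x)) \<longlonglongrightarrow> 0"
  shows "(\<lambda>n. p (s n)) \<longlonglongrightarrow> p x"
proof (rule Lim_transform[OF tendsto_const])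
  have "\<bar>p (s n) - p x\<bar> \<le> p (s n - x)" for n
    using norm_le[of "s n" x] norm_le[of x "s n"] diff_commute[of x "s n"] assms(1,2) by force
  then show "(\<lambda>n. p (s n) - p x) \<longlonglongrightarrow> 0"
    by (intro Lim_null_comparison[OF _ assms(3)]) simp
qed

lemma limit_Cauchy:
  assumes "\<And>n. s n \<in> V" "x \<in> V" "(\<lambda>n. p (s n - x)) \<longlonglongrightarrow> 0" "0 < e"
  shows "\<exists>N. \<forall>m\<ge>N. \<forall>n\<ge>N. p (s m - s n) < e"
proof -
  have "\<forall>\<^sub>F n in sequentially. p (s n - x) < e / 2"
    using assms(3,4) by (intro order_tendstoD) auto
  then obtain N where N: "\<And>n. n \<ge> N \<Longrightarrow> p (s n - x) < e / 2"
    by (auto simp: eventually_sequentially)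
  have "p (s m - s n) < e" if "m \<ge> N" "n \<ge> N" for m n
    using diff_triangle[of "s m" x "s n"] diff_commute[of x "s n"] N[OF that(1)] N[OF that(2)] assms(1,2)
    by simp
  then show ?thesis by blast
qed

lemma MCauchy_iff:
  assumes "\<And>n. s n \<in> V"
  shows "metric.MCauchy s \<longleftrightarrow> (\<forall>e>0. \<exists>N. \<forall>m\<ge>N. \<forall>n\<ge>N. p (s m - s n) < e)"
  using assms by (auto simp: metric.MCauchy_def norm_dist_def)

lemma limitin_iff:
  assumes "\<And>n. s n \<in> V"
  shows "limitin metric.mtopology s x sequentially \<longleftrightarrow> x \<in> V \<and> (\<lambda>n. p (s n - x)) \<longlonglongrightarrow> 0"
proof (cases "x \<in> V")
  case True
  have "limitin metric.mtopology s x sequentially \<longleftrightarrow> (\<forall>e>0. \<forall>\<^sub>F n in sequentially. p (s n - x) < e)"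
    using True assms by (simp add: metric.limitin_metric norm_dist_def)
  also have "\<dots> \<longleftrightarrow> (\<lambda>n. p (s n - x)) \<longlonglongrightarrow> 0"
    using nonneg[OF diff_in[OF assms True]] by (simp add: tendsto_iff)
  finally show ?thesis using True by simp
next
  case False
  then show ?thesis by (simp add: metric.limitin_metric)
qed

lemma complex_banach_spaceI:
  assumes "\<And>s. (\<And>n. s n \<in> V) \<Longrightarrow> (\<And>e. 0 < e \<Longrightarrow> \<exists>N. \<forall>m\<ge>N. \<forall>n\<ge>N. p (s m - s n) < e) \<Longrightarrow>
    \<exists>x\<in>V. (\<lambda>n. p (s n - x)) \<longlonglongrightarrow> 0"
  shows "complex_banach_space sc V p"
  unfolding complex_banach_space_def metric.mcomplete_def
proof (intro conjI normed allI impI)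
  fix s assume s: "metric.MCauchy s"
  then have V: "s n \<in> V" for n by (auto simp: metric.MCauchy_def)
  show "\<exists>x. limitin metric.mtopology s x sequentially"
  proof -
    have "\<exists>x\<in>V. (\<lambda>n. p (s n - x)) \<longlonglongrightarrow> 0"
      by (rule assms[OF V]) (use s MCauchy_iff[where s = s, OF V] in simp)
    then show ?thesis using limitin_iff[where s = s, OF V] by blast
  qed
qed

lemma banach_limit:
  assumes "complex_banach_space sc V p" "\<And>n. s n \<in> V"
    and "\<And>e. 0 < e \<Longrightarrow> \<exists>N. \<forall>m\<ge>N. \<forall>n\<ge>N. p (s m - s n) < e"
  shows "\<exists>x\<in>V. (\<lambda>n. p (s n - x)) \<longlonglongrightarrow> 0"
proof -
  have "metric.MCauchy s" using MCauchy_iff[OF assms(2)] assms(3) by simp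
  moreover have "metric.mcomplete" using assms(1) by (simp add: complex_banach_space_def)
  ultimately obtain x where "limitin metric.mtopology s x sequentially"
    unfolding metric.mcomplete_def by blast
  then show ?thesis using limitin_iff[where s = s, OF assms(2)] by blast
qed

lemma closure_iff:
  assumes "S \<subseteq> V"
  shows "x \<in> metric.mtopology closure_of S \<longleftrightarrow> x \<in> V \<and> (\<forall>e>0. \<exists>y\<in>S. p (x - y) < e)"
proof -
  have "y \<in> metric.mball x e \<longleftrightarrow> p (x - y) < e" if "x \<in> V" "y \<in> S" for y e
    using assms that by (auto simp: norm_dist_def)
  then show ?thesis unfolding metric.metric_closure_of mem_Collect_eq by blast
qed

end

lemma prod_norm_closure_iff:
  assumes "cnormed sc UNIV p" "cnormed sc' UNIV p'"
  shows "(x, y) \<in> prod_topology (norm_topology UNIV p) (norm_topology UNIV p') closure_of S \<longleftrightarrow>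
    (\<forall>e>0. \<exists>(x', y')\<in>S. p (x' - x) < e \<and> p' (y' - y) < e)"
proof -
  interpret N: cnormed sc UNIV p by fact
  interpret N': cnormed sc' UNIV p' by fact
  have ball1: "x' \<in> N.metric.mball x e \<longleftrightarrow> p (x' - x) < e" for x x' e
    by (simp add: norm_dist_def N.diff_commute)
  have ball2: "x' \<in> N'.metric.mball x e \<longleftrightarrow> p' (x' - x) < e" for x x' e
    by (simp add: norm_dist_def N'.diff_commute)
  show ?thesis
  proof
    assume L: "(x, y) \<in> prod_topology (norm_topology UNIV p) (norm_topology UNIV p') closure_of S"
    show "\<forall>e>0. \<exists>(x', y')\<in>S. p (x' - x) < e \<and> p' (y' - y) < e"
    proof (intro allI impI)
      fix e :: real assume "0 < e"
      have "openin (prod_topology (norm_topology UNIV p) (norm_topology UNIV p'))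
          (N.metric.mball x e \<times> N'.metric.mball y e)"
        by (simp add: openin_prod_Times_iff)
      moreover have "(x, y) \<in> N.metric.mball x e \<times> N'.metric.mball y e"
        using \<open>0 < e\<close> ball1 ball2 N.norm_0 N'.norm_0 by auto
      ultimately have "\<exists>z\<in>S. z \<in> N.metric.mball x e \<times> N'.metric.mball y e"
        using conjunct2[OF L[unfolded in_closure_of], rule_format, of "N.metric.mball x e \<times> N'.metric.mball y e"]
        by blast
      then show "\<exists>(x', y')\<in>S. p (x' - x) < e \<and> p' (y' - y) < e" using ball1 ball2 by blast
    qed
  next
    assume R: "\<forall>e>0. \<exists>(x', y')\<in>S. p (x' - x) < e \<and> p' (y' - y) < e"
    show "(x, y) \<in> prod_topology (norm_topology UNIV p) (norm_topology UNIV p') closure_of S"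
      unfolding in_closure_of
    proof (intro conjI allI impI)
      fix W assume W: "(x, y) \<in> W \<and> openin (prod_topology (norm_topology UNIV p) (norm_topology UNIV p')) W"
      then obtain W1 W2 where W12: "openin (norm_topology UNIV p) W1" "openin (norm_topology UNIV p') W2"
          "x \<in> W1" "y \<in> W2" "W1 \<times> W2 \<subseteq> W"
        using conjunct2[OF W, unfolded openin_prod_topology_alt, rule_format, OF conjunct1[OF W]] by blast
      obtain r where r: "0 < r" "N.metric.mball x r \<subseteq> W1" using W12 unfolding N.metric.openin_mtopology by blast
      obtain r' where r': "0 < r'" "N'.metric.mball y r' \<subseteq> W2" using W12 unfolding N'.metric.openin_mtopology by blast
      obtain x' y' where "(x', y') \<in> S" "p (x' - x) < min r r'" "p' (y' - y) < min r r'"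
        using R[rule_format, of "min r r'"] r r' by auto
      moreover from this have "x' \<in> W1" "y' \<in> W2" using ball1[of x' x r] ball2[of y' y r'] r r' by auto
      ultimately show "\<exists>z. z \<in> S \<and> z \<in> W" using W12 by blast
    qed simp
  qed
qed

text \<open>
  The closure \<open>R\<close> of the graph of an operator \<open>L\<close> that is defined on a space \<open>E\<close> mapped into a Banach space
  by \<open>i\<close>, with values in a second Banach space.
\<close>

locale closed_graph =
  fixes scE :: "complex \<Rightarrow> 'e::ab_group_add \<Rightarrow> 'e"
    and scA :: "complex \<Rightarrow> 'a::ab_group_add \<Rightarrow> 'a" and pA :: "'a \<Rightarrow> real"
    and scT :: "complex \<Rightarrow> 't::ab_group_add \<Rightarrow> 't" and pT :: "'t \<Rightarrow> real"
    and i :: "'e \<Rightarrow> 'a" and L :: "'e \<Rightarrow> 't"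
  assumes banachA: "complex_banach_space scA UNIV pA"
    and banachT: "complex_banach_space scT UNIV pT"
    and linear_i: "Vector_Spaces.linear scE scA i"
    and linear_L: "Vector_Spaces.linear scE scT L"
begin

sublocale A: cnormed scA UNIV pA
  using banachA by unfold_locales (simp add: complex_banach_space_def)

sublocale T: cnormed scT UNIV pT
  using banachT by unfold_locales (simp add: complex_banach_space_def)

sublocale i: Vector_Spaces.linear scE scA i by (rule linear_i)
sublocale L: Vector_Spaces.linear scE scT L by (rule linear_L)

definition R :: "('a \<times> 't) set" where
  "R = prod_topology (norm_topology UNIV pA) (norm_topology UNIV pT) closure_of range (\<lambda>a. (i a, L a))"

lemma R_iff: "(x, y) \<in> R \<longleftrightarrow> (\<forall>e>0. \<exists>a. pA (i a - x) < e \<and> pT (L a - y) < e)"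
  unfolding R_def prod_norm_closure_iff[OF A.cnormed_axioms T.cnormed_axioms] by auto

lemma R_I: "(i a, L a) \<in> R"
  unfolding R_iff using A.norm_0 T.norm_0 by (metis diff_self)

lemma R_sequence:
  assumes "(x, y) \<in> R"
  shows "\<exists>a. (\<lambda>n. pA (i (a n) - x)) \<longlonglongrightarrow> 0 \<and> (\<lambda>n. pT (L (a n) - y)) \<longlonglongrightarrow> 0"
proof -
  have "\<forall>n. \<exists>a. pA (i a - x) < inverse (Suc n) \<and> pT (L a - y) < inverse (Suc n)"
    using assms unfolding R_iff by (simp del: inverse_eq_divide)
  then obtain a where a: "\<And>n. pA (i (a n) - x) < inverse (Suc n)" "\<And>n. pT (L (a n) - y) < inverse (Suc n)"
    by metis
  have "(\<lambda>n. pA (i (a n) - x)) \<longlonglongrightarrow> 0"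
    by (rule Lim_null_comparison[OF _ LIMSEQ_inverse_real_of_nat])
      (use a(1) A.nonneg in \<open>auto intro!: always_eventually less_imp_le simp del: inverse_eq_divide\<close>)
  moreover have "(\<lambda>n. pT (L (a n) - y)) \<longlonglongrightarrow> 0"
    by (rule Lim_null_comparison[OF _ LIMSEQ_inverse_real_of_nat])
      (use a(2) T.nonneg in \<open>auto intro!: always_eventually less_imp_le simp del: inverse_eq_divide\<close>)
  ultimately show ?thesis by blast
qed

lemma R_closed:
  assumes "\<And>n. (s n, t n) \<in> R" "(\<lambda>n. pA (s n - x)) \<longlonglongrightarrow> 0" "(\<lambda>n. pT (t n - y)) \<longlonglongrightarrow> 0"
  shows "(x, y) \<in> R"
  unfolding R_iff
proof (intro allI impI)
  fix e :: real assume e: "0 < e"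
  have "\<forall>\<^sub>F n in sequentially. pA (s n - x) < e / 2 \<and> pT (t n - y) < e / 2"
    using assms(2,3) e by (intro eventually_conj order_tendstoD) auto
  then obtain n where n: "pA (s n - x) < e / 2" "pT (t n - y) < e / 2"
    by (auto simp: eventually_sequentially)
  obtain a where a: "pA (i a - s n) < e / 2" "pT (L a - t n) < e / 2"
    using assms(1)[of n] e unfolding R_iff by (meson half_gt_zero)
  have "pA (i a - x) < e" using A.diff_triangle[of "i a" "s n" x] n a by simp
  moreover have "pT (L a - y) < e" using T.diff_triangle[of "L a" "t n" y] n a by simp
  ultimately show "\<exists>a. pA (i a - x) < e \<and> pT (L a - y) < e" by blast
qed

lemma R_limit:
  assumes "(\<lambda>n. pA (i (a n) - x)) \<longlonglongrightarrow> 0"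
    and "\<And>e. 0 < e \<Longrightarrow> \<exists>N. \<forall>m\<ge>N. \<forall>n\<ge>N. pT (L (a m) - L (a n)) < e"
  shows "\<exists>y. (x, y) \<in> R \<and> (\<lambda>n. pT (L (a n) - y)) \<longlonglongrightarrow> 0"
proof -
  obtain y where "(\<lambda>n. pT (L (a n) - y)) \<longlonglongrightarrow> 0"
    using T.banach_limit[OF banachT _ assms(2)] by auto
  then show ?thesis using R_closed[OF R_I assms(1)] by blast
qed

lemma R_scale: "(x, y) \<in> R \<Longrightarrow> (scA c x, scT c y) \<in> R"
proof -
  assume "(x, y) \<in> R"
  then obtain a where a: "(\<lambda>n. pA (i (a n) - x)) \<longlonglongrightarrow> 0" "(\<lambda>n. pT (L (a n) - y)) \<longlonglongrightarrow> 0"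
    using R_sequence by blast
  show ?thesis
  proof (rule R_closed[OF R_I])
    show "(\<lambda>n. pA (i (scE c (a n)) - scA c x)) \<longlonglongrightarrow> 0"
      using tendsto_mult_left[OF a(1), of "cmod c"]
      by (simp add: i.scale A.scale_right_diff_distrib[symmetric] A.scale_eq)
    show "(\<lambda>n. pT (L (scE c (a n)) - scT c y)) \<longlonglongrightarrow> 0"
      using tendsto_mult_left[OF a(2), of "cmod c"]
      by (simp add: L.scale T.scale_right_diff_distrib[symmetric] T.scale_eq)
  qed
qed

lemma R_add:
  assumes "(x, y) \<in> R" "(x', y') \<in> R"
  shows "(x + x', y + y') \<in> R"
  unfolding R_iff
proof (intro allI impI)
  fix e :: real assume e: "0 < e"
  obtain a where a: "pA (i a - x) < e / 2" "pT (L a - y) < e / 2"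
    using assms(1) e unfolding R_iff by (meson half_gt_zero)
  obtain b where b: "pA (i b - x') < e / 2" "pT (L b - y') < e / 2"
    using assms(2) e unfolding R_iff by (meson half_gt_zero)
  have "pA (i (a + b) - (x + x')) < e"
    using A.add_le[of "i a - x" "i b - x'"] a b by (simp add: i.add algebra_simps)
  moreover have "pT (L (a + b) - (y + y')) < e"
    using T.add_le[of "L a - y" "L b - y'"] a b by (simp add: L.add algebra_simps)
  ultimately show "\<exists>a. pA (i a - (x + x')) < e \<and> pT (L a - (y + y')) < e" by blast
qed

lemma R_diff:
  assumes "(x, y) \<in> R" "(x', y') \<in> R"
  shows "(x - x', y - y') \<in> R"
  using R_add[OF assms(1) R_scale[OF assms(2), of "-1"]] by simp

lemma single_valued_iff: "single_valued R \<longleftrightarrow> (\<forall>y. (0, y) \<in> R \<longrightarrow> y = 0)"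
proof
  assume "single_valued R"
  moreover have "(0, 0) \<in> R" using R_I[of 0] by (simp add: i.zero L.zero)
  ultimately show "\<forall>y. (0, y) \<in> R \<longrightarrow> y = 0" by (auto dest: single_valuedD)
next
  assume *: "\<forall>y. (0, y) \<in> R \<longrightarrow> y = 0"
  show "single_valued R"
    by (rule single_valuedI) (use R_diff * in \<open>metis diff_self eq_iff_diff_eq_0\<close>)
qed

text \<open>
  Along a sequence that converges in the graph of \<open>L'\<close>, the values of the dominated operator \<open>L\<close> form a
  Cauchy sequence, so they converge as well.
\<close>

lemma comparison:
  assumes "closed_graph scE scA pA scT pT i L'" and K: "\<And>a. pT (L a) \<le> K * pT (L' a)"
    and xy: "(x, y') \<in> closed_graph.R pA pT i L'"
  shows "\<exists>y. (x, y) \<in> R \<and> pT y \<le> K * pT y'"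
proof -
  interpret L': closed_graph scE scA pA scT pT i L' by fact
  obtain a where a: "(\<lambda>n. pA (i (a n) - x)) \<longlonglongrightarrow> 0" "(\<lambda>n. pT (L' (a n) - y')) \<longlonglongrightarrow> 0"
    using L'.R_sequence[OF xy] by blast
  have "\<exists>N. \<forall>m\<ge>N. \<forall>n\<ge>N. pT (L (a m) - L (a n)) < e" if e: "0 < e" for e
  proof -
    have K1: "0 < \<bar>K\<bar> + 1" by simp
    obtain N where N: "\<forall>m\<ge>N. \<forall>n\<ge>N. pT (L' (a m) - L' (a n)) < e / (\<bar>K\<bar> + 1)"
      using T.limit_Cauchy[OF _ _ a(2), of "e / (\<bar>K\<bar> + 1)"] e K1 by auto
    have "pT (L (a m) - L (a n)) < e" if "m \<ge> N" "n \<ge> N" for m n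
    proof -
      have "pT (L (a m) - L (a n)) \<le> K * pT (L' (a m) - L' (a n))"
        using K[of "a m - a n"] by (simp add: L.diff L'.L.diff)
      also have "\<dots> \<le> (\<bar>K\<bar> + 1) * pT (L' (a m) - L' (a n))"
        using T.nonneg[of "L' (a m) - L' (a n)"] by (intro mult_right_mono) auto
      also have "\<dots> < e" using N that K1 by (simp add: pos_less_divide_eq mult.commute)
      finally show ?thesis .
    qed
    then show ?thesis by blast
  qed
  then obtain y where y: "(x, y) \<in> R" "(\<lambda>n. pT (L (a n) - y)) \<longlonglongrightarrow> 0"
    using R_limit[OF a(1)] by blast
  have "(\<lambda>n. pT (L (a n))) \<longlonglongrightarrow> pT y" by (rule T.norm_limit) (use y in auto)
  moreover have "(\<lambda>n. K * pT (L' (a n))) \<longlonglongrightarrow> K * pT y'"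
    by (intro tendsto_mult_left T.norm_limit) (use a in auto)
  ultimately have "pT y \<le> K * pT y'" by (rule LIMSEQ_le) (use K in auto)
  then show ?thesis using y by blast
qed

abbreviation "norm1 \<equiv> graph_norm pA pT R"

context
  assumes sv: "single_valued R"
begin

lemma norm1_eq: "(x, y) \<in> R \<Longrightarrow> norm1 x = pA x + pT y"
proof -
  assume xy: "(x, y) \<in> R"
  then have "(THE y. (x, y) \<in> R) = y"
    by (rule the_equality) (use sv xy in \<open>blast dest: single_valuedD\<close>)
  then show ?thesis by (simp add: graph_norm_def)
qed

lemma subspace_Domain: "A.subspace (Domain R)"
proof (rule A.subspaceI)
  show "0 \<in> Domain R" using R_I[of 0] by (auto simp: i.zero)
  show "x + y \<in> Domain R" if "x \<in> Domain R" "y \<in> Domain R" for x y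
    using that R_add by (meson DomainE DomainI)
  show "scA c x \<in> Domain R" if "x \<in> Domain R" for c x
    using that R_scale by (meson DomainE DomainI)
qed

lemma normed1: "complex_normed_space scA (Domain R) norm1"
  unfolding complex_normed_space_def
proof (intro conjI ballI allI impI)
  show "vector_space scA" by (rule A.vector_space_axioms)
  show "A.subspace (Domain R)" by (rule subspace_Domain)
  fix x assume "x \<in> Domain R"
  then obtain y where y: "(x, y) \<in> R" by blast
  show "0 \<le> norm1 x" using norm1_eq[OF y] A.nonneg T.nonneg by simp
  show "x = 0" if "norm1 x = 0"
    using norm1_eq[OF y] A.nonneg[of x] T.nonneg[of y] A.zero_iff[of x] that by simp
  show "norm1 (scA c x) = cmod c * norm1 x" for c
    using norm1_eq[OF y] norm1_eq[OF R_scale[OF y]] by (simp add: A.scale_eq T.scale_eq algebra_simps)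
  fix x' assume "x' \<in> Domain R"
  then obtain y' where y': "(x', y') \<in> R" by blast
  show "norm1 (x + x') \<le> norm1 x + norm1 x'"
    using norm1_eq[OF y] norm1_eq[OF y'] norm1_eq[OF R_add[OF y y']] A.add_le[of x x'] T.add_le[of y y'] by simp
qed

lemma banach1: "complex_banach_space scA (Domain R) norm1"
proof -
  interpret D: cnormed scA "Domain R" norm1 by unfold_locales (rule normed1)
  show ?thesis
  proof (rule D.complex_banach_spaceI)
    fix s :: "nat \<Rightarrow> 'a"
    assume "s n \<in> Domain R" for n
    then obtain t where t: "\<And>n. (s n, t n) \<in> R" by (meson DomainE)
    assume cauchy: "\<exists>N. \<forall>m\<ge>N. \<forall>n\<ge>N. norm1 (s m - s n) < e" if "0 < e" for e
    have eq: "norm1 (s m - s n) = pA (s m - s n) + pT (t m - t n)" for m n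
      by (rule norm1_eq[OF R_diff[OF t t]])
    have le: "pA (s m - s n) \<le> norm1 (s m - s n)" "pT (t m - t n) \<le> norm1 (s m - s n)" for m n
      unfolding eq using A.nonneg T.nonneg by auto
    obtain x where x: "(\<lambda>n. pA (s n - x)) \<longlonglongrightarrow> 0"
      using A.banach_limit[OF banachA, of s] cauchy le by (meson UNIV_I le_less_trans)
    obtain y where y: "(\<lambda>n. pT (t n - y)) \<longlonglongrightarrow> 0"
      using T.banach_limit[OF banachT, of t] cauchy le by (meson UNIV_I le_less_trans)
    have R: "(x, y) \<in> R" by (rule R_closed[OF t x y])
    have "(\<lambda>n. norm1 (s n - x)) \<longlonglongrightarrow> 0"
      unfolding norm1_eq[OF R_diff[OF t R]] using tendsto_add[OF x y] by simp
    then show "\<exists>x\<in>Domain R. (\<lambda>n. norm1 (s n - x)) \<longlonglongrightarrow> 0" using R by blast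
  qed
qed

lemma dense1: "norm_topology (Domain R) norm1 closure_of range i = Domain R"
proof -
  interpret D: cnormed scA "Domain R" norm1 by unfold_locales (rule normed1)
  have ran: "range i \<subseteq> Domain R" using R_I by blast
  have "\<exists>z\<in>range i. norm1 (x - z) < e" if xy: "(x, y) \<in> R" and e: "0 < e" for x y e
  proof -
    obtain a where a: "pA (i a - x) < e / 2" "pT (L a - y) < e / 2"
      using xy e unfolding R_iff by (meson half_gt_zero)
    have "norm1 (x - i a) < e"
      using norm1_eq[OF R_diff[OF xy R_I[of a]]] a A.diff_commute[of x "i a"] T.diff_commute[of y "L a"] by simp
    then show ?thesis by blast
  qed
  then show ?thesis using D.closure_iff[OF ran] by auto
qed

lemma norm1_ge: "x \<in> Domain R \<Longrightarrow> pA x \<le> norm1 x"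
proof -
  assume "x \<in> Domain R"
  then obtain y where "(x, y) \<in> R" by blast
  from norm1_eq[OF this] show ?thesis using T.nonneg[of y] by simp
qed

end
end

section \<open>Inverting \<open>1 - w\<close> in a Banach algebra\<close>

text \<open>
  The Neumann series. In \<open>inverse_in_A1\<close> the right inverse is compared with a two-sided inverse that exists
  in a larger algebra.
\<close>

lemma neumann_right_inverse:
  fixes w :: "'a::ring_1"
  assumes alg: "complex_banach_algebra sc B p"
    and mult: "\<And>x y. x \<in> B \<Longrightarrow> y \<in> B \<Longrightarrow> p (x * y) \<le> C * p x * p y"
    and C: "0 \<le> C" and w: "w \<in> B" "C * p w < 1"
  shows "\<exists>u\<in>B. (1 - w) * u = 1"
proof -
  have banach: "complex_banach_space sc B p" and sub: "unital_subalgebra sc B"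
    using alg by (auto simp: complex_banach_algebra_def)
  interpret cnormed sc B p
    by unfold_locales (use banach in \<open>simp add: complex_banach_space_def\<close>)
  have one: "1 \<in> B" and times: "\<And>x y. x \<in> B \<Longrightarrow> y \<in> B \<Longrightarrow> x * y \<in> B"
    using sub by (auto simp: unital_subalgebra_def)
  have pow: "w ^ n \<in> B" for n by (induction n) (auto simp: one times w)
  define r where "r = C * p w"
  have r: "0 \<le> r" "r < 1" using C w nonneg by (auto simp: r_def)
  have pow_le: "p (w ^ Suc n) \<le> r ^ n * p w" for n
  proof (induction n)
    case (Suc n)
    have "p (w ^ Suc (Suc n)) \<le> C * p w * p (w ^ Suc n)"
      using mult[OF w(1) pow[of "Suc n"]] by simp
    also have "\<dots> \<le> r * (r ^ n * p w)"
      unfolding r_def[symmetric] using Suc r by (intro mult_left_mono) auto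
    finally show ?case by (simp add: mult_ac)
  qed simp
  have "summable (\<lambda>n. p (w ^ Suc n))"
  proof (rule summable_comparison_test')
    show "summable (\<lambda>n. r ^ n * p w)" using r by (intro summable_mult2 summable_geometric) auto
    show "norm (p (w ^ Suc n)) \<le> r ^ n * p w" if "n \<ge> 0" for n
      using pow_le[of n] nonneg[OF pow[of "Suc n"]] by simp
  qed
  then have sm: "summable (\<lambda>n. p (w ^ n))" using summable_Suc_iff by blast
  define s where "s n = (\<Sum>j<n. w ^ j)" for n
  have sB: "s n \<in> B" for n unfolding s_def by (rule subspace_sum[OF carrier]) (rule pow)
  have diff: "p (s m - s n) \<le> (\<Sum>j=n..<m. p (w ^ j))" if "n \<le> m" for m n
    using that
  proof (induction m rule: dec_induct)
    case (step m)
    have "p (s (Suc m) - s n) \<le> p (w ^ m) + p (s m - s n)"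
      using add_le[OF pow[of m] diff_in[OF sB sB], of m n] by (simp add: s_def algebra_simps)
    with step show ?case by simp
  qed (simp add: norm_0)
  have cauchy: "\<exists>N. \<forall>m\<ge>N. \<forall>n\<ge>N. p (s m - s n) < e" if "0 < e" for e
  proof -
    obtain N where N: "\<And>m n. m \<ge> N \<Longrightarrow> norm (\<Sum>j=m..<n. p (w ^ j)) < e"
      using sm \<open>0 < e\<close> unfolding summable_Cauchy by blast
    have "p (s m - s n) < e" if "m \<ge> N" "n \<ge> N" for m n
      using diff[of n m] diff[of m n] N[of n m] N[of m n] that diff_commute[OF sB sB, of m n]
      by (cases "n \<le> m") auto
    then show ?thesis by blast
  qed
  obtain u where u: "u \<in> B" "(\<lambda>n. p (s n - u)) \<longlonglongrightarrow> 0"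
    using banach_limit[where s = s, OF banach sB cauchy] by blast
  have tel: "(1 - w) * s n = 1 - w ^ n" for n
  proof (induction n)
    case (Suc n)
    have "(1 - w) * s (Suc n) = (1 - w) * s n + (1 - w) * w ^ n" by (simp add: s_def distrib_left)
    also have "\<dots> = (1 - w ^ n) + (w ^ n - w ^ Suc n)"
      unfolding Suc by (simp add: left_diff_distrib)
    finally show ?case by simp
  qed (simp add: s_def)
  have 1: "1 - w \<in> B" by (rule diff_in[OF one w(1)])
  have "(\<lambda>n. p ((1 - w) * u - 1)) \<longlonglongrightarrow> 0"
  proof (rule Lim_null_comparison)
    have "p ((1 - w) * u - 1) \<le> C * p (1 - w) * p (s n - u) + p (w ^ n)" for n
    proof -
      have "(1 - w) * u - 1 = (1 - w) * (u - s n) - w ^ n"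
        using tel[of n] by (simp add: right_diff_distrib)
      also have "p \<dots> \<le> p ((1 - w) * (u - s n)) + p (0 - w ^ n)"
        using diff_triangle[OF times[OF 1 diff_in[OF u(1) sB]] zero_in pow] by simp
      also have "p (0 - w ^ n) = p (w ^ n)"
        using diff_commute[OF zero_in pow] by simp
      also have "p ((1 - w) * (u - s n)) \<le> C * p (1 - w) * p (s n - u)"
        using mult[OF 1 diff_in[OF u(1) sB]] diff_commute[OF u(1) sB] by simp
      finally show ?thesis by simp
    qed
    then show "\<forall>\<^sub>F n in sequentially. norm (p ((1 - w) * u - 1)) \<le> C * p (1 - w) * p (s n - u) + p (w ^ n)"
      using nonneg[OF diff_in[OF times[OF 1 u(1)] one]] by simp
    show "(\<lambda>n. C * p (1 - w) * p (s n - u) + p (w ^ n)) \<longlonglongrightarrow> 0"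
      using tendsto_add[OF tendsto_mult_left[OF u(2)] summable_LIMSEQ_zero[OF sm]] by simp
  qed
  then have "p ((1 - w) * u - 1) = 0" by (simp add: LIMSEQ_const_iff)
  then have "(1 - w) * u - 1 = 0" by (rule zero_iff[OF diff_in[OF times[OF 1 u(1)] one]])
  then show ?thesis using u(1) by auto
qed

text \<open>
  By induction from \<open>1 - w\<^sup>2 = (1 - w) (1 + w)\<close>.
\<close>

lemma right_inverse_of_squaring:
  fixes w :: "'a::ring_1"
  assumes B: "unital_subalgebra sc B" "\<And>x y. x \<in> B \<Longrightarrow> y \<in> B \<Longrightarrow> x + y \<in> B"
    and "w \<in> B" "\<exists>u\<in>B. (1 - w ^ (2 ^ k)) * u = 1"
  shows "\<exists>u\<in>B. (1 - w) * u = 1"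
  using assms(3,4)
proof (induction k arbitrary: w)
  case (Suc k)
  have "w ^ (2 ^ Suc k) = (w * w) ^ (2 ^ k)" by (simp add: power_mult power2_eq_square)
  moreover have "w * w \<in> B" using Suc.prems(1) B by (simp add: unital_subalgebra_def)
  ultimately obtain u where u: "u \<in> B" "(1 - w * w) * u = 1" using Suc by metis
  have "(1 - w) * ((1 + w) * u) = 1"
    using u(2) by (simp add: algebra_simps)
  moreover have "(1 + w) * u \<in> B" using B u Suc.prems(1) by (simp add: unital_subalgebra_def)
  ultimately show ?case by blast
qed simp

section \<open>Closability of the quasiderivation\<close>

locale uc_tensor_algebra =
  fixes scaleA :: "complex \<Rightarrow> 'a::ring_1 \<Rightarrow> 'a"
    and normA :: "'a \<Rightarrow> real"
    and \<iota> :: "('g::group_add \<Rightarrow>\<^sub>0 complex) \<Rightarrow> 'a"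
    and scaleT :: "complex \<Rightarrow> 't::ab_group_add \<Rightarrow> 't"
    and normT :: "'t \<Rightarrow> real"
    and tens :: "'a \<Rightarrow> 'a \<Rightarrow> 't"
  assumes algebra: "unconditional_banach_algebra scaleA UNIV normA \<iota>"
    and tensor: "uc_tensor_completion scaleA normA \<iota> scaleT normT tens"
begin

abbreviation "J \<equiv> tensor_incl scaleT tens \<iota>"

definition q where "q a = normA (\<iota> a)"

lemma banach_algebra: "complex_banach_algebra scaleA UNIV normA"
  using algebra by (simp add: unconditional_banach_algebra_def)

lemma banachA: "complex_banach_space scaleA UNIV normA"
  using banach_algebra by (simp add: complex_banach_algebra_def)

lemma banachT: "complex_banach_space scaleT UNIV normT"
  using tensor by (simp add: uc_tensor_completion_def)

sublocale A: cnormed scaleA UNIV normA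
  using banachA by unfold_locales (simp add: complex_banach_space_def)

sublocale T: cnormed scaleT UNIV normT
  using banachT by unfold_locales (simp add: complex_banach_space_def)

lemma linear_\<iota>: "Vector_Spaces.linear cscale scaleA \<iota>"
  and dense_\<iota>: "norm_topology UNIV normA closure_of range \<iota> = UNIV"
  using algebra by (auto simp: unconditional_banach_algebra_def completion_of_def)

lemma \<iota>_one: "\<iota> 1 = 1" and \<iota>_times: "\<iota> (a * b) = \<iota> a * \<iota> b" and inj_\<iota>: "inj \<iota>"
  using algebra by (auto simp: unconditional_banach_algebra_def)

sublocale \<iota>: Vector_Spaces.linear cscale scaleA \<iota> by (rule linear_\<iota>)

text \<open>
  A fixed constant with which the product of the algebra is bounded, taken at least \<open>1\<close> so that a bound
  on \<open>C * normA x\<close> is also a bound on \<open>normA x\<close>.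
\<close>

definition C where "C = (SOME C. 1 \<le> C \<and> (\<forall>x y. normA (x * y) \<le> C * normA x * normA y))"

lemma C: "1 \<le> C" "normA (x * y) \<le> C * normA x * normA y"
proof -
  obtain C0 where C0: "\<And>x y. normA (x * y) \<le> C0 * normA x * normA y"
    using banach_algebra by (auto simp: complex_banach_algebra_def)
  have "normA (x * y) \<le> max 1 C0 * normA x * normA y" for x y
    using C0[of x y] mult_right_mono[of C0 "max 1 C0" "normA x * normA y"] A.nonneg
    by (force simp: mult.assoc intro: order_trans)
  then have "\<exists>C. 1 \<le> C \<and> (\<forall>x y. normA (x * y) \<le> C * normA x * normA y)"
    by (intro exI[of _ "max 1 C0"]) simp
  from someI_ex[OF this] show "1 \<le> C" "normA (x * y) \<le> C * normA x * normA y"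
    unfolding C_def by auto
qed

lemma unconditional_q: "unconditional_seminorm q"
proof -
  obtain q' where "unconditional_seminorm q'" "\<And>a. normA (\<iota> a) = q' a"
    using algebra by (auto simp: unconditional_banach_algebra_def completion_of_def)
  moreover from this have "q = q'" by (auto simp: q_def)
  ultimately show ?thesis by simp
qed

sublocale q: unconditional_algebra_norm q C
proof
  show "unconditional_seminorm q" by (rule unconditional_q)
  show "0 \<le> C" using C(1) by simp
  show "q (a * b) \<le> C * q a * q b" for a b
    unfolding q_def \<iota>_times by (rule C(2))
qed

text \<open>
  Injectivity of \<open>\<iota>\<close> makes the seminorm of the group ring a norm, which is what makes coefficients
  continuous.
\<close>

lemma q_basis_pos: "0 < q (basis_vec g)"
proof -
  have "\<iota> (basis_vec g) \<noteq> \<iota> 0"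
    using inj_\<iota> by (metis injD lookup_single_eq lookup_zero zero_neq_one)
  then have "normA (\<iota> (basis_vec g)) \<noteq> 0" using A.zero_iff \<iota>.zero by auto
  then show ?thesis using A.nonneg[of "\<iota> (basis_vec g)"] by (simp add: q_def)
qed

lemma coefficient_le: "mag a g * q (basis_vec g) \<le> q a"
proof -
  have "mag a g * q (basis_vec g) = q (cscale (Poly_Mapping.lookup a g) (basis_vec g))"
    by (simp add: q_def \<iota>.scale A.scale_eq)
  also have "\<dots> \<le> q a" by (rule q.q_mono) (simp add: lookup_single_if)
  finally show ?thesis .
qed

lemma normT_J: "normT (J \<gamma>) = uc_norm q \<gamma>"
  using tensor by (simp add: uc_tensor_completion_def q_def[abs_def])

lemma J_superset:
  assumes "finite Z" "Poly_Mapping.keys \<gamma> \<subseteq> Z"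
  shows "J \<gamma> = (\<Sum>z\<in>Z. scaleT (Poly_Mapping.lookup \<gamma> z) (tens (\<iota> (basis_vec (fst z))) (\<iota> (basis_vec (snd z)))))"
  unfolding tensor_incl_def
  by (rule sum.mono_neutral_left) (use assms in \<open>auto simp: in_keys_iff\<close>)

lemma vector_space_cscale: "vector_space (cscale :: complex \<Rightarrow> ('x \<Rightarrow>\<^sub>0 complex) \<Rightarrow> _)"
  by unfold_locales (auto intro!: poly_mapping_eqI simp: lookup_add algebra_simps)

lemma linear_J: "Vector_Spaces.linear cscale scaleT J"
  unfolding Vector_Spaces.linear_iff
proof (intro conjI allI vector_space_cscale T.vector_space_axioms)
  fix \<gamma> \<gamma>' :: "'g \<times> 'g \<Rightarrow>\<^sub>0 complex" and c
  let ?Z = "Poly_Mapping.keys \<gamma> \<union> Poly_Mapping.keys \<gamma>'"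
  show "J (\<gamma> + \<gamma>') = J \<gamma> + J \<gamma>'"
    using J_superset[of ?Z \<gamma>] J_superset[of ?Z \<gamma>'] J_superset[of ?Z "\<gamma> + \<gamma>'"] keys_add[of \<gamma> \<gamma>']
    by (simp add: lookup_add T.scale_left_distrib sum.distrib)
  show "J (cscale c \<gamma>) = scaleT c (J \<gamma>)"
    using J_superset[of ?Z \<gamma>] J_superset[of ?Z "cscale c \<gamma>"]
    by (simp add: T.scale_sum_right subset_iff in_keys_iff)
qed

sublocale J: Vector_Spaces.linear cscale scaleT J by (rule linear_J)

lemma uc_norm_basis: "uc_norm q (basis_vec (h, k)) = q (basis_vec h) * q (basis_vec k)"
proof -
  have "normT (J (basis_vec (h, k))) = normT (tens (\<iota> (basis_vec h)) (\<iota> (basis_vec k)))"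
    by (simp add: tensor_incl_def)
  also have "\<dots> = q (basis_vec h) * q (basis_vec k)"
    using tensor by (simp add: uc_tensor_completion_def q_def)
  finally show ?thesis by (simp add: normT_J)
qed

end

locale group_quasiderivation = uc_tensor_algebra scaleA normA \<iota> scaleT normT tens
  for scaleA :: "complex \<Rightarrow> 'a::ring_1 \<Rightarrow> 'a"
    and normA :: "'a \<Rightarrow> real"
    and \<iota> :: "('g::group_add \<Rightarrow>\<^sub>0 complex) \<Rightarrow> 'a"
    and scaleT :: "complex \<Rightarrow> 't::ab_group_add \<Rightarrow> 't"
    and normT :: "'t \<Rightarrow> real"
    and tens :: "'a \<Rightarrow> 'a \<Rightarrow> 't" +
  fixes S :: "'g set" and \<sigma> :: "'g \<Rightarrow> 'g list"
  assumes gen: "fin_sym_generating S" and minimal: "minimal_presentation S \<sigma>"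
begin

abbreviation "\<Delta> \<equiv> quasiderivation \<sigma>"

lemma linear_\<Delta>: "Vector_Spaces.linear cscale cscale \<Delta>"
  unfolding Vector_Spaces.linear_iff
proof (intro conjI allI vector_space_cscale)
  show "\<Delta> (a + b) = \<Delta> a + \<Delta> b" for a b
    by (rule poly_mapping_eqI) (auto simp: lookup_add lookup_quasiderivation[OF gen minimal] split_paired_all)
  show "\<Delta> (cscale c a) = cscale c (\<Delta> a)" for c a
    by (rule poly_mapping_eqI) (auto simp: lookup_quasiderivation[OF gen minimal] split_paired_all)
qed

abbreviation "L \<equiv> \<lambda>a. J (\<Delta> a)"

lemma linear_L: "Vector_Spaces.linear cscale scaleT L"
  using Vector_Spaces.linear_compose[OF linear_\<Delta> linear_J] by (simp add: o_def)

sublocale G: closed_graph cscale scaleA normA scaleT normT \<iota> L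
  by (rule closed_graph.intro[OF banachA banachT linear_\<iota> linear_L])

lemma closure_eq: "quasiderivation_closure normA \<iota> scaleT normT tens \<sigma> = G.R"
  by (simp add: quasiderivation_closure_def G.R_def)

lemma uc_diff: "uc_norm q (\<gamma> - \<gamma>') = normT (J \<gamma> - J \<gamma>')"
  by (simp add: normT_J[symmetric] J.diff)

text \<open>
  Let \<open>(0, y)\<close> be in the closure of the graph. Choose \<open>b\<close> with \<open>\<Delta>(b)\<close> close to \<open>y\<close>, and then, depending on
  the support \<open>F\<close> of \<open>\<Delta>(b)\<close>, choose \<open>a\<close> so small that the part \<open>\<gamma>\<close> of \<open>\<Delta>(a)\<close> on \<open>F\<close> is negligible, with
  \<open>\<Delta>(a)\<close> again close to \<open>y\<close>. Unconditionality gives \<open>\<parallel>\<Delta>(b) - \<gamma>\<parallel> \<le> \<parallel>\<Delta>(b) - \<Delta>(a)\<parallel>\<close>, so \<open>\<Delta>(b)\<close>, and hence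
  \<open>y\<close>, is small.
\<close>

lemma closable: "single_valued G.R"
  unfolding G.single_valued_iff
proof (intro allI impI)
  fix y assume y: "(0, y) \<in> G.R"
  have "normT y \<le> 0 + e" if e': "0 < e" for e :: real
  proof -
    (* normT y is at most one \<epsilon> for replacing y by L b, two for replacing L b by L a, and one for
       the part of L a on F. *)
    define \<epsilon> where "\<epsilon> = e / 4"
    have e: "0 < \<epsilon>" using e' by (simp add: \<epsilon>_def)
    obtain b where b: "normT (L b - y) < \<epsilon>"
      using y e unfolding G.R_iff by blast
    define F where "F = Poly_Mapping.keys (\<Delta> b)"
    define M where "M = (\<Sum>(h, k)\<in>F. q (basis_vec h) * q (basis_vec k) / q (basis_vec (h + k)))"
    have M: "0 \<le> M" unfolding M_def by (intro sum_nonneg) (auto simp: q.q_nonneg)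
    have "0 < min \<epsilon> (\<epsilon> / (M + 1))" using e M by simp
    then obtain a where a: "normA (\<iota> a - 0) < min \<epsilon> (\<epsilon> / (M + 1))" "normT (L a - y) < min \<epsilon> (\<epsilon> / (M + 1))"
      using y unfolding G.R_iff by blast
    have qa: "q a * M \<le> \<epsilon>"
    proof -
      have "q a * M \<le> q a * (M + 1)" using q.q_nonneg by (simp add: mult_left_mono)
      also have "\<dots> \<le> \<epsilon>" using a(1) M by (simp add: q_def pos_less_divide_eq)
      finally show ?thesis .
    qed
    define \<gamma> where "\<gamma> = (\<Sum>z\<in>F. cscale (Poly_Mapping.lookup (\<Delta> a) z) (basis_vec z))"
    have \<gamma>: "Poly_Mapping.lookup \<gamma> z = (if z \<in> F then Poly_Mapping.lookup (\<Delta> a) z else 0)" for z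
      by (simp add: \<gamma>_def lookup_sum lookup_single_if F_def if_distrib cong: if_cong)
    have "abs_le (\<Delta> b - \<gamma>) (\<Delta> b - \<Delta> a)"
      by (auto simp: abs_le_def lookup_minus \<gamma> F_def in_keys_iff)
    then have "normT (L b - J \<gamma>) \<le> normT (L b - L a)"
      using q.uc_norm_mono by (simp add: uc_diff[symmetric])
    also have "\<dots> \<le> normT (L b - y) + normT (y - L a)" by (rule T.diff_triangle) auto
    finally have 1: "normT (L b - J \<gamma>) \<le> 2 * \<epsilon>"
      using a b T.diff_commute[of y "L a"] by simp
    have "normT (J \<gamma>) \<le> (\<Sum>z\<in>F. normT (J (cscale (Poly_Mapping.lookup (\<Delta> a) z) (basis_vec z))))"
    proof -
      have sum_le: "normT (\<Sum>z\<in>Z. f z) \<le> (\<Sum>z\<in>Z. normT (f z))" if "finite Z" for Z and f :: "'g \<times> 'g \<Rightarrow> 't"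
        using that
      proof (induction Z rule: finite_induct)
        case (insert z Z)
        then show ?case using T.add_le[of "f z" "\<Sum>z\<in>Z. f z"] by simp
      qed (simp add: T.norm_0)
      show ?thesis unfolding \<gamma>_def J.sum by (rule sum_le) (simp add: F_def)
    qed
    also have "\<dots> \<le> (\<Sum>(h, k)\<in>F. q a * (q (basis_vec h) * q (basis_vec k) / q (basis_vec (h + k))))"
    proof (rule sum_mono)
      fix z assume "z \<in> F"
      obtain h k where z: "z = (h, k)" by (cases z)
      have "mag (\<Delta> a) (h, k) \<le> mag a (h + k)"
        by (simp add: lookup_quasiderivation[OF gen minimal])
      also have "\<dots> \<le> q a / q (basis_vec (h + k))"
        using coefficient_le[of a "h + k"] q_basis_pos[of "h + k"] by (simp add: pos_le_divide_eq)
      finally have "mag (\<Delta> a) (h, k) * (q (basis_vec h) * q (basis_vec k))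
          \<le> q a / q (basis_vec (h + k)) * (q (basis_vec h) * q (basis_vec k))"
        by (intro mult_right_mono) (auto simp: q.q_nonneg)
      then show "normT (J (cscale (Poly_Mapping.lookup (\<Delta> a) z) (basis_vec z)))
          \<le> (case z of (h, k) \<Rightarrow> q a * (q (basis_vec h) * q (basis_vec k) / q (basis_vec (h + k))))"
        by (simp add: z J.scale T.scale_eq normT_J uc_norm_basis)
    qed
    also have "\<dots> = q a * M" by (simp add: M_def sum_distrib_left case_prod_unfold)
    finally have 2: "normT (J \<gamma>) \<le> \<epsilon>" using qa by simp
    have "normT y \<le> normT (L b) + normT (y - L b)" by (rule T.norm_le) auto
    moreover have "normT (L b) \<le> normT (J \<gamma>) + normT (L b - J \<gamma>)" by (rule T.norm_le) auto
    ultimately show "normT y \<le> 0 + e"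
      using 1 2 b T.diff_commute[of y "L b"] e' by (simp add: \<epsilon>_def)
  qed
  then have "normT y \<le> 0" by (rule field_le_epsilon)
  then have "normT y = 0" using T.nonneg[of y] by simp
  then show "y = 0" by (rule T.zero_iff[rotated]) simp
qed

abbreviation "A1 \<equiv> Domain G.R"

lemmas norm1_eq = G.norm1_eq[OF closable]

end

section \<open>The smooth subalgebra\<close>

locale hyperbolic_quasiderivation = group_quasiderivation scaleA normA \<iota> scaleT normT tens S \<sigma>
  for scaleA :: "complex \<Rightarrow> 'a::ring_1 \<Rightarrow> 'a"
    and normA :: "'a \<Rightarrow> real"
    and \<iota> :: "('g::group_add \<Rightarrow>\<^sub>0 complex) \<Rightarrow> 'a"
    and scaleT :: "complex \<Rightarrow> 't::ab_group_add \<Rightarrow> 't"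
    and normT :: "'t \<Rightarrow> real"
    and tens :: "'a \<Rightarrow> 'a \<Rightarrow> 't"
    and S :: "'g set" and \<sigma> :: "'g \<Rightarrow> 'g list" +
  assumes hyperbolic: "word_hyperbolic TYPE('g)"
begin

lemma uc_comparison:
  assumes S': "fin_sym_generating S'" "minimal_presentation S' \<sigma>'"
  shows "\<exists>K\<ge>0. \<forall>a. uc_norm q (\<Delta> a) \<le> K * uc_norm q (quasiderivation \<sigma>' a)"
proof -
  obtain B where B: "finite B" "\<And>g h. h \<in> prefixes_of \<sigma> g \<Longrightarrow> \<exists>h'\<in>prefixes_of \<sigma>' g. - h' + h \<in> B"
    using prefixes_close[OF hyperbolic gen minimal S'] by blast
  have "0 \<le> (\<Sum>r\<in>B. C ^ 2 * q (basis_vec r) * q (basis_vec (- r)))"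
    by (intro sum_nonneg mult_nonneg_nonneg q.q_nonneg) simp
  then show ?thesis
    using q.uc_quasiderivation_comparison[OF gen minimal S' B] by blast
qed

lemma norm1_comparison:
  assumes S': "fin_sym_generating S'" "minimal_presentation S' \<sigma>'"
  shows "\<exists>K\<ge>1. \<forall>x\<in>Domain (quasiderivation_closure normA \<iota> scaleT normT tens \<sigma>').
    x \<in> A1 \<and> G.norm1 x \<le> K * graph_norm normA normT (quasiderivation_closure normA \<iota> scaleT normT tens \<sigma>') x"
proof -
  interpret O: group_quasiderivation scaleA normA \<iota> scaleT normT tens S' \<sigma>'
    by unfold_locales (fact S')+
  obtain K where K: "0 \<le> K" "\<And>a. uc_norm q (\<Delta> a) \<le> K * uc_norm q (O.\<Delta> a)"
    using uc_comparison[OF S'] by blast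
  have LK: "normT (L a) \<le> K * normT (O.L a)" for a using K(2) by (simp add: normT_J)
  show ?thesis
    unfolding O.closure_eq
  proof (intro exI[of _ "max 1 K"] conjI ballI)
    show "1 \<le> max 1 K" by simp
    fix x assume "x \<in> O.A1"
    then obtain y' where y': "(x, y') \<in> O.G.R" by blast
    obtain y where y: "(x, y) \<in> G.R" "normT y \<le> K * normT y'"
      using G.comparison[OF O.G.closed_graph_axioms LK y'] by blast
    show "x \<in> A1" using y by blast
    have "K * normT y' \<le> max 1 K * normT y'" "1 * normA x \<le> max 1 K * normA x"
      using T.nonneg A.nonneg by (intro mult_right_mono; simp)+
    then show "G.norm1 x \<le> max 1 K * O.G.norm1 x"
      unfolding norm1_eq[OF y(1)] O.norm1_eq[OF y'] using y(2) by (simp add: distrib_left)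
  qed
qed

text \<open>
  The Leibniz inequality is available for one presentation, for which triangles are known to be thin. It
  passes to every other one because the norms of the two quasiderivations bound each other.
\<close>

lemma L_leibniz: "\<exists>M\<ge>0. \<forall>a b. normT (L (a * b)) \<le> M * (normT (L a) * q b + q a * normT (L b))"
proof -
  obtain S0 :: "'g set" and \<sigma>0 B where S0: "fin_sym_generating S0" "minimal_presentation S0 \<sigma>0"
    and B: "finite B" "\<And>g1 g2 h. h \<in> prefixes_of \<sigma>0 (g1 + g2) \<Longrightarrow>
       (\<exists>h'\<in>prefixes_of \<sigma>0 g1. - h' + h \<in> B) \<or> (\<exists>h'\<in>prefixes_of \<sigma>0 g2. - (g1 + h') + h \<in> B)"
    using thin_presentation_exists[OF hyperbolic] by blast
  interpret O: hyperbolic_quasiderivation scaleA normA \<iota> scaleT normT tens S0 \<sigma>0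
    by unfold_locales (fact S0 hyperbolic)+
  obtain K where K: "0 \<le> K" "\<And>a. uc_norm q (\<Delta> a) \<le> K * uc_norm q (O.\<Delta> a)"
    using uc_comparison[OF S0] by blast
  obtain K' where K': "0 \<le> K'" "\<And>a. uc_norm q (O.\<Delta> a) \<le> K' * uc_norm q (\<Delta> a)"
    using O.uc_comparison[OF gen minimal] by blast
  define M where "M = (\<Sum>r\<in>B. C ^ 3 * q (basis_vec r) * q (basis_vec (- r)))"
  have M: "0 \<le> M" unfolding M_def
    using C(1) by (intro sum_nonneg mult_nonneg_nonneg q.q_nonneg zero_le_power) simp
  have "uc_norm q (\<Delta> (a * b)) \<le> K * M * K' * (uc_norm q (\<Delta> a) * q b + q a * uc_norm q (\<Delta> b))" for a b
  proof -
    have "uc_norm q (\<Delta> (a * b)) \<le> K * uc_norm q (O.\<Delta> (a * b))" by (rule K(2))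
    also have "\<dots> \<le> K * (M * (uc_norm q (O.\<Delta> a) * q b + q a * uc_norm q (O.\<Delta> b)))"
      unfolding M_def by (intro mult_left_mono K(1) q.uc_quasiderivation_leibniz[OF S0 B])
    also have "\<dots> \<le> K * (M * (K' * uc_norm q (\<Delta> a) * q b + q a * (K' * uc_norm q (\<Delta> b))))"
      by (intro mult_left_mono add_mono mult_right_mono K K' M q.q_nonneg)
    finally show ?thesis by (simp add: algebra_simps)
  qed
  then show ?thesis using K(1) K'(1) M by (intro exI[of _ "K * M * K'"]) (simp add: normT_J)
qed

text \<open>
  The Leibniz inequality in the completion. Applied to the differences in
  \<open>a\<^sub>m b\<^sub>m - a\<^sub>n b\<^sub>n = (a\<^sub>m - a\<^sub>n) b\<^sub>m + a\<^sub>n (b\<^sub>m - b\<^sub>n)\<close>, it shows that the values of the quasiderivation on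
  products of approximating sequences converge.
\<close>

lemma R_leibniz:
  "\<exists>M\<ge>0. \<forall>x s y t. (x, s) \<in> G.R \<longrightarrow> (y, t) \<in> G.R \<longrightarrow>
     (\<exists>u. (x * y, u) \<in> G.R \<and> normT u \<le> M * (normT s * normA y + normA x * normT t))"
proof -
  obtain M where M: "0 \<le> M" "\<And>a b. normT (L (a * b)) \<le> M * (normT (L a) * q b + q a * normT (L b))"
    using L_leibniz by blast
  have "\<exists>u. (x * y, u) \<in> G.R \<and> normT u \<le> M * (normT s * normA y + normA x * normT t)"
    if xs: "(x, s) \<in> G.R" and yt: "(y, t) \<in> G.R" for x s y t
  proof -
    obtain a where a: "(\<lambda>n. normA (\<iota> (a n) - x)) \<longlonglongrightarrow> 0" "(\<lambda>n. normT (L (a n) - s)) \<longlonglongrightarrow> 0"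
      using G.R_sequence[OF xs] by blast
    obtain b where b: "(\<lambda>n. normA (\<iota> (b n) - y)) \<longlonglongrightarrow> 0" "(\<lambda>n. normT (L (b n) - t)) \<longlonglongrightarrow> 0"
      using G.R_sequence[OF yt] by blast
    have lim: "(\<lambda>n. q (a n)) \<longlonglongrightarrow> normA x" "(\<lambda>n. q (b n)) \<longlonglongrightarrow> normA y"
      "(\<lambda>n. normT (L (a n))) \<longlonglongrightarrow> normT s" "(\<lambda>n. normT (L (b n))) \<longlonglongrightarrow> normT t"
      unfolding q_def using a b by (auto intro!: A.norm_limit T.norm_limit)
    have bounded: "\<exists>D. \<forall>n. f n \<le> D" if "f \<longlonglongrightarrow> l" for f :: "nat \<Rightarrow> real" and l
      using convergent_imp_Bseq[OF convergentI[OF that]] unfolding Bseq_def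
      by (metis abs_le_D1 real_norm_def)
    obtain D1 D2 D3 D4 where D': "\<And>n. q (a n) \<le> D1" "\<And>n. q (b n) \<le> D2" "\<And>n. normT (L (a n)) \<le> D3" "\<And>n. normT (L (b n)) \<le> D4"
      using bounded[OF lim(1)] bounded[OF lim(2)] bounded[OF lim(3)] bounded[OF lim(4)] by metis
    define D where "D = max (max D1 D2) (max D3 D4)"
    have D: "q (a n) \<le> D" "q (b n) \<le> D" "normT (L (a n)) \<le> D" "normT (L (b n)) \<le> D" for n
      using D'[of n] by (auto simp: D_def)
    have D0: "0 \<le> D" using D(1)[of 0] q.q_nonneg order_trans by blast
    have "(\<lambda>n. normA (\<iota> (a n * b n) - x * y)) \<longlonglongrightarrow> 0"
    proof (rule Lim_null_comparison)
      have "normA (\<iota> (a n * b n) - x * y) \<le> C * normA (\<iota> (a n) - x) * q (b n) + C * normA x * normA (\<iota> (b n) - y)" for n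
      proof -
        have "\<iota> (a n * b n) - x * y = (\<iota> (a n) - x) * \<iota> (b n) + x * (\<iota> (b n) - y)"
          by (simp add: \<iota>_times algebra_simps)
        then have "normA (\<iota> (a n * b n) - x * y) \<le> normA ((\<iota> (a n) - x) * \<iota> (b n)) + normA (x * (\<iota> (b n) - y))"
          using A.add_le by simp
        also have "\<dots> \<le> C * normA (\<iota> (a n) - x) * q (b n) + C * normA x * normA (\<iota> (b n) - y)"
          unfolding q_def by (intro add_mono C(2))
        finally show ?thesis .
      qed
      then show "\<forall>\<^sub>F n in sequentially. norm (normA (\<iota> (a n * b n) - x * y))
          \<le> C * normA (\<iota> (a n) - x) * q (b n) + C * normA x * normA (\<iota> (b n) - y)"
        using A.nonneg by simp
      show "(\<lambda>n. C * normA (\<iota> (a n) - x) * q (b n) + C * normA x * normA (\<iota> (b n) - y)) \<longlonglongrightarrow> 0"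
        using tendsto_add[OF tendsto_mult[OF tendsto_mult_left[OF a(1), of C] lim(2)] tendsto_mult_left[OF b(1), of "C * normA x"]]
        by simp
    qed
    moreover have "\<exists>N. \<forall>m\<ge>N. \<forall>n\<ge>N. normT (L (a m * b m) - L (a n * b n)) < e" if e: "0 < e" for e
    proof -
      (* Four terms of size at most M * D * \<epsilon>; the 1 only prevents a division by 0. *)
      define \<epsilon> where "\<epsilon> = e / (4 * M * D + 1)"
      have MD: "0 \<le> 4 * M * D" using M D0 by simp
      have \<epsilon>: "0 < \<epsilon>" "4 * M * D * \<epsilon> < e"
        using e MD by (auto simp: \<epsilon>_def field_simps)
      obtain N1 where N1: "\<forall>m\<ge>N1. \<forall>n\<ge>N1. normA (\<iota> (a m) - \<iota> (a n)) < \<epsilon>"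
        using A.limit_Cauchy[OF _ _ a(1) \<epsilon>(1)] by auto
      obtain N2 where N2: "\<forall>m\<ge>N2. \<forall>n\<ge>N2. normT (L (a m) - L (a n)) < \<epsilon>"
        using T.limit_Cauchy[OF _ _ a(2) \<epsilon>(1)] by auto
      obtain N3 where N3: "\<forall>m\<ge>N3. \<forall>n\<ge>N3. normA (\<iota> (b m) - \<iota> (b n)) < \<epsilon>"
        using A.limit_Cauchy[OF _ _ b(1) \<epsilon>(1)] by auto
      obtain N4 where N4: "\<forall>m\<ge>N4. \<forall>n\<ge>N4. normT (L (b m) - L (b n)) < \<epsilon>"
        using T.limit_Cauchy[OF _ _ b(2) \<epsilon>(1)] by auto
      have "normT (L (a m * b m) - L (a n * b n)) < e"
        if mn: "m \<ge> N1 + N2 + N3 + N4" "n \<ge> N1 + N2 + N3 + N4" for m n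
      proof -
        let ?a = "a m - a n" and ?b = "b m - b n"
        have small: "q ?a \<le> \<epsilon>" "normT (L ?a) \<le> \<epsilon>" "q ?b \<le> \<epsilon>" "normT (L ?b) \<le> \<epsilon>"
          using N1 N2 N3 N4 mn unfolding q_def \<iota>.diff G.L.diff by (auto intro!: less_imp_le)
        have "L (a m * b m) - L (a n * b n) = L (?a * b m) + L (a n * ?b)"
          by (simp add: G.L.diff[symmetric] G.L.add[symmetric] algebra_simps)
        then have "normT (L (a m * b m) - L (a n * b n)) \<le> normT (L (?a * b m)) + normT (L (a n * ?b))"
          using T.add_le by simp
        also have "\<dots> \<le> M * (normT (L ?a) * q (b m) + q ?a * normT (L (b m)))
            + M * (normT (L (a n)) * q ?b + q (a n) * normT (L ?b))"
          by (intro add_mono M(2))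
        also have "\<dots> \<le> M * (\<epsilon> * D + \<epsilon> * D) + M * (D * \<epsilon> + D * \<epsilon>)"
          using \<epsilon>(1) D0 by (intro add_mono mult_left_mono mult_mono small D M(1) q.q_nonneg T.nonneg) auto
        also have "\<dots> = 4 * M * D * \<epsilon>" by (simp add: algebra_simps)
        finally show ?thesis using \<epsilon>(2) by simp
      qed
      then show ?thesis by blast
    qed
    ultimately obtain u where u: "(x * y, u) \<in> G.R" "(\<lambda>n. normT (L (a n * b n) - u)) \<longlonglongrightarrow> 0"
      using G.R_limit[of "\<lambda>n. a n * b n"] by blast
    have "(\<lambda>n. normT (L (a n * b n))) \<longlonglongrightarrow> normT u"
      by (rule T.norm_limit) (use u in auto)
    moreover have "(\<lambda>n. M * (normT (L (a n)) * q (b n) + q (a n) * normT (L (b n)))) \<longlonglongrightarrow> M * (normT s * normA y + normA x * normT t)"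
      by (intro tendsto_intros lim)
    ultimately have "normT u \<le> M * (normT s * normA y + normA x * normT t)"
      by (rule LIMSEQ_le) (use M(2) in auto)
    with u show ?thesis by blast
  qed
  with M(1) show ?thesis by blast
qed

text \<open>
  \<open>G.norm1 x - normA x\<close> is the norm of the closed quasiderivation at \<open>x\<close>. Unlike submultiplicativity of the
  graph norm, this form of the estimate gains a factor \<open>normA x\<close> when \<open>x\<close> is squared.
\<close>

lemma norm1_leibniz:
  "\<exists>M\<ge>0. \<forall>x\<in>A1. \<forall>y\<in>A1. x * y \<in> A1 \<and>
     G.norm1 (x * y) - normA (x * y) \<le> M * ((G.norm1 x - normA x) * normA y + normA x * (G.norm1 y - normA y))"
proof -
  obtain M where M: "0 \<le> M" "\<And>x s y t. (x, s) \<in> G.R \<Longrightarrow> (y, t) \<in> G.R \<Longrightarrow>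
     \<exists>u. (x * y, u) \<in> G.R \<and> normT u \<le> M * (normT s * normA y + normA x * normT t)"
    using R_leibniz by metis
  show ?thesis
  proof (intro exI[of _ M] conjI M(1) ballI)
    fix x y assume "x \<in> A1" "y \<in> A1"
    then obtain s t where st: "(x, s) \<in> G.R" "(y, t) \<in> G.R" by blast
    then obtain u where u: "(x * y, u) \<in> G.R" "normT u \<le> M * (normT s * normA y + normA x * normT t)"
      using M(2) by blast
    show "x * y \<in> A1" using u by blast
    show "G.norm1 (x * y) - normA (x * y) \<le> M * ((G.norm1 x - normA x) * normA y + normA x * (G.norm1 y - normA y))"
      using u(2) by (simp add: norm1_eq[OF u(1)] norm1_eq[OF st(1)] norm1_eq[OF st(2)])
  qed
qed

lemma range_A1: "\<iota> a \<in> A1"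
  using G.R_I by blast

lemma norm1_ge: "x \<in> A1 \<Longrightarrow> normA x \<le> G.norm1 x"
  by (rule G.norm1_ge[OF closable])

lemma subalgebra_A1: "unital_subalgebra scaleA A1"
proof -
  have "1 \<in> A1" using range_A1[of 1] by (simp add: \<iota>_one)
  then show ?thesis
    using norm1_leibniz G.subspace_Domain[OF closable] unfolding unital_subalgebra_def by blast
qed

lemma banach_algebra_A1: "complex_banach_algebra scaleA A1 G.norm1"
proof -
  obtain M where M: "0 \<le> M" "\<And>x y. x \<in> A1 \<Longrightarrow> y \<in> A1 \<Longrightarrow>
     G.norm1 (x * y) - normA (x * y) \<le> M * ((G.norm1 x - normA x) * normA y + normA x * (G.norm1 y - normA y))"
    using norm1_leibniz by blast
  have "G.norm1 (x * y) \<le> (C + 2 * M) * G.norm1 x * G.norm1 y" if xy: "x \<in> A1" "y \<in> A1" for x y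
  proof -
    have n: "0 \<le> normA x" "0 \<le> normA y" "normA x \<le> G.norm1 x" "normA y \<le> G.norm1 y"
      using A.nonneg norm1_ge xy by auto
    have "(G.norm1 x - normA x) * normA y \<le> G.norm1 x * G.norm1 y"
      "normA x * (G.norm1 y - normA y) \<le> G.norm1 x * G.norm1 y"
      "normA x * normA y \<le> G.norm1 x * G.norm1 y"
      using n by (auto intro!: mult_mono)
    then have "M * ((G.norm1 x - normA x) * normA y + normA x * (G.norm1 y - normA y)) \<le> M * (2 * (G.norm1 x * G.norm1 y))"
      "C * (normA x * normA y) \<le> C * (G.norm1 x * G.norm1 y)"
      using M(1) C(1) by (auto intro!: mult_left_mono)
    then show ?thesis using M(2)[OF xy] C(2)[of x y] by (simp add: algebra_simps)
  qed
  then show ?thesis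
    using banach_algebra subalgebra_A1 G.banach1[OF closable] unfolding complex_banach_algebra_def by blast
qed

lemma norm1_\<iota>: "G.norm1 (\<iota> a) = q a + uc_norm q (\<Delta> a)"
  by (simp add: norm1_eq[OF G.R_I] q_def normT_J)

lemma unconditional_A1: "unconditional_banach_algebra scaleA A1 G.norm1 \<iota>"
proof -
  have "unconditional_seminorm (\<lambda>a. G.norm1 (\<iota> a))"
    unfolding unconditional_seminorm_def seminorm_def
  proof (intro conjI allI impI)
    interpret D: cnormed scaleA A1 G.norm1
      by unfold_locales (rule G.normed1[OF closable])
    show "0 \<le> G.norm1 (\<iota> a)" for a by (rule D.nonneg[OF range_A1])
    show "G.norm1 (\<iota> (a + b)) \<le> G.norm1 (\<iota> a) + G.norm1 (\<iota> b)" for a b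
      unfolding \<iota>.add by (rule D.add_le[OF range_A1 range_A1])
    show "G.norm1 (\<iota> (cscale c a)) = cmod c * G.norm1 (\<iota> a)" for c a
      unfolding \<iota>.scale by (rule D.scale_eq[OF range_A1])
    fix a b :: "'g \<Rightarrow>\<^sub>0 complex" assume ab: "abs_le a b"
    then have "abs_le (\<Delta> a) (\<Delta> b)"
      by (auto simp: abs_le_def lookup_quasiderivation[OF gen minimal])
    then show "G.norm1 (\<iota> a) \<le> G.norm1 (\<iota> b)"
      unfolding norm1_\<iota> using ab q.q_mono q.uc_norm_mono by (intro add_mono) (auto simp: abs_le_def)
  qed
  moreover have "completion_of scaleA A1 G.norm1 \<iota> (\<lambda>a. G.norm1 (\<iota> a))"
    unfolding completion_of_def
    using G.banach1[OF closable] linear_\<iota> range_A1 G.dense1[OF closable] by auto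
  ultimately show ?thesis
    unfolding unconditional_banach_algebra_def using banach_algebra_A1 \<iota>_one \<iota>_times inj_\<iota> by blast
qed

lemma inclusion_hom: "banach_algebra_hom scaleA A1 G.norm1 scaleA UNIV normA (\<lambda>x. x)"
proof -
  have "\<exists>K. \<forall>x\<in>A1. normA x \<le> K * G.norm1 x"
    using norm1_ge by (intro exI[of _ 1]) simp
  then show ?thesis
    unfolding banach_algebra_hom_def using banach_algebra_A1 banach_algebra by simp
qed

lemma dense_A1: "norm_topology UNIV normA closure_of A1 = UNIV"
proof -
  have "norm_topology UNIV normA closure_of range \<iota> \<subseteq> norm_topology UNIV normA closure_of A1"
    by (rule closure_of_mono) (use range_A1 in auto)
  then show ?thesis unfolding dense_\<iota> by blast
qed

text \<open>
  Smallness of \<open>w\<close> in the norm of the big algebra suffices. The norms of \<open>v k = w ^ 2 ^ k\<close> decrease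
  geometrically; the norms \<open>\<tau> k\<close> of the quasiderivation at \<open>v k\<close> satisfy \<open>\<tau> (k + 1) \<le> 2 M \<parallel>v k\<parallel> \<tau> k\<close>, so
  they are eventually halved in each step. Some \<open>v k\<close> is therefore small in the graph norm.
\<close>

lemma right_inverse_A1:
  assumes w: "w \<in> A1" "C * normA w < 1"
  shows "\<exists>u\<in>A1. (1 - w) * u = 1"
proof -
  obtain M where M: "0 \<le> M" "\<And>x y. x \<in> A1 \<Longrightarrow> y \<in> A1 \<Longrightarrow>
     G.norm1 (x * y) - normA (x * y) \<le> M * ((G.norm1 x - normA x) * normA y + normA x * (G.norm1 y - normA y))"
    using norm1_leibniz by blast
  obtain C1 where C1: "\<And>x y. x \<in> A1 \<Longrightarrow> y \<in> A1 \<Longrightarrow> G.norm1 (x * y) \<le> C1 * G.norm1 x * G.norm1 y"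
    using banach_algebra_A1 unfolding complex_banach_algebra_def by blast
  define C2 where "C2 = max 1 C1"
  interpret D: cnormed scaleA A1 G.norm1
    by unfold_locales (rule G.normed1[OF closable])
  have C2: "G.norm1 (x * y) \<le> C2 * G.norm1 x * G.norm1 y" if "x \<in> A1" "y \<in> A1" for x y
    using C1[OF that] mult_right_mono[of C1 C2 "G.norm1 x * G.norm1 y"] D.nonneg that
    by (simp add: C2_def mult.assoc)
  define v where "v k = w ^ (2 ^ k)" for k :: nat
  have v_Suc: "v (Suc k) = v k * v k" for k
    by (simp add: v_def power_add[symmetric] mult_2)
  have v_in: "v k \<in> A1" for k
  proof (induction k)
    case (Suc k)
    then show ?case using subalgebra_A1 unfolding v_Suc unital_subalgebra_def by blast
  qed (simp add: v_def w)
  define r where "r = C * normA w"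
  have r: "0 \<le> r" "r < 1" using w C(1) A.nonneg by (auto simp: r_def)
  have v_norm: "C * normA (v k) \<le> r ^ Suc k" for k
  proof (induction k)
    case (Suc k)
    have "C * normA (v (Suc k)) \<le> C * (C * normA (v k) * normA (v k))"
      unfolding v_Suc using C by (intro mult_left_mono) auto
    also have "\<dots> = (C * normA (v k)) * (C * normA (v k))" by simp
    also have "\<dots> \<le> r ^ Suc k * r ^ Suc k"
      using C(1) A.nonneg r by (intro mult_mono Suc) auto
    also have "\<dots> \<le> r ^ Suc k * r"
      using r power_le_one[of r k] by (intro mult_left_mono) (auto intro: mult_left_le)
    finally show ?case by (simp add: mult_ac)
  qed (simp add: r_def v_def)
  have v_le: "normA (v k) \<le> r ^ Suc k" for k
    using v_norm[of k] mult_right_mono[OF C(1), of "normA (v k)"] A.nonneg by simp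
  define \<tau> where "\<tau> k = G.norm1 (v k) - normA (v k)" for k
  have \<tau>0: "0 \<le> \<tau> k" for k using norm1_ge[OF v_in] by (simp add: \<tau>_def)
  have \<tau>_Suc: "\<tau> (Suc k) \<le> (2 * M * normA (v k)) * \<tau> k" for k
    using M(2)[OF v_in v_in, of k k] by (simp add: \<tau>_def v_Suc algebra_simps)
  have rlim: "(\<lambda>k. 2 * M * r ^ Suc k) \<longlonglongrightarrow> 0"
    using tendsto_mult_right_zero[OF LIMSEQ_Suc[OF LIMSEQ_realpow_zero[OF r]], of "2 * M"] by simp
  then have "\<forall>\<^sub>F k in sequentially. 2 * M * r ^ Suc k < 1 / 2"
    by (rule order_tendstoD) simp
  then obtain K where K: "\<And>k. k \<ge> K \<Longrightarrow> 2 * M * r ^ Suc k < 1 / 2"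
    by (auto simp: eventually_sequentially)
  (* From K on, the factor 2 * M * normA (v k) is at most 1 / 2. *)
  have \<tau>_half: "\<tau> (K + j) \<le> \<tau> K * (1 / 2) ^ j" for j
  proof (induction j)
    case (Suc j)
    have "2 * M * normA (v (K + j)) \<le> 2 * M * r ^ Suc (K + j)"
      using v_le M(1) by (intro mult_left_mono) auto
    also have "\<dots> \<le> 1 / 2" using K[of "K + j"] by simp
    finally have "\<tau> (Suc (K + j)) \<le> 1 / 2 * \<tau> (K + j)"
      using \<tau>_Suc[of "K + j"] mult_right_mono[OF _ \<tau>0[of "K + j"]] by (meson order_trans)
    then show ?case using Suc by simp
  qed simp
  have half: "(\<lambda>j. (1 / 2 :: real) ^ j) \<longlonglongrightarrow> 0" by (rule LIMSEQ_realpow_zero) auto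
  have rK: "(\<lambda>j. r ^ Suc (K + j)) \<longlonglongrightarrow> 0"
    using LIMSEQ_ignore_initial_segment[OF LIMSEQ_realpow_zero[OF r], of "Suc K"] by (simp add: ac_simps)
  have "(\<lambda>j. C2 * (\<tau> K * (1 / 2) ^ j + r ^ Suc (K + j))) \<longlonglongrightarrow> C2 * (\<tau> K * 0 + 0)"
    by (rule tendsto_mult_left[OF tendsto_add[OF tendsto_mult_left[OF half] rK]])
  then have "\<forall>\<^sub>F j in sequentially. C2 * (\<tau> K * (1 / 2) ^ j + r ^ Suc (K + j)) < 1"
    by (intro order_tendstoD) auto
  then obtain j where j: "C2 * (\<tau> K * (1 / 2) ^ j + r ^ Suc (K + j)) < 1"
    by (auto simp: eventually_sequentially)
  have "C2 * G.norm1 (v (K + j)) \<le> C2 * (\<tau> K * (1 / 2) ^ j + r ^ Suc (K + j))"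
    using \<tau>_half[of j] v_le[of "K + j"] by (intro mult_left_mono) (auto simp: \<tau>_def C2_def)
  then have "C2 * G.norm1 (v (K + j)) < 1" using j by simp
  then have "\<exists>u\<in>A1. (1 - v (K + j)) * u = 1"
    by (intro neumann_right_inverse[OF banach_algebra_A1 C2 _ v_in]) (auto simp: C2_def)
  then show ?thesis
    using right_inverse_of_squaring[OF subalgebra_A1 _ w(1), of "K + j"] A.subspace_add[OF D.carrier]
    by (simp add: v_def)
qed

text \<open>
  With \<open>z\<close> in the group ring close to the inverse \<open>v\<close> of \<open>y\<close>, the product \<open>y z\<close> has a right inverse \<open>u\<close> in
  the subalgebra, and \<open>v = v (y z u) = z u\<close>.
\<close>

lemma inverse_in_A1:
  assumes y: "y \<in> A1" and v: "v * y = 1" "y * v = 1"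
  shows "v \<in> A1"
proof -
  (* One factor C comes from the product y * (v - z), the other from the condition on w in right_inverse_A1. *)
  define e where "e = 1 / (C * C * normA y + 1)"
  have c: "0 \<le> C * C * normA y" using C(1) A.nonneg by simp
  then have e: "0 < e" "C * C * normA y * e < 1" by (auto simp: e_def field_simps)
  have "v \<in> norm_topology UNIV normA closure_of range \<iota>" using dense_\<iota> by simp
  then obtain a where a: "normA (v - \<iota> a) < e" using e(1) A.closure_iff[of "range \<iota>" v] by auto
  define z where "z = \<iota> a"
  define w where "w = 1 - y * z"
  have z: "z \<in> A1" by (simp add: z_def range_A1)
  interpret D: cnormed scaleA A1 G.norm1
    by unfold_locales (rule G.normed1[OF closable])
  have times: "s \<in> A1 \<Longrightarrow> t \<in> A1 \<Longrightarrow> s * t \<in> A1" and one: "1 \<in> A1" for s t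
    using subalgebra_A1 unfolding unital_subalgebra_def by auto
  have "w = y * (v - z)" by (simp add: w_def right_diff_distrib v)
  then have "C * normA w \<le> C * (C * normA y * normA (v - z))"
    using C by (intro mult_left_mono) auto
  also have "\<dots> \<le> C * C * normA y * e"
    using mult_left_mono[OF less_imp_le[OF a] c] by (simp add: z_def mult_ac)
  finally have "C * normA w < 1" using e(2) by simp
  moreover have "w \<in> A1" unfolding w_def by (intro D.diff_in one times y z)
  ultimately obtain u where u: "u \<in> A1" "(1 - w) * u = 1" using right_inverse_A1 by blast
  have "v = v * (y * z * u)" using u(2) by (simp add: w_def)
  also have "\<dots> = z * u" using v(1) by (metis mult.assoc mult_1)
  finally show ?thesis using times z u(1) by simp
qed

lemma holomorphically_closed_A1: "holomorphically_closed scaleA A1 UNIV"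
  unfolding holomorphically_closed_def
proof
  fix x assume x: "x \<in> A1"
  interpret D: cnormed scaleA A1 G.norm1
    by unfold_locales (rule G.normed1[OF closable])
  have "1 \<in> A1" using subalgebra_A1 unfolding unital_subalgebra_def by blast
  then have "x - scaleA c 1 \<in> A1" for c
    using x D.carrier A.subspace_scale D.diff_in by blast
  then show "spectrum_in scaleA A1 x = spectrum_in scaleA UNIV x"
    unfolding spectrum_in_def using inverse_in_A1 by blast
qed

end

theorem theorem3p5:
  fixes scaleA :: "complex \<Rightarrow> 'a::ring_1 \<Rightarrow> 'a"
    and normA :: "'a \<Rightarrow> real"
    and \<iota> :: "('g::group_add \<Rightarrow>\<^sub>0 complex) \<Rightarrow> 'a"
    and scaleT :: "complex \<Rightarrow> 't::ab_group_add \<Rightarrow> 't"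
    and normT :: "'t \<Rightarrow> real"
    and tens :: "'a \<Rightarrow> 'a \<Rightarrow> 't"
  assumes "word_hyperbolic TYPE('g)"
    and "unconditional_banach_algebra scaleA UNIV normA \<iota>"
    and "uc_tensor_completion scaleA normA \<iota> scaleT normT tens"
  shows
    "let cl = quasiderivation_closure normA \<iota> scaleT normT tens;
         A1 = (\<lambda>\<sigma>. Domain (cl \<sigma>));
         norm1 = (\<lambda>\<sigma>. graph_norm normA normT (cl \<sigma>))
     in
       \<comment> \<open>(a)\<close>
       (\<forall>S \<sigma>. fin_sym_generating S \<and> minimal_presentation S \<sigma> \<longrightarrow> single_valued (cl \<sigma>)) \<and>
       \<comment> \<open>(b)\<close>
       (\<forall>S \<sigma> S' \<sigma>'. fin_sym_generating S \<and> minimal_presentation S \<sigma> \<and>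
            fin_sym_generating S' \<and> minimal_presentation S' \<sigma>' \<longrightarrow>
          A1 \<sigma> = A1 \<sigma>' \<and> equivalent_norms (A1 \<sigma>) (norm1 \<sigma>) (norm1 \<sigma>')) \<and>
       \<comment> \<open>(c)\<close>
       (\<forall>S \<sigma>. fin_sym_generating S \<and> minimal_presentation S \<sigma> \<longrightarrow>
          unconditional_banach_algebra scaleA (A1 \<sigma>) (norm1 \<sigma>) \<iota>) \<and>
       \<comment> \<open>(d)\<close>
       (\<forall>S \<sigma>. fin_sym_generating S \<and> minimal_presentation S \<sigma> \<longrightarrow>
          banach_algebra_hom scaleA (A1 \<sigma>) (norm1 \<sigma>) scaleA UNIV normA (\<lambda>x. x) \<and>
          unital_subalgebra scaleA (A1 \<sigma>) \<and>
          norm_topology UNIV normA closure_of (A1 \<sigma>) = UNIV \<and>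
          holomorphically_closed scaleA (A1 \<sigma>) UNIV)"
proof -
  interpret uc_tensor_algebra scaleA normA \<iota> scaleT normT tens
    by unfold_locales (fact assms)+
  have loc: "hyperbolic_quasiderivation scaleA normA \<iota> scaleT normT tens S \<sigma>"
    if "fin_sym_generating S" "minimal_presentation S \<sigma>" for S \<sigma>
    by unfold_locales (fact that assms)+
  show ?thesis
    unfolding Let_def
  proof (intro conjI allI impI; elim conjE)
    fix S :: "'g set" and \<sigma>
    assume "fin_sym_generating S" "minimal_presentation S \<sigma>"
    then interpret hyperbolic_quasiderivation scaleA normA \<iota> scaleT normT tens S \<sigma> by (rule loc)
    show "single_valued (quasiderivation_closure normA \<iota> scaleT normT tens \<sigma>)"
      unfolding closure_eq by (rule closable)
    show "unconditional_banach_algebra scaleA (Domain (quasiderivation_closure normA \<iota> scaleT normT tens \<sigma>))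
        (graph_norm normA normT (quasiderivation_closure normA \<iota> scaleT normT tens \<sigma>)) \<iota>"
      unfolding closure_eq by (rule unconditional_A1)
    show "banach_algebra_hom scaleA (Domain (quasiderivation_closure normA \<iota> scaleT normT tens \<sigma>))
        (graph_norm normA normT (quasiderivation_closure normA \<iota> scaleT normT tens \<sigma>)) scaleA UNIV normA (\<lambda>x. x)"
      unfolding closure_eq by (rule inclusion_hom)
    show "unital_subalgebra scaleA (Domain (quasiderivation_closure normA \<iota> scaleT normT tens \<sigma>))"
      unfolding closure_eq by (rule subalgebra_A1)
    show "norm_topology UNIV normA closure_of (Domain (quasiderivation_closure normA \<iota> scaleT normT tens \<sigma>)) = UNIV"
      unfolding closure_eq by (rule dense_A1)
    show "holomorphically_closed scaleA (Domain (quasiderivation_closure normA \<iota> scaleT normT tens \<sigma>)) UNIV"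
      unfolding closure_eq by (rule holomorphically_closed_A1)
    fix S' :: "'g set" and \<sigma>'
    assume S': "fin_sym_generating S'" "minimal_presentation S' \<sigma>'"
    then interpret O: hyperbolic_quasiderivation scaleA normA \<iota> scaleT normT tens S' \<sigma>' by (rule loc)
    obtain K where K: "1 \<le> K" "\<And>x. x \<in> O.A1 \<Longrightarrow> x \<in> A1 \<and> G.norm1 x \<le> K * O.G.norm1 x"
      using norm1_comparison[OF S'] unfolding O.closure_eq by blast
    obtain K' where K': "1 \<le> K'" "\<And>x. x \<in> A1 \<Longrightarrow> x \<in> O.A1 \<and> O.G.norm1 x \<le> K' * G.norm1 x"
      using O.norm1_comparison[OF gen minimal] unfolding closure_eq by blast
    have eq: "A1 = O.A1" using K K' by blast
    show "Domain (quasiderivation_closure normA \<iota> scaleT normT tens \<sigma>) = Domain (quasiderivation_closure normA \<iota> scaleT normT tens \<sigma>')"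
      unfolding closure_eq O.closure_eq by (rule eq)
    show "equivalent_norms (Domain (quasiderivation_closure normA \<iota> scaleT normT tens \<sigma>))
        (graph_norm normA normT (quasiderivation_closure normA \<iota> scaleT normT tens \<sigma>))
        (graph_norm normA normT (quasiderivation_closure normA \<iota> scaleT normT tens \<sigma>'))"
      unfolding closure_eq O.closure_eq equivalent_norms_def
    proof (intro exI[of _ "max K K'"] ballI)
      fix x assume x: "x \<in> A1"
      have "0 \<le> G.norm1 x" "0 \<le> O.G.norm1 x"
        using norm1_ge[OF x] O.norm1_ge x eq A.nonneg[of x] by force+
      then have "K * O.G.norm1 x \<le> max K K' * O.G.norm1 x" "K' * G.norm1 x \<le> max K K' * G.norm1 x"
        by (intro mult_right_mono; simp)+
      then show "G.norm1 x \<le> max K K' * O.G.norm1 x \<and> O.G.norm1 x \<le> max K K' * G.norm1 x"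
        using K K' x eq by force
    qed
  qed
qed

end
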